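(* Let $G$ be a totally disconnected second countable locally compact group. The following are equivalent: (i) $G$ has Property $(T_{\ell_p})$ for some $1<p<\infty$, $p\neq2$; (ii) $G$ has Property $(T;\mathcal R_{\rm quasi\text{-}reg})$, where $\mathcal R_{\rm quasi\text{-}reg}$ is the set of quasi-regular representations $(\lambda_{G/H},\ell_2(G/H))$ associated to open subgroups $H$ of $G$.
   Context: All Banach spaces are complex; $\ell_p=\ell_p(\mathbf N)$, $q$ the conjugate exponent, $\mathbf O(\ell_p)$ the group of linear bijective isometries. An orthogonal representation of $G$ on $\ell_p$ is a strongly continuous homomorphism $\pi:G\to\mathbf O(\ell_p)$. A sequence of almost invariant vectors is a sequence of unit vectors $f_n$ with $\|\pi(g)f_n-f_n\|\to0$ uniformly on compact subsets of $G$. With $\pi^*$ the dual representation on $\ell_q$, $\ell'_p(\pi)$ is the annihilator in $\ell_p$ of the $\pi^*(G)$-invariant vectors of $\ell_q$. $G$ has Property $(T_{\ell_p})$ if for no orthogonal representation $\pi$ on $\ell_p$ does $\ell'_p(\pi)$ contain a sequence of almost invariant vectors. For a set $\mathcal R$ of unitary representations, $G$ has Property $(T;\mathcal R)$ if $1_G$ is not weakly contained in $\bigoplus_{\pi\in\mathcal R}\pi'$, where $\pi'$ is the restriction of $\pi$ to the orthogonal complement of its invariant vectors. $\lambda_{G/H}$ is the representation of $G$ on $\ell_2(G/H)$ by left translations: $\lambda_{G/H}(g)f(x)=f(g^{-1}x)$. *)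

theory Defs
  imports "HOL-Analysis.Analysis"
begin

(* The group G is the whole type 'g, a topological group written additively
   (group_add does NOT assume commutativity). *)

definition lp_space :: "real \<Rightarrow> (nat \<Rightarrow> complex) set" where
  "lp_space p = {f. summable (\<lambda>n. cmod (f n) powr p)}"

definition lp_norm :: "real \<Rightarrow> (nat \<Rightarrow> complex) \<Rightarrow> real" where
  "lp_norm p f = (\<Sum>n. cmod (f n) powr p) powr (1 / p)"

definition conj_exp :: "real \<Rightarrow> real" where
  "conj_exp p = p / (p - 1)"

definition lp_pair :: "(nat \<Rightarrow> complex) \<Rightarrow> (nat \<Rightarrow> complex) \<Rightarrow> complex" where
  "lp_pair f \<psi> = (\<Sum>n. f n * \<psi> n)"

definition lp_isometry :: "real \<Rightarrow> ((nat \<Rightarrow> complex) \<Rightarrow> (nat \<Rightarrow> complex)) \<Rightarrow> bool" where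
  "lp_isometry p T \<longleftrightarrow>
     bij_betw T (lp_space p) (lp_space p) \<and>
     (\<forall>f\<in>lp_space p. \<forall>h\<in>lp_space p. \<forall>a b::complex.
        T (\<lambda>n. a * f n + b * h n) = (\<lambda>n. a * T f n + b * T h n)) \<and>
     (\<forall>f\<in>lp_space p. lp_norm p (T f) = lp_norm p f)"

definition orth_rep_lp ::
  "real \<Rightarrow> ('g::topological_group_add \<Rightarrow> (nat \<Rightarrow> complex) \<Rightarrow> (nat \<Rightarrow> complex)) \<Rightarrow> bool" where
  "orth_rep_lp p \<pi> \<longleftrightarrow>
     (\<forall>g. lp_isometry p (\<pi> g)) \<and>
     (\<forall>f\<in>lp_space p. \<pi> 0 f = f) \<and>
     (\<forall>g h. \<forall>f\<in>lp_space p. \<pi> (g + h) f = \<pi> g (\<pi> h f)) \<and>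
     (\<forall>f\<in>lp_space p. \<forall>g0. ((\<lambda>g. lp_norm p (\<pi> g f - \<pi> g0 f)) \<longlongrightarrow> 0) (at g0))"

(* psi in ell_q is invariant under the dual representation pi^*:
   <f, pi^*(g) psi> = <pi(g^-1) f, psi> = <f, psi> for all f, g *)
definition dual_invariant ::
  "real \<Rightarrow> ('g::group_add \<Rightarrow> (nat \<Rightarrow> complex) \<Rightarrow> (nat \<Rightarrow> complex)) \<Rightarrow> (nat \<Rightarrow> complex) \<Rightarrow> bool" where
  "dual_invariant p \<pi> \<psi> \<longleftrightarrow>
     \<psi> \<in> lp_space (conj_exp p) \<and>
     (\<forall>g. \<forall>f\<in>lp_space p. lp_pair (\<pi> (- g) f) \<psi> = lp_pair f \<psi>)"

definition lp_prime ::
  "real \<Rightarrow> ('g::group_add \<Rightarrow> (nat \<Rightarrow> complex) \<Rightarrow> (nat \<Rightarrow> complex)) \<Rightarrow> (nat \<Rightarrow> complex) set" where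
  "lp_prime p \<pi> = {f \<in> lp_space p. \<forall>\<psi>. dual_invariant p \<pi> \<psi> \<longrightarrow> lp_pair f \<psi> = 0}"

definition almost_invariant_seq ::
  "real \<Rightarrow> ('g::topological_space \<Rightarrow> (nat \<Rightarrow> complex) \<Rightarrow> (nat \<Rightarrow> complex))
     \<Rightarrow> (nat \<Rightarrow> nat \<Rightarrow> complex) \<Rightarrow> bool" where
  "almost_invariant_seq p \<pi> F \<longleftrightarrow>
     (\<forall>n. F n \<in> lp_space p \<and> lp_norm p (F n) = 1) \<and>
     (\<forall>K. compact K \<longrightarrow> (\<forall>\<epsilon>>0. eventually (\<lambda>n. \<forall>g\<in>K. lp_norm p (\<pi> g (F n) - F n) < \<epsilon>) sequentially))"

definition property_T_lp :: "real \<Rightarrow> 'g::topological_group_add itself \<Rightarrow> bool" where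
  "property_T_lp p _ \<longleftrightarrow>
     \<not> (\<exists>(\<pi> :: 'g \<Rightarrow> (nat \<Rightarrow> complex) \<Rightarrow> (nat \<Rightarrow> complex)) F.
          orth_rep_lp p \<pi> \<and> (\<forall>n. F n \<in> lp_prime p \<pi>) \<and> almost_invariant_seq p \<pi> F)"

definition open_subgroup :: "'g::{topological_space, group_add} set \<Rightarrow> bool" where
  "open_subgroup H \<longleftrightarrow> open H \<and> 0 \<in> H \<and> (\<forall>x\<in>H. \<forall>y\<in>H. x + y \<in> H) \<and> (\<forall>x\<in>H. - x \<in> H)"

definition left_cosets :: "'g::group_add set \<Rightarrow> 'g set set" where
  "left_cosets H = {((+) g) ` H | g. True}"

definition quasi_reg :: "'g::group_add \<Rightarrow> ('g set \<Rightarrow> complex) \<Rightarrow> ('g set \<Rightarrow> complex)" where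
  "quasi_reg g \<xi> = (\<lambda>x. \<xi> ((+) (- g) ` x))"

definition l2_cosets :: "'g::group_add set \<Rightarrow> ('g set \<Rightarrow> complex) set" where
  "l2_cosets H = {\<xi>. (\<forall>x. x \<notin> left_cosets H \<longrightarrow> \<xi> x = 0) \<and>
                     (\<lambda>x. (cmod (\<xi> x))\<^sup>2) summable_on left_cosets H}"

definition l2_inner :: "'g::group_add set \<Rightarrow> ('g set \<Rightarrow> complex) \<Rightarrow> ('g set \<Rightarrow> complex) \<Rightarrow> complex" where
  "l2_inner H \<xi> \<eta> = infsum (\<lambda>x. \<xi> x * cnj (\<eta> x)) (left_cosets H)"

definition l2_cosets_prime :: "'g::group_add set \<Rightarrow> ('g set \<Rightarrow> complex) set" where
  "l2_cosets_prime H = {\<xi> \<in> l2_cosets H. \<forall>\<eta> \<in> l2_cosets H.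
      (\<forall>g. quasi_reg g \<eta> = \<eta>) \<longrightarrow> l2_inner H \<xi> \<eta> = 0}"

definition dirsum_space :: "('g::{topological_space, group_add} set \<Rightarrow> 'g set \<Rightarrow> complex) set" where
  "dirsum_space = {\<Xi>. (\<forall>H. open_subgroup H \<longrightarrow> \<Xi> H \<in> l2_cosets_prime H) \<and>
                       (\<forall>H. \<not> open_subgroup H \<longrightarrow> \<Xi> H = (\<lambda>_. 0)) \<and>
                       (\<lambda>H. infsum (\<lambda>x. (cmod (\<Xi> H x))\<^sup>2) (left_cosets H)) summable_on {H. open_subgroup H}}"

definition dirsum_coeff :: "('g::{topological_space, group_add} set \<Rightarrow> 'g set \<Rightarrow> complex) \<Rightarrow> 'g \<Rightarrow> complex" where
  "dirsum_coeff \<Xi> g = infsum (\<lambda>H. l2_inner H (quasi_reg g (\<Xi> H)) (\<Xi> H)) {H. open_subgroup H}"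

(* 1_G weakly contained in the direct sum: every function of positive type
   associated with 1_G (i.e. every constant c \<ge> 0) is a limit, uniformly on
   compact sets, of finite sums of functions of positive type associated with it *)
definition trivial_weakly_contained_quasi_reg :: "'g::{topological_space, group_add} itself \<Rightarrow> bool" where
  "trivial_weakly_contained_quasi_reg _ \<longleftrightarrow>
     (\<forall>c::real. c \<ge> 0 \<longrightarrow> (\<forall>K::'g set. compact K \<longrightarrow> (\<forall>\<epsilon>>0.
        \<exists>(n::nat) (\<Xi> :: nat \<Rightarrow> 'g set \<Rightarrow> 'g set \<Rightarrow> complex).
          (\<forall>i<n. \<Xi> i \<in> dirsum_space) \<and>
          (\<forall>g\<in>K. cmod (complex_of_real c - (\<Sum>i<n. dirsum_coeff (\<Xi> i) g)) < \<epsilon>))))"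

definition property_T_quasi_reg :: "'g::{topological_space, group_add} itself \<Rightarrow> bool" where
  "property_T_quasi_reg G \<longleftrightarrow> \<not> trivial_weakly_contained_quasi_reg G"

definition totally_disconnected_group :: "'g::topological_space itself \<Rightarrow> bool" where
  "totally_disconnected_group _ \<longleftrightarrow> (\<forall>x::'g. connected_component_set UNIV x = {x})"

end

theory Submission
  imports Defs
begin

text \<open>
  The open stabilizers of a continuous action on a countable set tie orthogonal representations
  on \<open>l_p\<close> to quasi-regular representations, and the Mazur map
  \<open>a \<mapsto> \<bar>a\<bar> powr (p/q - 1) * a\<close> carries almost invariant vectors from \<open>l_p\<close> to \<open>l_q\<close>
  uniformly continuously in both directions.

  If the trivial representation is weakly contained in the quasi-regular ones, countably many
  finite families of almost invariant vectors are placed on one countable disjoint union of coset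
  spaces; the Mazur map transports them to the permutation representation on \<open>l_p\<close>, and
  subtracting orbit means puts them into the annihilator of the dual invariants without losing
  more than a fixed proportion of the norm.

  Conversely, an isometry of \<open>l_4\<close> permutes coordinates up to unimodular factors, so a
  representation is given by an action on \<open>\<nat>\<close> and a cocycle.  By van Dantzig's theorem the
  cocycle is locally constant, hence the action extends with open stabilizers to
  \<open>\<nat> \<times> \<complex>\<close>, by twisting the second coordinate with the cocycle.  On infinite orbits
  of the extended action, amenability of the circle group lets one replace a vector \<open>f\<close> by
  \<open>\<bar>f\<bar>\<close> times an almost invariant function of the second coordinate; on finite orbits \<open>f\<close> is
  compared with its mean.  A spectral gap for the quasi-regular representations therefore
  moves every almost invariant vector of \<open>l_4\<close> close to an invariant one.
\<close>

section \<open>The Mazur map and \<open>p\<close>-summable functions\<close>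

text \<open>The statement asks for one exponent only, and 4 is chosen because there the
  classification of isometries rests on a polynomial identity. The obstacle is that the spectral gap
  concerns permutation actions, while a monomial representation carries phases. Replacing
  \<open>f\<close> by \<open>z * f x\<close> on pairs \<open>(x, z)\<close> removes the phases
  exactly, but over an infinite fibre this is not square-summable; hence the separate treatment of
  infinite twisted orbits, where in exchange no condition of vanishing mean arises. In the other
  direction the Mazur map, being nonlinear, does not preserve orthogonality to the invariant
  vectors, and this is why means must be subtracted after the transport; that enough norm survives
  is seen back in l_2, where a vector orthogonal to all invariant ones stays away from each of them.
  All estimates are for \<open>psum\<close>, the p-th power of the norm. It is additive over orbits
  but satisfies the triangle inequality only up to the factor 2^p, which produces the
  constants.\<close>

definition mazur :: "real \<Rightarrow> complex \<Rightarrow> complex" where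
  "mazur r a = of_real (cmod a powr (r - 1)) * a"

lemma norm_mazur [simp]: "cmod (mazur r a) = cmod a powr r"
  by (cases "a = 0") (auto simp: mazur_def norm_mult powr_mult_base mult.commute[of _ "cmod a"])

lemma mazur_0 [simp]: "mazur r 0 = 0"
  by (simp add: mazur_def)

lemma mazur_inverse: "r \<noteq> 0 \<Longrightarrow> mazur (1 / r) (mazur r a) = a"
proof (cases "a = 0")
  case False
  assume "r \<noteq> 0"
  have "(cmod a powr r) powr (1 / r - 1) * cmod a powr (r - 1) = 1"
    using False \<open>r \<noteq> 0\<close> by (simp add: powr_powr powr_add[symmetric] right_diff_distrib)
  moreover have "mazur (1 / r) (mazur r a)
      = of_real ((cmod a powr r) powr (1 / r - 1) * cmod a powr (r - 1)) * a"
    by (subst mazur_def) (simp add: mazur_def[of r a] norm_mult flip: norm_mazur)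
  ultimately show ?thesis
    by simp
qed simp

lemma mazur_scale: "t \<ge> 0 \<Longrightarrow> mazur r (of_real t * a) = of_real (t powr r) * mazur r a"
  using powr_mult_base[of t "r - 1"]
  by (cases "t = 0") (auto simp: mazur_def norm_mult powr_mult mult.commute mult.left_commute
        simp flip: of_real_mult)

lemma mazur_unimodular: "cmod z = 1 \<Longrightarrow> mazur r (z * a) = z * mazur r a"
  by (simp add: mazur_def norm_mult)

lemma continuous_on_mazur:
  assumes "r > 0"
  shows "continuous_on UNIV (mazur r)"
proof -
  have "isCont (mazur r) a" for a
  \<comment> \<open>Near 0 the factor \<open>cmod a powr (r - 1)\<close> is unbounded when
    \<open>r < 1\<close>, so continuity there is read off from the modulus
    \<open>cmod a powr r\<close>.\<close>
  proof (cases "a = 0")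
    case True
    have "((\<lambda>x. cmod x powr r) \<longlongrightarrow> cmod 0 powr r) (at 0)"
      by (rule tendsto_powr2) (use assms in \<open>auto intro!: tendsto_eq_intros\<close>)
    then have "((\<lambda>x. cmod (mazur r x)) \<longlongrightarrow> 0) (at 0)"
      by simp
    then have "(mazur r \<longlongrightarrow> 0) (at 0)"
      by (rule tendsto_norm_zero_cancel)
    then show ?thesis
      using True by (simp add: isCont_def)
  next
    case False
    then show ?thesis
      unfolding mazur_def by (intro continuous_intros) auto
  qed
  then show ?thesis
    by (simp add: continuous_on_eq_continuous_at)
qed

text \<open>Both sides are homogeneous of degree \<open>p\<close>, so it suffices to treat the unit bidisc,
  where uniform continuity applies.\<close>

lemma mazur_diff_bound:
  assumes "p > 0" "q > 0" "\<epsilon> > 0"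
  shows "\<exists>C>0. \<forall>a b. cmod (mazur (p / q) a - mazur (p / q) b) powr q
           \<le> \<epsilon> * (cmod a powr p + cmod b powr p) + C * cmod (a - b) powr p"
proof -
  define r where "r = p / q"
  have r: "r > 0" "r * q = p"
    using assms by (auto simp: r_def)
  have "uniformly_continuous_on (cball 0 1) (mazur r)"
    by (intro compact_uniformly_continuous continuous_on_subset[OF continuous_on_mazur]) (use r in auto)
  then obtain d where d: "d > 0"
    "\<And>a b. \<lbrakk>cmod a \<le> 1; cmod b \<le> 1; cmod (a - b) < d\<rbrakk>
       \<Longrightarrow> cmod (mazur r a - mazur r b) < \<epsilon> powr (1 / q)"
    using assms unfolding uniformly_continuous_on_def
    by (metis dist_commute dist_norm mem_cball_0 powr_gt_zero less_irrefl)
  \<comment> \<open>Chosen so that C * d^p equals 2^q, which bounds the left-hand side on the whole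
    unit bidisc; this settles the pairs at distance at least \<open>d\<close>.\<close>
  define C where "C = 2 powr q / d powr p"
  have "C > 0"
    using d by (simp add: C_def)
  have unit: "cmod (mazur r a - mazur r b) powr q \<le> \<epsilon> + C * cmod (a - b) powr p"
    if ab: "cmod a \<le> 1" "cmod b \<le> 1" for a b
  proof (cases "cmod (a - b) < d")
    case True
    then have "cmod (mazur r a - mazur r b) powr q \<le> (\<epsilon> powr (1 / q)) powr q"
      using d(2)[of a b] ab assms by (intro powr_mono2) auto
    also have "\<dots> = \<epsilon>"
      using assms by (simp add: powr_powr)
    finally show ?thesis
      using \<open>C > 0\<close> by (smt (verit) mult_nonneg_nonneg powr_ge_zero)
  next
    case False
    have "cmod (mazur r a) \<le> 1" "cmod (mazur r b) \<le> 1"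
      using ab r powr_mono2[of r "cmod a" 1] powr_mono2[of r "cmod b" 1] by auto
    then have "cmod (mazur r a - mazur r b) \<le> 2"
      using norm_triangle_ineq4[of "mazur r a" "mazur r b"] by linarith
    then have "cmod (mazur r a - mazur r b) powr q \<le> 2 powr q"
      using assms by (intro powr_mono2) auto
    also have "\<dots> = C * d powr p"
      using d by (simp add: C_def)
    also have "\<dots> \<le> C * cmod (a - b) powr p"
      using False \<open>C > 0\<close> d assms by (intro mult_left_mono powr_mono2) auto
    finally show ?thesis
      using assms by linarith
  qed
  have "cmod (mazur r a - mazur r b) powr q
      \<le> \<epsilon> * (cmod a powr p + cmod b powr p) + C * cmod (a - b) powr p" for a b
  proof (cases "a = 0 \<and> b = 0")
    case False
    define s where "s = max (cmod a) (cmod b)"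
    have s: "s > 0"
      using False by (auto simp: s_def less_max_iff_disj)
    define a' b' where "a' = a / of_real s" and "b' = b / of_real s"
    have ab: "a = of_real s * a'" "b = of_real s * b'"
      using s by (auto simp: a'_def b'_def)
    have "cmod a' \<le> 1" "cmod b' \<le> 1"
      using s by (auto simp: a'_def b'_def norm_divide s_def)
    note u = unit[OF this]
    have "mazur r a - mazur r b = of_real (s powr r) * (mazur r a' - mazur r b')"
      using s by (simp add: ab mazur_scale right_diff_distrib)
    then have "cmod (mazur r a - mazur r b) powr q = s powr p * cmod (mazur r a' - mazur r b') powr q"
      using s r by (simp add: norm_mult powr_mult powr_powr)
    also have "\<dots> \<le> s powr p * (\<epsilon> + C * cmod (a' - b') powr p)"
      using u by (intro mult_left_mono) auto
    also have "\<dots> = \<epsilon> * s powr p + C * (s * cmod (a' - b')) powr p"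
      using s by (simp add: powr_mult algebra_simps)
    also have "s * cmod (a' - b') = cmod (a - b)"
      using s by (simp add: ab norm_mult flip: right_diff_distrib)
    also have "s powr p \<le> cmod a powr p + cmod b powr p"
      by (simp add: s_def max_def)
    finally show ?thesis
      using assms by simp
  qed simp
  then show ?thesis
    using \<open>C > 0\<close> unfolding r_def by blast
qed

text \<open>This crude substitute for Minkowski's inequality holds for every \<open>p > 0\<close>
  alike; for p = 2 and p = 4 it is the source of the factors 4 and 16 below.\<close>

lemma norm_add_powr_le:
  fixes a b :: "'a::real_normed_vector"
  assumes "p > 0"
  shows "norm (a + b) powr p \<le> 2 powr p * (norm a powr p + norm b powr p)"
proof -
  have "norm (a + b) \<le> 2 * max (norm a) (norm b)"
    using norm_triangle_ineq[of a b] by linarith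
  then have "norm (a + b) powr p \<le> (2 * max (norm a) (norm b)) powr p"
    using assms by (intro powr_mono2) auto
  also have "\<dots> = 2 powr p * max (norm a) (norm b) powr p"
    by (simp add: powr_mult)
  also have "\<dots> \<le> 2 powr p * (norm a powr p + norm b powr p)"
    by (intro mult_left_mono) (auto simp: max_def)
  finally show ?thesis .
qed

text \<open>The index type is arbitrary because the same sums are taken over the naturals, over sets
  of cosets and over pairs. No root is taken, so that masses add over disjoint supports.\<close>

definition psummable :: "real \<Rightarrow> ('a \<Rightarrow> complex) \<Rightarrow> bool" where
  "psummable p f \<longleftrightarrow> (\<lambda>x. cmod (f x) powr p) summable_on UNIV"

definition psum :: "real \<Rightarrow> ('a \<Rightarrow> complex) \<Rightarrow> real" where
  "psum p f = (\<Sum>\<^sub>\<infinity>x. cmod (f x) powr p)"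

lemma psum_nonneg [simp]: "psum p f \<ge> 0"
  by (simp add: psum_def infsum_nonneg)

lemma psum_norm_cong: "(\<And>x. cmod (f x) = cmod (g x)) \<Longrightarrow> psum p f = psum p g"
  by (simp add: psum_def)

lemma psummable_norm_cong: "(\<And>x. cmod (f x) = cmod (g x)) \<Longrightarrow> psummable p f = psummable p g"
  by (simp add: psummable_def)

lemma psum_finite: "finite A \<Longrightarrow> (\<And>x. x \<notin> A \<Longrightarrow> f x = 0) \<Longrightarrow> psum p f = (\<Sum>x\<in>A. cmod (f x) powr p)"
  unfolding psum_def by (subst infsum_cong_neutral[where T=A and g="\<lambda>x. cmod (f x) powr p"]) auto

lemma psummable_finite: "finite A \<Longrightarrow> (\<And>x. x \<notin> A \<Longrightarrow> f x = 0) \<Longrightarrow> psummable p f"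
  unfolding psummable_def by (subst summable_on_cong_neutral[where T=A and g="\<lambda>x. cmod (f x) powr p"]) auto

lemma psummable_reindex: "bij s \<Longrightarrow> psummable p (\<lambda>x. f (s x)) = psummable p f"
  unfolding psummable_def by (rule summable_on_reindex_bij_betw)

lemma psum_reindex: "bij s \<Longrightarrow> psum p (\<lambda>x. f (s x)) = psum p f"
  unfolding psum_def by (rule infsum_reindex_bij_betw)

lemma psummable_mono:
  "psummable p g \<Longrightarrow> p > 0 \<Longrightarrow> (\<And>x. cmod (f x) \<le> cmod (g x)) \<Longrightarrow> psummable p f"
  unfolding psummable_def by (erule summable_on_comparison_test) (auto intro: powr_mono2)

lemma psum_mono:
  "psummable p g \<Longrightarrow> p > 0 \<Longrightarrow> (\<And>x. cmod (f x) \<le> cmod (g x)) \<Longrightarrow> psum p f \<le> psum p g"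
  using psummable_mono[of p g f] unfolding psummable_def psum_def
  by (intro infsum_mono) (auto intro: powr_mono2)

lemma psummable_add:
  assumes "psummable p f" "psummable p g" "p > 0"
  shows "psummable p (\<lambda>x. f x + g x)"
  unfolding psummable_def
  by (rule summable_on_comparison_test[where f="\<lambda>x. 2 powr p * (cmod (f x) powr p + cmod (g x) powr p)"])
     (use assms in \<open>auto simp: psummable_def norm_add_powr_le intro!: summable_on_cmult_right summable_on_add\<close>)

lemma psum_add_le:
  assumes "psummable p f" "psummable p g" "p > 0"
  shows "psum p (\<lambda>x. f x + g x) \<le> 2 powr p * (psum p f + psum p g)"
proof -
  have "psum p (\<lambda>x. f x + g x) \<le> (\<Sum>\<^sub>\<infinity>x. 2 powr p * (cmod (f x) powr p + cmod (g x) powr p))"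
    unfolding psum_def
    by (rule infsum_mono) (use assms psummable_add[OF assms] in
        \<open>auto simp: psummable_def norm_add_powr_le intro!: summable_on_cmult_right summable_on_add\<close>)
  also have "\<dots> = 2 powr p * (psum p f + psum p g)"
    using assms unfolding psum_def psummable_def
    by (simp add: infsum_cmult_right' infsum_add)
  finally show ?thesis .
qed

lemma psummable_diff: "psummable p f \<Longrightarrow> psummable p g \<Longrightarrow> p > 0 \<Longrightarrow> psummable p (\<lambda>x. f x - g x)"
  using psummable_add[of p f "\<lambda>x. - g x"] by (simp add: psummable_norm_cong[of "\<lambda>x. - g x" g])

lemma psum_diff_le:
  "psummable p f \<Longrightarrow> psummable p g \<Longrightarrow> p > 0 \<Longrightarrow> psum p (\<lambda>x. f x - g x) \<le> 2 powr p * (psum p f + psum p g)"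
  using psum_add_le[of p f "\<lambda>x. - g x"]
  by (simp add: psummable_norm_cong[of "\<lambda>x. - g x" g] psum_norm_cong[of "\<lambda>x. - g x" g])

lemma psum_diff_commute: "psum p (\<lambda>x. f x - g x) = psum p (\<lambda>x. g x - f x)"
  by (intro psum_norm_cong norm_minus_commute)

lemma psum_cmult: "psum p (\<lambda>x. c * f x) = cmod c powr p * psum p f"
  unfolding psum_def by (simp add: norm_mult powr_mult infsum_cmult_right')

lemma psummable_cmult: "psummable p f \<Longrightarrow> psummable p (\<lambda>x. c * f x)"
  unfolding psummable_def by (simp add: norm_mult powr_mult summable_on_cmult_right)

lemma norm_powr_le_psum: "psummable p f \<Longrightarrow> cmod (f x) powr p \<le> psum p f"
  using finite_sum_le_infsum[of "\<lambda>x. cmod (f x) powr p" UNIV "{x}"]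
  by (auto simp: psum_def psummable_def)

lemma psum_tail:
  assumes "psummable p f" "e > 0"
  obtains A where "finite A" "psum p (\<lambda>x. if x \<in> A then 0 else f x) < e"
proof -
  let ?h = "\<lambda>x. cmod (f x) powr p"
  have s: "?h summable_on UNIV"
    using assms by (simp add: psummable_def)
  obtain A where A: "finite A" "dist (sum ?h A) (infsum ?h UNIV) \<le> e / 2"
    using infsum_finite_approximation[OF s, of "e / 2"] assms by auto
  have "psum p (\<lambda>x. if x \<in> A then 0 else f x) = infsum ?h (- A)"
    unfolding psum_def by (rule infsum_cong_neutral) auto
  also have "\<dots> = infsum ?h UNIV - infsum ?h A"
    using s A by (subst infsum_Diff[symmetric]) (auto simp: Compl_eq_Diff_UNIV)
  also have "\<dots> < e"
    using A(2) \<open>e > 0\<close> infsum_finite[OF A(1), of ?h] unfolding dist_real_def by linarith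
  finally show thesis
    using A that by blast
qed

lemma psum_mazur [simp]: "q \<noteq> 0 \<Longrightarrow> psum q (\<lambda>x. mazur (p / q) (f x)) = psum p f"
  by (simp add: psum_def powr_powr)

lemma psummable_mazur: "q \<noteq> 0 \<Longrightarrow> psummable q (\<lambda>x. mazur (p / q) (f x)) = psummable p f"
  by (simp add: psummable_def powr_powr)

text \<open>The pointwise bound, summed. For vectors of bounded mass the first term is made small by
  choosing \<open>\<epsilon>\<close>, which fixes \<open>C\<close>; the second is then small for
  close vectors. This is uniform continuity of the Mazur map on balls.\<close>

lemma psum_mazur_diff_le:
  assumes C: "\<forall>a b. cmod (mazur (p / q) a - mazur (p / q) b) powr q
           \<le> \<epsilon> * (cmod a powr p + cmod b powr p) + C * cmod (a - b) powr p"
    and "p > 0" "q > 0" and f: "psummable p f" and g: "psummable p g"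
  shows "psum q (\<lambda>x. mazur (p / q) (f x) - mazur (p / q) (g x))
           \<le> \<epsilon> * (psum p f + psum p g) + C * psum p (\<lambda>x. f x - g x)"
proof -
  have d: "psummable p (\<lambda>x. f x - g x)" "psummable q (\<lambda>x. mazur (p / q) (f x) - mazur (p / q) (g x))"
    using assms by (auto intro!: psummable_diff simp: psummable_mazur)
  have s: "(\<lambda>x. \<epsilon> * (cmod (f x) powr p + cmod (g x) powr p)) summable_on UNIV"
      "(\<lambda>x. C * cmod (f x - g x) powr p) summable_on UNIV"
    using d f g unfolding psummable_def by (auto intro!: summable_on_cmult_right summable_on_add)
  have "psum q (\<lambda>x. mazur (p / q) (f x) - mazur (p / q) (g x))
     \<le> (\<Sum>\<^sub>\<infinity>x. \<epsilon> * (cmod (f x) powr p + cmod (g x) powr p) + C * cmod (f x - g x) powr p)"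
    unfolding psum_def
    by (rule infsum_mono) (use d s C in \<open>auto simp: psummable_def intro: summable_on_add\<close>)
  also have "\<dots> = \<epsilon> * (psum p f + psum p g) + C * psum p (\<lambda>x. f x - g x)"
    using s d f g unfolding psum_def psummable_def
    by (simp add: infsum_add infsum_cmult_right')
  finally show ?thesis .
qed

section \<open>Translation between \<open>psum\<close> and the norm of l_p\<close>

lemma lp_space_iff: "f \<in> lp_space p \<longleftrightarrow> psummable p f"
  by (simp add: lp_space_def psummable_def summable_on_UNIV_nonneg_real_iff)

lemma lp_norm_eq:
  assumes "psummable p f"
  shows "lp_norm p f = psum p f powr (1 / p)"
proof -
  have "(\<lambda>n. cmod (f n) powr p) sums psum p f"
    using assms unfolding psum_def psummable_def by (intro has_sum_imp_sums has_sum_infsum)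
  then show ?thesis
    by (simp add: lp_norm_def sums_iff)
qed

lemma lp_norm_powr: "psummable p f \<Longrightarrow> p > 0 \<Longrightarrow> lp_norm p f powr p = psum p f"
  by (simp add: lp_norm_eq powr_powr)

lemma lp_norm_less_iff:
  assumes "psummable p f" "p > 0" "e > 0"
  shows "lp_norm p f < e \<longleftrightarrow> psum p f < e powr p"
proof -
  have "lp_norm p f \<ge> 0"
    by (simp add: lp_norm_def)
  then have "lp_norm p f < e \<longleftrightarrow> lp_norm p f powr p < e powr p"
    using assms by (metis less_eq_real_def linorder_not_less powr_less_mono2 powr_mono2)
  then show ?thesis
    using assms by (simp add: lp_norm_powr)
qed

lemma lp_pair_finite:
  assumes "finite A" "\<And>x. x \<notin> A \<Longrightarrow> f x * g x = 0"
  shows "lp_pair f g = (\<Sum>x\<in>A. f x * g x)"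
  unfolding lp_pair_def by (rule suminf_finite) (use assms in auto)

section \<open>Open subgroups of totally disconnected groups\<close>

lemma continuous_on_translation:
  fixes a b :: "'g::topological_group_add"
  shows "continuous_on UNIV (\<lambda>x. a + x)" "continuous_on UNIV (\<lambda>x. x + a)" "continuous_on UNIV (\<lambda>x::'g. - x)"
  by (auto intro!: continuous_intros)

lemma open_left_translate:
  fixes a :: "'g::topological_group_add"
  shows "open U \<Longrightarrow> open {x. a + x \<in> U}"
  using open_vimage[OF _ continuous_on_translation(1)[of a], of U] by (simp add: vimage_def)

lemma open_right_translate:
  fixes a :: "'g::topological_group_add"
  shows "open U \<Longrightarrow> open {x. x + a \<in> U}"
  using open_vimage[OF _ continuous_on_translation(2)[of a], of U] by (simp add: vimage_def)

lemma open_uminus_vimage: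
  fixes U :: "'g::topological_group_add set"
  shows "open U \<Longrightarrow> open {x. - x \<in> U}"
  using open_vimage[OF _ continuous_on_translation(3), of U] by (simp add: vimage_def)

lemma open_add_nhds:
  fixes a b :: "'g::topological_group_add"
  assumes "open W" "a + b \<in> W"
  obtains A B where "open A" "open B" "a \<in> A" "b \<in> B" "\<And>x y. x \<in> A \<Longrightarrow> y \<in> B \<Longrightarrow> x + y \<in> W"
proof -
  have "((\<lambda>x. fst x + snd x) \<longlongrightarrow> a + b) (nhds a \<times>\<^sub>F nhds b)"
    by (rule tendsto_add_Pair)
  then have "eventually (\<lambda>x. fst x + snd x \<in> W) (nhds a \<times>\<^sub>F nhds b)"
    using assms by (rule topological_tendstoD)
  then obtain P Q where "eventually P (nhds a)" "eventually Q (nhds b)"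
    "\<And>x y. P x \<Longrightarrow> Q y \<Longrightarrow> x + y \<in> W"
    by (auto simp: eventually_prod_filter)
  then show thesis
    unfolding eventually_nhds by (metis that)
qed

text \<open>A subgroup is the union of the translates \<open>u + N\<close> over its elements
  \<open>u\<close>, hence open as soon as it contains one neighbourhood of 0.\<close>

lemma open_subgroupI:
  fixes U :: "'g::topological_group_add set"
  assumes "open N" "0 \<in> N" "N \<subseteq> U"
    and "\<And>x y. x \<in> U \<Longrightarrow> y \<in> U \<Longrightarrow> x + y \<in> U" "\<And>x. x \<in> U \<Longrightarrow> - x \<in> U"
  shows "open_subgroup U"
proof -
  have "U = (\<Union>u\<in>U. {x. - u + x \<in> N})"
  proof (intro equalityI subsetI)
    fix x assume "x \<in> (\<Union>u\<in>U. {x. - u + x \<in> N})"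
    then obtain u where "u \<in> U" "- u + x \<in> N"
      by auto
    then show "x \<in> U"
      using assms(3) assms(4)[of u "- u + x"] by (auto simp flip: add.assoc)
  qed (use assms(2) in force)
  also have "open \<dots>"
    by (intro open_UN ballI open_left_translate assms)
  finally show ?thesis
    using assms unfolding open_subgroup_def by blast
qed

text \<open>For distinct \<open>x\<close> and \<open>y\<close>, continuity of addition at
  \<open>x + 0\<close> gives neighbourhoods \<open>A\<close> of \<open>x\<close> and
  \<open>B\<close> of 0 such that \<open>A + B\<close> misses \<open>y\<close>; then
  \<open>A\<close> and \<open>y - B\<close> are disjoint.\<close>

lemma Hausdorff_group:
  assumes "closed {0::'g::topological_group_add}"
  shows "Hausdorff_space (euclidean :: 'g topology)"
  unfolding Hausdorff_space_def
proof clarsimp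
  fix x y :: 'g
  assume "x \<noteq> y"
  have "open {z. z - y \<in> - {0}}"
    using open_right_translate[of "- {0}" "- y", OF open_Compl[OF assms]] by (simp only: add_uminus_conv_diff)
  moreover have "x + 0 \<in> {z. z - y \<in> - {0}}"
    using \<open>x \<noteq> y\<close> by simp
  ultimately obtain A B where AB: "open A" "open B" "x \<in> A" "0 \<in> B"
    "\<And>u v. u \<in> A \<Longrightarrow> v \<in> B \<Longrightarrow> u + v \<in> {z. z - y \<in> - {0}}"
    by (rule open_add_nhds) blast
  define B' where "B' = {z. - (- y + z) \<in> B}"
  have "open B'"
    using open_left_translate[OF open_uminus_vimage[OF AB(2)], of "- y"] by (simp add: B'_def)
  moreover have "y \<in> B'"
    using AB by (simp add: B'_def)
  moreover have "disjnt A B'"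
    unfolding disjnt_iff
  proof (intro allI notI)
    fix z assume z: "z \<in> A \<and> z \<in> B'"
    then have "z + - (- y + z) \<noteq> y"
      using AB(5)[of z "- (- y + z)"] by (auto simp: B'_def)
    then show False
      by (simp add: minus_add flip: add.assoc)
  qed
  ultimately show "\<exists>U. open U \<and> (\<exists>V. open V \<and> x \<in> U \<and> y \<in> V \<and> disjnt U V)"
    using AB by blast
qed

text \<open>In a compact Hausdorff neighbourhood of 0 quasi-components are components, here single
  points. So each other point is cut off from 0 by a relatively clopen set, and by compactness
  finitely many of these sets intersect inside \<open>W\<close>.\<close>

lemma compact_open_nhd:
  fixes W :: "'g::topological_group_add set"
  assumes lc: "locally_compact_space (euclidean :: 'g topology)"
    and td: "totally_disconnected_group TYPE('g)"
    and W: "open W" "0 \<in> W"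
  obtains C where "compact C" "open C" "0 \<in> C" "C \<subseteq> W"
proof -
  have comp: "connected_component_set UNIV (0::'g) = {0}"
    using td by (simp add: totally_disconnected_group_def)
  then have "closed {0::'g}"
    using closed_connected_component[OF closed_UNIV, of 0] by metis
  then have H: "Hausdorff_space (euclidean :: 'g topology)"
    by (rule Hausdorff_group)
  obtain U L where UL: "open U" "compact L" "closed L" "(0::'g) \<in> U" "U \<subseteq> L"
    using lc[unfolded locally_compact_space_compact_closedin[OF disjI1[OF H]], rule_format, of 0]
    by simp metis
  define X where "X = subtopology euclidean L"
  have cX: "compact_space X"
    unfolding X_def by (rule compact_space_subtopology) (simp add: UL)
  have HX: "Hausdorff_space X"
    unfolding X_def by (rule Hausdorff_space_subtopology[OF H])
  have lX: "locally_compact_space X"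
    by (rule compact_imp_locally_compact_space[OF cX])
  have tX: "topspace X = L"
    by (simp add: X_def)
  define Q where "Q = quasi_component_of_set X 0"
  have "compactin X Q"
    unfolding Q_def by (rule closedin_compact_space[OF cX closedin_quasi_component_of])
  moreover have "Q \<in> quasi_components_of X"
    unfolding Q_def quasi_components_of_def by (rule imageI) (use UL in \<open>auto simp: tX\<close>)
  ultimately have "Q \<in> connected_components_of X"
    using compact_quasi_eq_connected_components_of[OF lX HX, of Q] by simp
  then have "connected Q"
    using connectedin_connected_components_of[of Q X] by (simp add: X_def connectedin_subtopology)
  moreover have "0 \<in> Q"
    using UL by (simp add: Q_def tX subsetD)
  ultimately have "Q \<subseteq> {0}"
    using connected_component_maximal[of 0 Q UNIV] comp by auto
  then have sep: "\<exists>T. 0 \<in> T \<and> closedin X T \<and> openin X T \<and> y \<notin> T" if "y \<in> L" "y \<noteq> 0" for y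
  proof -
    have "\<not> quasi_component_of X 0 y"
      using \<open>Q \<subseteq> {0}\<close> that by (auto simp: Q_def)
    moreover have "0 \<in> L"
      using UL by auto
    ultimately show ?thesis
      unfolding quasi_component_of tX using that by blast
  qed
  obtain T where T: "\<And>y. y \<in> L \<Longrightarrow> y \<noteq> 0 \<Longrightarrow>
      0 \<in> T y \<and> closedin X (T y) \<and> openin X (T y) \<and> y \<notin> T y"
  proof -
    have "\<forall>y. \<exists>T. y \<in> L \<longrightarrow> y \<noteq> 0 \<longrightarrow> 0 \<in> T \<and> closedin X T \<and> openin X T \<and> y \<notin> T"
      using sep by blast
    from choice[OF this] show thesis
      using that by blast
  qed
  \<comment> \<open>\<open>V\<close> is open in the group and not merely in \<open>L\<close>, so a
    relatively open subset of \<open>L\<close> that lies in \<open>V\<close> is open in the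
    group.\<close>
  define V where "V = U \<inter> W"
  have V: "open V" "0 \<in> V" "V \<subseteq> L"
    using W UL by (auto simp: V_def)
  have "compactin X (L - V)"
  proof (rule closedin_compact_space[OF cX])
    have "L - V = - V \<inter> L"
      by blast
    then show "closedin X (L - V)"
      unfolding X_def closedin_subtopology using V(1) by auto
  qed
  moreover have "L - V \<subseteq> \<Union>((\<lambda>y. L - T y) ` (L - V))"
    using T V by auto
  moreover have "openin X B" if "B \<in> (\<lambda>y. L - T y) ` (L - V)" for B
  proof -
    obtain y where y: "y \<in> L" "y \<notin> V" "B = L - T y"
      using \<open>B \<in> _\<close> by auto
    then have "closedin X (T y)"
      using T V by blast
    then show ?thesis
      unfolding y(3) closedin_def tX by blast
  qed
  ultimately obtain F where F: "finite F" "F \<subseteq> (\<lambda>y. L - T y) ` (L - V)" "L - V \<subseteq> \<Union>F"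
    using compactinD[of X "L - V"] by metis
  then obtain I where I: "finite I" "I \<subseteq> L - V" "F = (\<lambda>y. L - T y) ` I"
    using finite_subset_image[OF F(1,2)] by metis
  define C where "C = L \<inter> (\<Inter>y\<in>I. T y)"
  have ne: "y \<in> L" "y \<noteq> 0" if "y \<in> I" for y
    using that I V by auto
  have "closedin X C"
  proof (cases "I = {}")
    case True
    then show ?thesis
      using closedin_topspace[of X] by (simp add: C_def tX)
  next
    case False
    then show ?thesis
      unfolding C_def using T ne closedin_topspace[of X] by (intro closedin_Int closedin_INT) (auto simp: tX)
  qed
  have "openin X C"
  proof (cases "I = {}")
    case True
    then show ?thesis
      using openin_topspace[of X] by (simp add: C_def tX)
  next
    case False
    then show ?thesis
      unfolding C_def using T ne I(1) openin_topspace[of X] by (intro openin_Int openin_INT2) (auto simp: tX)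
  qed
  have "C \<subseteq> V"
    using F(3) unfolding C_def I(3) by blast
  obtain C' where "open C'" "C = C' \<inter> L"
    using \<open>openin X C\<close> by (auto simp: X_def openin_subtopology)
  then have "C = C' \<inter> V"
    using \<open>C \<subseteq> V\<close> V by auto
  then have "open C"
    using V \<open>open C'\<close> by auto
  moreover have "compact C"
    using closedin_compact_space[OF cX \<open>closedin X C\<close>] by (simp add: X_def compactin_subtopology)
  moreover have "0 \<in> C"
    using T ne UL by (auto simp: C_def)
  moreover have "C \<subseteq> W"
    using \<open>C \<subseteq> V\<close> by (auto simp: V_def)
  ultimately show thesis
    using that by blast
qed

text \<open>The stabilizer of a compact open set \<open>C\<close> under right translation is a
  subgroup. It contains a neighbourhood of 0 because \<open>C\<close> is compact and open, and it
  lies in \<open>C\<close> because 0 does.\<close>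

lemma van_Dantzig:
  fixes W :: "'g::topological_group_add set"
  assumes lc: "locally_compact_space (euclidean :: 'g topology)"
    and td: "totally_disconnected_group TYPE('g)"
    and W: "open W" "0 \<in> W"
  obtains U where "open_subgroup U" "U \<subseteq> W"
proof -
  obtain C where C: "compact C" "open C" "0 \<in> C" "C \<subseteq> W"
    using compact_open_nhd[OF assms] .
  have "\<exists>A B. open A \<and> open B \<and> c \<in> A \<and> 0 \<in> B \<and> (\<forall>x\<in>A. \<forall>y\<in>B. x + y \<in> C)" if "c \<in> C" for c
    using open_add_nhds[OF C(2), of c 0] that by (metis add_0_right)
  then obtain A B where AB: "\<And>c. c \<in> C \<Longrightarrow> open (A c) \<and> open (B c) \<and> c \<in> A c \<and> 0 \<in> B c \<and>
      (\<forall>x\<in>A c. \<forall>y\<in>B c. x + y \<in> C)"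
    by metis
  obtain I where I: "I \<subseteq> C" "finite I" "C \<subseteq> (\<Union>c\<in>I. A c)"
    by (rule compactE_image[OF C(1), of C A]) (use AB in auto)
  define N where "N = (\<Inter>c\<in>I. B c)"
  have N: "open N" "0 \<in> N"
    using AB I by (auto simp: N_def)
  have CN: "x + y \<in> C" if "x \<in> C" "y \<in> N" for x y
  proof -
    obtain c where "c \<in> I" "x \<in> A c"
      using I \<open>x \<in> C\<close> by auto
    then show ?thesis
      using AB[of c] I \<open>y \<in> N\<close> by (auto simp: N_def)
  qed
  \<comment> \<open>The two conditions together say that \<open>C + g = C\<close>; both are imposed
    so that closure under negation is immediate.\<close>
  define U where "U = {g. \<forall>c\<in>C. c + g \<in> C \<and> c - g \<in> C}"
  have "open_subgroup U"
  proof (rule open_subgroupI)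
    show "open (N \<inter> {x. - x \<in> N})" "0 \<in> N \<inter> {x. - x \<in> N}"
      using N by (auto intro: open_uminus_vimage)
    show "N \<inter> {x. - x \<in> N} \<subseteq> U"
    proof
      fix x assume "x \<in> N \<inter> {x. - x \<in> N}"
      then show "x \<in> U"
        using CN[of _ x] CN[of _ "- x"] unfolding U_def by simp
    qed
    show "x + y \<in> U" if "x \<in> U" "y \<in> U" for x y
    proof -
      have "c + (x + y) = (c + x) + y" "c - (x + y) = (c - y) - x" for c
        by (simp_all add: add.assoc diff_conv_add_uminus minus_add del: add_uminus_conv_diff)
      then show ?thesis
        using that unfolding U_def by simp
    qed
    show "- x \<in> U" if "x \<in> U" for x
      using that by (auto simp: U_def)
  qed
  moreover have "U \<subseteq> W"
    using C unfolding U_def by (metis (no_types, lifting) add_0 mem_Collect_eq subset_iff)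
  ultimately show thesis
    using that by blast
qed

text \<open>While \<open>w\<close> on the circle is within 1 of 1, the parallelogram law gives
  \<open>cmod (w + 1)\<close> squared at least 3, so squaring \<open>w\<close> triples the squared
  distance to 1. Iterated squares of some \<open>z\<close> other than 1 would therefore
  escape.\<close>

lemma unit_circle_no_small_subgroups:
  fixes z :: complex
  assumes "cmod z = 1" and small: "\<And>n. cmod (z ^ n - 1) < 1"
  shows "z = 1"
proof (rule ccontr)
  assume "z \<noteq> 1"
  have step: "3 * (cmod (w - 1))\<^sup>2 \<le> (cmod (w\<^sup>2 - 1))\<^sup>2" if "cmod w = 1" "cmod (w - 1) < 1" for w
  proof -
    have "w\<^sup>2 - 1 = (w + 1) * (w - 1)"
      by (simp add: algebra_simps power2_eq_square)
    then have "(cmod (w\<^sup>2 - 1))\<^sup>2 = (cmod (w + 1))\<^sup>2 * (cmod (w - 1))\<^sup>2"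
      by (simp add: norm_mult power_mult_distrib)
    moreover have "(cmod (w + 1))\<^sup>2 + (cmod (w - 1))\<^sup>2 = 2 * (cmod w)\<^sup>2 + 2"
      unfolding cmod_power2 by (simp add: power2_eq_square algebra_simps)
    moreover have "(cmod (w - 1))\<^sup>2 < 1"
      using that by (simp add: power2_eq_square abs_square_less_1[unfolded power2_eq_square])
    ultimately have "(cmod (w + 1))\<^sup>2 \<ge> 3" and eq: "(cmod (w\<^sup>2 - 1))\<^sup>2 = (cmod (w + 1))\<^sup>2 * (cmod (w - 1))\<^sup>2"
      using that by auto
    then show ?thesis
      using mult_right_mono[of 3 "(cmod (w + 1))\<^sup>2" "(cmod (w - 1))\<^sup>2"] by simp
  qed
  have "3 ^ k * (cmod (z - 1))\<^sup>2 \<le> (cmod (z ^ (2 ^ k) - 1))\<^sup>2" for k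
  proof (induction k)
    case (Suc k)
    have "(z ^ (2 ^ k))\<^sup>2 = z ^ (2 ^ Suc k)"
      by (simp add: power_mult[symmetric] mult.commute)
    then show ?case
      using Suc step[of "z ^ (2 ^ k)"] small[of "2 ^ k"] assms(1) by (simp add: norm_power)
  qed simp
  moreover have "(cmod (z ^ (2 ^ k) - 1))\<^sup>2 \<le> 1" for k
    using small[of "2 ^ k"] by (simp add: power_le_one)
  ultimately have "3 ^ k * (cmod (z - 1))\<^sup>2 \<le> 1" for k
    by (meson order_trans)
  moreover obtain k where "1 / (cmod (z - 1))\<^sup>2 < 3 ^ k"
    using real_arch_pow[of 3] by auto
  ultimately show False
    using \<open>z \<noteq> 1\<close> by (simp add: divide_simps) (metis linorder_not_less)
qed

section \<open>Quasi-regular representations\<close>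

lemma psum_2: "psum 2 f = (\<Sum>\<^sub>\<infinity>x. (cmod (f x))\<^sup>2)"
  by (simp add: psum_def)

lemma psummable_2: "psummable 2 f \<longleftrightarrow> (\<lambda>x. (cmod (f x))\<^sup>2) summable_on UNIV"
  by (simp add: psummable_def)

section \<open>Inner products of square-summable functions\<close>

lemma has_sum_minus:
  fixes f g :: "'a \<Rightarrow> 'b::real_normed_vector"
  assumes "(f has_sum a) A" "(g has_sum b) A"
  shows "((\<lambda>x. f x - g x) has_sum (a - b)) A"
  using has_sum_add[OF assms(1), of "\<lambda>x. - g x" "- b"] assms(2) by (simp add: has_sum_uminus)

definition l2_ip :: "('a \<Rightarrow> complex) \<Rightarrow> ('a \<Rightarrow> complex) \<Rightarrow> complex" where
  "l2_ip a b = (\<Sum>\<^sub>\<infinity>x. a x * cnj (b x))"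

lemma mult_le_weighted_squares:
  fixes u v t :: real
  assumes "t > 0"
  shows "u * v \<le> t / 2 * u\<^sup>2 + 1 / (2 * t) * v\<^sup>2"
proof -
  have "0 \<le> (t * u - v)\<^sup>2 / (2 * t)"
    using assms by simp
  also have "\<dots> = t / 2 * u\<^sup>2 + 1 / (2 * t) * v\<^sup>2 - u * v"
    using assms by (simp add: field_simps power2_eq_square)
  finally show ?thesis
    by simp
qed

lemma l2_ip_summable:
  assumes "psummable 2 a" "psummable 2 b"
  shows "(\<lambda>x. norm (a x * cnj (b x))) summable_on UNIV"
proof (rule Infinite_Sum.abs_summable_on_comparison_test')
  show "(\<lambda>x. 1 / 2 * (cmod (a x))\<^sup>2 + 1 / (2 * 1) * (cmod (b x))\<^sup>2) summable_on UNIV"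
    using assms unfolding psummable_2 by (intro summable_on_add summable_on_cmult_right)
  show "norm (a x * cnj (b x)) \<le> 1 / 2 * (cmod (a x))\<^sup>2 + 1 / (2 * 1) * (cmod (b x))\<^sup>2" for x
    using mult_le_weighted_squares[of 1 "cmod (a x)" "cmod (b x)"] by (simp add: norm_mult)
qed

lemma l2_ip_has_sum:
  assumes "psummable 2 a" "psummable 2 b"
  shows "((\<lambda>x. a x * cnj (b x)) has_sum l2_ip a b) UNIV"
  unfolding l2_ip_def
  by (rule has_sum_infsum[OF Infinite_Sum.abs_summable_summable[OF l2_ip_summable[OF assms]]])

lemma psum_2_has_sum: "psummable 2 a \<Longrightarrow> ((\<lambda>x. (cmod (a x))\<^sup>2) has_sum psum 2 a) UNIV"
  unfolding psummable_2 psum_2 by (rule has_sum_infsum)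

text \<open>A linear form of the Cauchy-Schwarz inequality: it can be summed over a family at once,
  with the weight \<open>t\<close> optimized only afterwards.\<close>

lemma l2_ip_bound:
  assumes "psummable 2 a" "psummable 2 b" "t > 0"
  shows "cmod (l2_ip a b) \<le> t / 2 * psum 2 a + 1 / (2 * t) * psum 2 b"
proof (rule norm_infsum_le)
  show "((\<lambda>x. a x * cnj (b x)) has_sum l2_ip a b) UNIV"
    by (rule l2_ip_has_sum[OF assms(1,2)])
  show "((\<lambda>x. t / 2 * (cmod (a x))\<^sup>2 + 1 / (2 * t) * (cmod (b x))\<^sup>2)
      has_sum (t / 2 * psum 2 a + 1 / (2 * t) * psum 2 b)) UNIV"
    by (intro has_sum_add has_sum_cmult_right psum_2_has_sum assms)
  show "norm (a x * cnj (b x)) \<le> t / 2 * (cmod (a x))\<^sup>2 + 1 / (2 * t) * (cmod (b x))\<^sup>2" for x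
    using mult_le_weighted_squares[OF assms(3), of "cmod (a x)" "cmod (b x)"] by (simp add: norm_mult)
qed

lemma l2_ip_self:
  assumes "psummable 2 a"
  shows "l2_ip a a = of_real (psum 2 a)"
proof (rule has_sum_unique[OF l2_ip_has_sum[OF assms assms]])
  have "((\<lambda>x. complex_of_real ((cmod (a x))\<^sup>2)) has_sum of_real (psum 2 a)) UNIV"
    by (rule has_sum_of_real[OF psum_2_has_sum[OF assms]])
  then show "((\<lambda>x. a x * cnj (a x)) has_sum of_real (psum 2 a)) UNIV"
    unfolding complex_norm_square .
qed

lemma l2_ip_diff_left:
  assumes "psummable 2 a" "psummable 2 b" "psummable 2 c"
  shows "l2_ip (\<lambda>x. a x - b x) c = l2_ip a c - l2_ip b c"
  using has_sum_minus[OF l2_ip_has_sum[OF assms(1,3)] l2_ip_has_sum[OF assms(2,3)]]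
  unfolding l2_ip_def by (intro infsumI) (simp add: left_diff_distrib)

lemma psum_2_diff:
  assumes "psummable 2 a" "psummable 2 b"
  shows "psum 2 (\<lambda>x. a x - b x) = psum 2 a + psum 2 b - 2 * Re (l2_ip a b)"
proof -
  have "((\<lambda>x. Re (a x * cnj (b x))) has_sum Re (l2_ip a b)) UNIV"
    by (rule has_sum_Re[OF l2_ip_has_sum[OF assms]])
  then have "((\<lambda>x. (cmod (a x))\<^sup>2 + (cmod (b x))\<^sup>2 - 2 * Re (a x * cnj (b x)))
      has_sum (psum 2 a + psum 2 b - 2 * Re (l2_ip a b))) UNIV"
    by (intro has_sum_minus has_sum_add has_sum_cmult_right psum_2_has_sum assms)
  moreover have "(cmod (a x))\<^sup>2 + (cmod (b x))\<^sup>2 - 2 * Re (a x * cnj (b x)) = (cmod (a x - b x))\<^sup>2" for x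
    unfolding cmod_power2 by (simp add: power2_eq_square algebra_simps)
  ultimately show ?thesis
    unfolding psum_2[of "\<lambda>x. a x - b x"] by (simp add: infsumI)
qed

section \<open>Translations of cosets and vectors orthogonal to the invariant ones\<close>

lemma translate_translate: "(+) g ` (+) h ` x = (+) (g + (h::'g::group_add)) ` x"
  by (auto simp: image_image add.assoc)

lemma bij_translate: "bij ((`) ((+) (g::'g::group_add)))"
proof (rule o_bij)
  show "(`) ((+) (- g)) \<circ> (`) ((+) g) = id" "(`) ((+) g) \<circ> (`) ((+) (- g)) = id"
    by (auto simp: fun_eq_iff translate_translate)
qed

lemma psum_quasi_reg [simp]: "psum p (quasi_reg g \<xi>) = psum p \<xi>"
  unfolding quasi_reg_def by (rule psum_reindex[OF bij_translate])

lemma psummable_quasi_reg [simp]: "psummable p (quasi_reg g \<xi>) = psummable p \<xi>"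
  unfolding quasi_reg_def by (rule psummable_reindex[OF bij_translate])

lemma left_cosets_translate: "(+) g ` x \<in> left_cosets H \<longleftrightarrow> x \<in> left_cosets (H::'g::group_add set)"
proof
  assume "(+) g ` x \<in> left_cosets H"
  then obtain k where "(+) g ` x = (+) k ` H"
    unfolding left_cosets_def by blast
  then have "(+) (- g) ` (+) g ` x = (+) (- g) ` (+) k ` H"
    by simp
  then show "x \<in> left_cosets H"
    unfolding translate_translate left_cosets_def by simp blast
next
  assume "x \<in> left_cosets H"
  then show "(+) g ` x \<in> left_cosets H"
    unfolding left_cosets_def using translate_translate by blast
qed

lemma l2_cosets_iff:
  "\<xi> \<in> l2_cosets H \<longleftrightarrow> (\<forall>x. x \<notin> left_cosets H \<longrightarrow> \<xi> x = 0) \<and> psummable 2 \<xi>"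
proof -
  have "(\<lambda>x. (cmod (\<xi> x))\<^sup>2) summable_on left_cosets H \<longleftrightarrow> (\<lambda>x. (cmod (\<xi> x))\<^sup>2) summable_on UNIV"
    if "\<forall>x. x \<notin> left_cosets H \<longrightarrow> \<xi> x = 0"
    using that by (intro summable_on_cong_neutral) auto
  then show ?thesis
    by (auto simp: l2_cosets_def psummable_2)
qed

lemma infsum_cosets_eq_psum:
  "\<xi> \<in> l2_cosets H \<Longrightarrow> (\<Sum>\<^sub>\<infinity>x\<in>left_cosets H. (cmod (\<xi> x))\<^sup>2) = psum 2 \<xi>"
  unfolding psum_2 by (rule infsum_cong_neutral) (auto simp: l2_cosets_iff)

lemma l2_inner_eq_ip: "\<eta> \<in> l2_cosets H \<Longrightarrow> l2_inner H \<xi> \<eta> = l2_ip \<xi> \<eta>"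
  unfolding l2_inner_def l2_ip_def by (rule infsum_cong_neutral) (auto simp: l2_cosets_iff)

lemma l2_cosets_prime_subset: "\<xi> \<in> l2_cosets_prime H \<Longrightarrow> \<xi> \<in> l2_cosets H"
  by (simp add: l2_cosets_prime_def)

lemma l2_cosets_prime_zero: "(\<lambda>_. 0) \<in> l2_cosets_prime H"
  by (auto simp: l2_cosets_prime_def l2_cosets_iff l2_inner_def psummable_2)

lemma l2_cosets_prime_scale:
  assumes "\<xi> \<in> l2_cosets_prime H"
  shows "(\<lambda>x. c * \<xi> x) \<in> l2_cosets_prime H"
proof -
  have "(\<lambda>x. c * \<xi> x) \<in> l2_cosets H"
    using assms by (auto simp: l2_cosets_prime_def l2_cosets_iff psummable_cmult)
  moreover have "l2_inner H (\<lambda>x. c * \<xi> x) \<eta> = c * l2_inner H \<xi> \<eta>" for \<eta>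
    unfolding l2_inner_def by (simp add: mult.assoc infsum_cmult_right')
  ultimately show ?thesis
    using assms by (auto simp: l2_cosets_prime_def)
qed

lemma invariant_constant_on_cosets:
  assumes "\<forall>g. quasi_reg g \<eta> = \<eta>" "x \<in> left_cosets H"
  shows "\<eta> x = \<eta> H"
proof -
  obtain g where g: "x = (+) g ` H"
    using assms by (auto simp: left_cosets_def)
  have "\<eta> x = quasi_reg g \<eta> x"
    using assms by simp
  then show ?thesis
    by (simp add: quasi_reg_def g translate_translate)
qed

text \<open>By transitivity an invariant vector is constant on the coset space. If that space is
  infinite, square-summability makes the vector zero and no condition remains; if it is finite,
  orthogonality to the constants is the vanishing of the sum.\<close>

lemma l2_cosets_primeI:
  assumes \<xi>: "\<xi> \<in> l2_cosets H" and sum: "finite (left_cosets H) \<Longrightarrow> (\<Sum>x\<in>left_cosets H. \<xi> x) = 0"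
  shows "\<xi> \<in> l2_cosets_prime H"
proof -
  have "l2_inner H \<xi> \<eta> = 0" if \<eta>: "\<eta> \<in> l2_cosets H" "\<forall>g. quasi_reg g \<eta> = \<eta>" for \<eta>
  proof (cases "finite (left_cosets H)")
    case True
    then have "l2_inner H \<xi> \<eta> = (\<Sum>x\<in>left_cosets H. \<xi> x * cnj (\<eta> H))"
      unfolding l2_inner_def using invariant_constant_on_cosets[OF \<eta>(2)] by simp
    then show ?thesis
      using sum[OF True] by (simp flip: sum_distrib_right)
  next
    case False
    have "\<eta> H = 0"
    proof (rule ccontr)
      assume "\<eta> H \<noteq> 0"
      then obtain N :: nat where N: "psum 2 \<eta> / (cmod (\<eta> H))\<^sup>2 < real N"
        using reals_Archimedean2 by blast
      obtain F where F: "finite F" "card F = N" "F \<subseteq> left_cosets H"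
        using infinite_arbitrarily_large[OF False] by blast
      have "real N * (cmod (\<eta> H))\<^sup>2 = (\<Sum>x\<in>F. (cmod (\<eta> x))\<^sup>2)"
      proof -
        have "(\<Sum>x\<in>F. (cmod (\<eta> x))\<^sup>2) = (\<Sum>x\<in>F. (cmod (\<eta> H))\<^sup>2)"
          using F(3) invariant_constant_on_cosets[OF \<eta>(2)] by (intro sum.cong refl) (metis subsetD)
        then show ?thesis
          using F(2) by simp
      qed
      also have "\<dots> \<le> psum 2 \<eta>"
        unfolding psum_2 using F \<eta> by (intro finite_sum_le_infsum) (auto simp: l2_cosets_iff psummable_2)
      finally show False
        using N \<open>\<eta> H \<noteq> 0\<close> by (simp add: divide_simps)
    qed
    then show ?thesis
      unfolding l2_inner_def using invariant_constant_on_cosets[OF \<eta>(2)] by (simp cong: infsum_cong)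
  qed
  then show ?thesis
    using \<xi> by (auto simp: l2_cosets_prime_def)
qed

lemma l2_cosets_prime_sum:
  assumes \<xi>: "\<xi> \<in> l2_cosets_prime H" and "finite (left_cosets H)"
  shows "(\<Sum>x\<in>left_cosets H. \<xi> x) = 0"
proof -
  let ?\<eta> = "\<lambda>x. if x \<in> left_cosets H then 1 else 0 :: complex"
  have "?\<eta> \<in> l2_cosets H"
    using assms(2) by (auto simp: l2_cosets_iff intro: psummable_finite)
  moreover have "\<forall>g. quasi_reg g ?\<eta> = ?\<eta>"
    by (simp add: quasi_reg_def left_cosets_translate)
  ultimately have "l2_inner H \<xi> ?\<eta> = 0"
    using \<xi> unfolding l2_cosets_prime_def by blast
  then show ?thesis
    using assms(2) by (simp add: l2_inner_def)
qed

text \<open>A Kazhdan pair, in squared norms, for all finite direct sums of the reduced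
  quasi-regular representations. Families are needed because weak containment admits finite sums of
  coefficients, and displacements are added up before being compared for each
  \<open>g\<close>.\<close>

definition quasi_reg_gap :: "'g::topological_group_add set \<Rightarrow> real \<Rightarrow> bool" where
  "quasi_reg_gap K \<epsilon> \<longleftrightarrow> (\<forall>n (L :: nat \<Rightarrow> 'g set) \<xi>.
     (\<forall>i<n. open_subgroup (L i) \<and> \<xi> i \<in> l2_cosets_prime (L i)) \<longrightarrow>
     (\<forall>g\<in>K. (\<Sum>i<n. psum 2 (\<lambda>x. quasi_reg g (\<xi> i) x - \<xi> i x)) \<le> \<epsilon> * (\<Sum>i<n. psum 2 (\<xi> i))) \<longrightarrow>
     (\<Sum>i<n. psum 2 (\<xi> i)) = 0)"

text \<open>Several members of a finite family may belong to the same subgroup. Giving each member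
  its own vector of the direct sum avoids collecting multiplicities.\<close>

lemma dirsum_single:
  assumes "open_subgroup L" "\<xi> \<in> l2_cosets_prime L"
  defines "\<Xi> \<equiv> \<lambda>H. if H = L then \<xi> else (\<lambda>_. 0)"
  shows "\<Xi> \<in> dirsum_space" "dirsum_coeff \<Xi> g = l2_ip (quasi_reg g \<xi>) \<xi>"
proof -
  have eq: "(\<lambda>H. \<Sum>\<^sub>\<infinity>x\<in>left_cosets H. (cmod (\<Xi> H x))\<^sup>2) = (\<lambda>H. if H = L then psum 2 \<xi> else 0)"
    using assms by (auto simp: fun_eq_iff \<Xi>_def infsum_cosets_eq_psum l2_cosets_prime_subset)
  have "(\<lambda>H. if H = L then psum 2 \<xi> else 0) summable_on {H. open_subgroup H}"
    by (rule finite_nonzero_values_imp_summable_on) (auto intro: finite_subset[of _ "{L}"])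
  then show "\<Xi> \<in> dirsum_space"
    unfolding dirsum_space_def mem_Collect_eq eq
    using assms by (auto simp: \<Xi>_def l2_cosets_prime_zero)
  have "dirsum_coeff \<Xi> g = (\<Sum>\<^sub>\<infinity>H\<in>{L}. l2_inner H (quasi_reg g (\<Xi> H)) (\<Xi> H))"
    unfolding dirsum_coeff_def using assms(1)
    by (intro infsum_cong_neutral) (auto simp: \<Xi>_def l2_inner_def)
  then show "dirsum_coeff \<Xi> g = l2_ip (quasi_reg g \<xi>) \<xi>"
    using assms by (simp add: \<Xi>_def l2_inner_eq_ip l2_cosets_prime_subset)
qed

text \<open>A family violating the gap, rescaled to total mass \<open>c\<close>, would have
  coefficients whose sum is within \<open>\<epsilon> / 2\<close> of \<open>c\<close> on
  \<open>K\<close>, against the failure of weak containment.\<close>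

lemma property_T_quasi_reg_gap:
  fixes G :: "'g::topological_group_add itself"
  assumes "property_T_quasi_reg TYPE('g)"
  obtains K :: "'g set" and \<epsilon> where "compact K" "\<epsilon> > 0" "quasi_reg_gap K \<epsilon>"
proof -
  obtain c \<epsilon> and K :: "'g set" where c: "c \<ge> 0" "compact K" "\<epsilon> > 0" and
    no: "\<And>(n::nat) \<Xi>. (\<forall>i<n. \<Xi> i \<in> dirsum_space) \<Longrightarrow>
          \<exists>g\<in>K. \<epsilon> \<le> cmod (complex_of_real c - (\<Sum>i<n. dirsum_coeff (\<Xi> i) g))"
    using assms unfolding property_T_quasi_reg_def trivial_weakly_contained_quasi_reg_def
  proof -
    have "\<exists>c\<ge>0. \<exists>K::'g set. compact K \<and> (\<exists>\<epsilon>>0. \<not> (\<exists>(n::nat) \<Xi>. (\<forall>i<n. \<Xi> i \<in> dirsum_space) \<and>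
        (\<forall>g\<in>K. cmod (complex_of_real c - (\<Sum>i<n. dirsum_coeff (\<Xi> i) g)) < \<epsilon>)))"
      using assms unfolding property_T_quasi_reg_def trivial_weakly_contained_quasi_reg_def by blast
    then obtain c \<epsilon> and K :: "'g set" where c: "c \<ge> 0" "compact K" "\<epsilon> > 0" and
      "\<not> (\<exists>(n::nat) \<Xi>. (\<forall>i<n. \<Xi> i \<in> dirsum_space) \<and>
        (\<forall>g\<in>K. cmod (complex_of_real c - (\<Sum>i<n. dirsum_coeff (\<Xi> i) g)) < \<epsilon>))"
      by blast
    then show thesis
      by (intro that[OF c]) (metis linorder_not_less)
  qed
  \<comment> \<open>For \<open>c = 0\<close> the empty family would be an exact
    approximation.\<close>
  have "c > 0"
    using no[of 0] c by (cases "c = 0") auto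
  \<comment> \<open>With the weight \<open>t = 2 * c / \<epsilon>\<close> in the Cauchy-Schwarz
    bound, each of its two terms becomes \<open>\<epsilon> / 4\<close>.\<close>
  define \<delta> where "\<delta> = \<epsilon>\<^sup>2 / (4 * c\<^sup>2)"
  have "\<delta> > 0"
    using c \<open>c > 0\<close> by (simp add: \<delta>_def)
  have "quasi_reg_gap K \<delta>"
    unfolding quasi_reg_gap_def
  proof (intro allI impI)
    fix n :: nat and L :: "nat \<Rightarrow> 'g set" and \<xi>
    assume L: "\<forall>i<n. open_subgroup (L i) \<and> \<xi> i \<in> l2_cosets_prime (L i)"
      and inv: "\<forall>g\<in>K. (\<Sum>i<n. psum 2 (\<lambda>x. quasi_reg g (\<xi> i) x - \<xi> i x)) \<le> \<delta> * (\<Sum>i<n. psum 2 (\<xi> i))"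
    define N where "N = (\<Sum>i<n. psum 2 (\<xi> i))"
    show "(\<Sum>i<n. psum 2 (\<xi> i)) = 0"
    proof (rule ccontr)
      assume "(\<Sum>i<n. psum 2 (\<xi> i)) \<noteq> 0"
      then have "N > 0"
        by (simp add: N_def sum_nonneg order_less_le)
      define s where "s = complex_of_real (sqrt (c / N))"
      have s2: "(cmod s)\<^sup>2 = c / N"
        using \<open>c > 0\<close> \<open>N > 0\<close> by (simp add: s_def)
      define \<zeta> where "\<zeta> i x = s * \<xi> i x" for i x
      define \<Xi> where "\<Xi> i H = (if H = L i then \<zeta> i else (\<lambda>_. 0))" for i H
      have \<zeta>: "\<zeta> i \<in> l2_cosets_prime (L i)" "psummable 2 (\<zeta> i)" if "i < n" for i
        using L that l2_cosets_prime_scale[of "\<xi> i" "L i" s] l2_cosets_prime_subset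
        by (auto simp: \<zeta>_def[abs_def] l2_cosets_iff dest!: l2_cosets_prime_subset)
      have \<Xi>: "\<Xi> i \<in> dirsum_space" "dirsum_coeff (\<Xi> i) g = l2_ip (quasi_reg g (\<zeta> i)) (\<zeta> i)"
        if "i < n" for i g
        using dirsum_single[of "L i" "\<zeta> i"] L \<zeta> that by (simp_all add: \<Xi>_def[abs_def])
      obtain g where g: "g \<in> K" "\<epsilon> \<le> cmod (complex_of_real c - (\<Sum>i<n. dirsum_coeff (\<Xi> i) g))"
        using no[of n \<Xi>] \<Xi> by blast
      have norm: "(\<Sum>i<n. psum 2 (\<zeta> i)) = c"
      proof -
        have "psum 2 (\<zeta> i) = c / N * psum 2 (\<xi> i)" for i
          using psum_cmult[of 2 s "\<xi> i"] s2 by (simp add: \<zeta>_def[abs_def])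
        then have "(\<Sum>i<n. psum 2 (\<zeta> i)) = c / N * N"
          by (simp add: N_def flip: sum_distrib_left del: times_divide_eq_left)
        then show ?thesis
          using \<open>N > 0\<close> by simp
      qed
      have "psum 2 (\<lambda>x. \<zeta> i x - quasi_reg g (\<zeta> i) x)
          = c / N * psum 2 (\<lambda>x. quasi_reg g (\<xi> i) x - \<xi> i x)" for i
        using psum_cmult[of 2 s "\<lambda>x. quasi_reg g (\<xi> i) x - \<xi> i x"] s2
        by (subst psum_diff_commute) (simp add: \<zeta>_def quasi_reg_def right_diff_distrib)
      then have "(\<Sum>i<n. psum 2 (\<lambda>x. \<zeta> i x - quasi_reg g (\<zeta> i) x))
          = c / N * (\<Sum>i<n. psum 2 (\<lambda>x. quasi_reg g (\<xi> i) x - \<xi> i x))"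
        by (simp add: sum_distrib_left)
      also have "\<dots> \<le> c / N * (\<delta> * N)"
        using inv g \<open>c > 0\<close> \<open>N > 0\<close> by (intro mult_left_mono) (auto simp: N_def)
      finally have diff: "(\<Sum>i<n. psum 2 (\<lambda>x. \<zeta> i x - quasi_reg g (\<zeta> i) x)) \<le> c * \<delta>"
        using \<open>N > 0\<close> by simp
      define t where "t = 2 * c / \<epsilon>"
      have "t > 0"
        using c \<open>c > 0\<close> by (simp add: t_def)
      have "complex_of_real c - (\<Sum>i<n. dirsum_coeff (\<Xi> i) g)
          = (\<Sum>i<n. l2_ip (\<lambda>x. \<zeta> i x - quasi_reg g (\<zeta> i) x) (\<zeta> i))"
        using \<zeta> \<Xi> by (simp add: l2_ip_diff_left l2_ip_self sum_subtractf flip: norm)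
      also have "cmod \<dots> \<le> (\<Sum>i<n. cmod (l2_ip (\<lambda>x. \<zeta> i x - quasi_reg g (\<zeta> i) x) (\<zeta> i)))"
        by (rule norm_sum)
      also have "\<dots> \<le> (\<Sum>i<n. t / 2 * psum 2 (\<lambda>x. \<zeta> i x - quasi_reg g (\<zeta> i) x) + 1 / (2 * t) * psum 2 (\<zeta> i))"
        using \<zeta> \<open>t > 0\<close> by (intro sum_mono l2_ip_bound psummable_diff) auto
      also have "\<dots> = t / 2 * (\<Sum>i<n. psum 2 (\<lambda>x. \<zeta> i x - quasi_reg g (\<zeta> i) x)) + 1 / (2 * t) * c"
        by (simp only: sum.distrib norm flip: sum_distrib_left)
      also have "\<dots> \<le> t / 2 * (c * \<delta>) + 1 / (2 * t) * c"
        using diff \<open>t > 0\<close> by simp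
      also have "\<dots> = \<epsilon> / 2"
        using c \<open>c > 0\<close> by (simp add: t_def \<delta>_def field_simps power2_eq_square)
      finally show False
        using g c by simp
    qed
  qed
  then show thesis
    using that c \<open>\<delta> > 0\<close> by blast
qed

section \<open>Actions with open stabilizers\<close>

text \<open>A right action makes composition with \<open>tau g\<close> a representation in the given
  order of factors, without inverses. The points carry no topology: open stabilizers express
  continuity for the discrete one.\<close>

locale right_action =
  fixes tau :: "'g::topological_group_add \<Rightarrow> 'y \<Rightarrow> 'y"
  assumes tau_zero: "tau 0 y = y"
    and tau_add: "tau (g + h) y = tau h (tau g y)"
    and open_stabilizer: "open {g. tau g y = y}"
begin

lemma tau_minus [simp]: "tau (- g) (tau g y) = y" "tau g (tau (- g) y) = y"
  using tau_add[of g "- g" y] tau_add[of "- g" g y] by (simp_all add: tau_zero)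

lemma bij_tau: "bij (tau g)"
  by (rule o_bij[of "tau (- g)"]) (auto simp: fun_eq_iff)

definition orb :: "'y \<Rightarrow> 'y set" where
  "orb y = range (\<lambda>g. tau g y)"

lemma orb_self [simp]: "y \<in> orb y"
  unfolding orb_def using tau_zero[of y] by (metis rangeI)

lemma tau_in_orb [simp]: "tau g y \<in> orb y"
  by (simp add: orb_def)

lemma orb_tau [simp]: "orb (tau g y) = orb y"
proof -
  have "\<And>h. tau h (tau g y) = tau (g + h) y" "\<And>h. tau h y = tau (- g + h) (tau g y)"
    by (simp_all add: tau_add)
  then show ?thesis
    unfolding orb_def by blast
qed

lemma orb_eq: "z \<in> orb y \<Longrightarrow> orb z = orb y"
  by (metis orb_def orb_tau rangeE)

lemma mem_orb_iff: "z \<in> orb y \<longleftrightarrow> orb z = orb y"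
  by (metis orb_eq orb_self)

lemma invariant_on_orb: "(\<And>g y. \<psi> (tau g y) = \<psi> y) \<Longrightarrow> z \<in> orb y \<Longrightarrow> \<psi> z = \<psi> y"
  by (auto simp: orb_def)

lemma open_fibre: "open {g. tau g y = z}"
proof (cases "\<exists>g0. tau g0 y = z")
  case True
  then obtain g0 where g0: "tau g0 y = z"
    by blast
  have "tau g y = z \<longleftrightarrow> tau (g + - g0) y = y" for g
    unfolding tau_add g0[symmetric] by (metis tau_minus)
  then show ?thesis
    using open_right_translate[OF open_stabilizer[of y], of "- g0"] by simp
next
  case False
  then show ?thesis
    by simp
qed

text \<open>The fibres of the orbit map are open and disjoint, so a compact set meets only finitely
  many.\<close>

lemma finite_compact_image:
  assumes "compact K"
  shows "finite ((\<lambda>g. tau g y) ` K)"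
proof -
  obtain C where "C \<subseteq> UNIV" "finite C" "K \<subseteq> (\<Union>z\<in>C. {g. tau g y = z})"
    by (rule compactE_image[OF assms, of UNIV "\<lambda>z. {g. tau g y = z}"]) (auto simp: open_fibre)
  then have "(\<lambda>g. tau g y) ` K \<subseteq> C"
    by auto
  then show ?thesis
    using \<open>finite C\<close> finite_subset by blast
qed

section \<open>Orbit means and functions of mean zero\<close>

definition orb_mean :: "('y \<Rightarrow> complex) \<Rightarrow> 'y \<Rightarrow> complex" where
  "orb_mean F y = (if finite (orb y) then (\<Sum>z\<in>orb y. F z) / of_nat (card (orb y)) else 0)"

lemma orb_mean_tau [simp]: "orb_mean F (tau g y) = orb_mean F y"
  by (simp add: orb_mean_def)

lemma finite_orb_mean:
  assumes "finite {y. F y \<noteq> 0}"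
  shows "finite {y. orb_mean F y \<noteq> 0}"
proof (rule finite_subset)
  show "{y. orb_mean F y \<noteq> 0} \<subseteq> (\<Union>z\<in>{z. F z \<noteq> 0 \<and> finite (orb z)}. orb z)"
  proof
    fix y assume "y \<in> {y. orb_mean F y \<noteq> 0}"
    then have "finite (orb y)" "(\<Sum>z\<in>orb y. F z) \<noteq> 0"
      by (auto simp: orb_mean_def split: if_splits)
    then obtain z where "z \<in> orb y" "F z \<noteq> 0"
      by (meson sum.neutral)
    then show "y \<in> (\<Union>z\<in>{z. F z \<noteq> 0 \<and> finite (orb z)}. orb z)"
      using \<open>finite (orb y)\<close> orb_eq[of z y] orb_self[of y] by auto
  qed
  show "finite (\<Union>z\<in>{z. F z \<noteq> 0 \<and> finite (orb z)}. orb z)"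
    using assms by auto
qed

text \<open>These are finitely supported vectors that annihilate every summable invariant function;
  infinite orbits impose no condition, since such a function vanishes there. No exponent occurs, so
  the same notion serves l_2 and l_p.\<close>

definition balanced :: "('y \<Rightarrow> complex) \<Rightarrow> bool" where
  "balanced F \<longleftrightarrow> finite {y. F y \<noteq> 0} \<and> (\<forall>y. finite (orb y) \<longrightarrow> (\<Sum>z\<in>orb y. F z) = 0)"

lemma balanced_diff_orb_mean:
  assumes "finite {y. F y \<noteq> 0}"
  shows "balanced (\<lambda>y. F y - orb_mean F y)"
proof -
  have "(\<Sum>z\<in>orb y. F z - orb_mean F z) = 0" if "finite (orb y)" for y
  proof -
    have "(\<Sum>z\<in>orb y. orb_mean F z) = (\<Sum>z\<in>orb y. orb_mean F y)"
      by (rule sum.cong) (auto intro: invariant_on_orb)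
    also have "\<dots> = (\<Sum>z\<in>orb y. F z)"
      using that orb_self[of y] by (auto simp: orb_mean_def card_eq_0_iff simp del: orb_self)
    finally show ?thesis
      by (simp add: sum_subtractf)
  qed
  moreover have "finite {y. F y - orb_mean F y \<noteq> 0}"
    by (rule finite_subset[OF _ finite_UnI[OF assms finite_orb_mean[OF assms]]]) auto
  ultimately show ?thesis
    by (simp add: balanced_def)
qed

lemma balanced_orthogonal:
  assumes F: "balanced F" and inv: "\<And>g y. \<psi> (tau g y) = \<psi> y"
    and inf: "\<And>y. infinite (orb y) \<Longrightarrow> \<psi> y = 0"
    and A: "finite A" "\<And>y. y \<notin> A \<Longrightarrow> F y = 0"
  shows "(\<Sum>y\<in>A. F y * \<psi> y) = 0"
proof -
  \<comment> \<open>\<open>A\<close> need not be a union of orbits. \<open>B\<close> collects the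
    full finite orbits that meet the support, so that the sum can be grouped by orbit with
    \<open>\<psi>\<close> constant on each group.\<close>
  define B where "B = (\<Union>z\<in>{z. F z \<noteq> 0 \<and> finite (orb z)}. orb z)"
  have B: "finite B" "\<And>y. y \<in> B \<Longrightarrow> finite (orb y) \<and> orb y \<subseteq> B"
    using F by (auto simp: B_def balanced_def mem_orb_iff) 
  have "F y * \<psi> y = 0" if "y \<notin> B" for y
    using that inf[of y] orb_self[of y] unfolding B_def by fastforce
  then have "(\<Sum>y\<in>A. F y * \<psi> y) = (\<Sum>y\<in>A \<inter> B. F y * \<psi> y)"
    using A by (intro sum.mono_neutral_right) auto
  also have "\<dots> = (\<Sum>y\<in>B. F y * \<psi> y)"
    using A B by (intro sum.mono_neutral_left) auto
  also have "\<dots> = (\<Sum>P\<in>orb ` B. \<Sum>y\<in>{y \<in> B. orb y = P}. F y * \<psi> y)"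
    by (rule sum.group[symmetric]) (use B in auto)
  also have "\<dots> = 0"
  proof (rule sum.neutral, safe)
    fix y assume "y \<in> B"
    then have "{z \<in> B. orb z = orb y} = orb y"
      using B(2)[of y] by (auto simp: mem_orb_iff)
    then have "(\<Sum>z\<in>{z \<in> B. orb z = orb y}. F z * \<psi> z) = (\<Sum>z\<in>orb y. F z * \<psi> y)"
      by (auto intro!: sum.cong dest: invariant_on_orb[of \<psi>, OF inv])
    also have "\<dots> = 0"
      using F B(2)[OF \<open>y \<in> B\<close>] by (simp add: balanced_def flip: sum_distrib_right)
    finally show "(\<Sum>z\<in>{z \<in> B. orb z = orb y}. F z * \<psi> z) = 0" .
  qed
  finally show ?thesis .
qed

lemma psum_tau [simp]: "psum p (\<lambda>y. F (tau g y)) = psum p F"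
  by (rule psum_reindex[OF bij_tau])

lemma psummable_tau [simp]: "psummable p (\<lambda>y. F (tau g y)) = psummable p F"
  by (rule psummable_reindex[OF bij_tau])

section \<open>Orbits as coset spaces of open stabilizers\<close>

definition stab :: "'y \<Rightarrow> 'g set" where
  "stab y = {g. tau g y = y}"

lemma open_subgroup_stab: "open_subgroup (stab y)"
  unfolding open_subgroup_def stab_def using open_stabilizer[of y]
  by (auto simp: tau_zero tau_add) (metis tau_minus(1))

text \<open>The identification of cosets of the stabilizer with the orbit. The negation converts the
  right action on points into left translation of cosets; the result does not depend on the
  representative picked.\<close>

definition coset_pt :: "'y \<Rightarrow> 'g set \<Rightarrow> 'y" where
  "coset_pt y x = tau (- (SOME g. g \<in> x)) y"

lemma coset_pt: "coset_pt y ((+) g ` stab y) = tau (- g) y"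
proof -
  have "g \<in> (+) g ` stab y"
    by (rule image_eqI[of _ _ 0]) (auto simp: stab_def tau_zero)
  then have "(SOME g'. g' \<in> (+) g ` stab y) \<in> (+) g ` stab y"
    by (rule someI)
  then obtain h where "(SOME g'. g' \<in> (+) g ` stab y) = g + h" "tau h y = y"
    by (auto simp: stab_def)
  moreover have "tau (- h) y = y"
    using \<open>tau h y = y\<close> by (metis tau_minus(1))
  ultimately show ?thesis
    by (simp add: coset_pt_def minus_add tau_add del: add_uminus_conv_diff)
qed

lemma coset_pt_translate:
  assumes "x \<in> left_cosets (stab y)"
  shows "coset_pt y ((+) (- g) ` x) = tau g (coset_pt y x)"
proof -
  obtain k where "x = (+) k ` stab y"
    using assms by (auto simp: left_cosets_def)
  then show ?thesis
    by (simp add: translate_translate coset_pt minus_add tau_add del: add_uminus_conv_diff)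
qed

lemma bij_coset_pt: "bij_betw (coset_pt y) (left_cosets (stab y)) (orb y)"
  unfolding bij_betw_def
proof
  show "inj_on (coset_pt y) (left_cosets (stab y))"
  proof (rule inj_onI)
    fix a b assume "a \<in> left_cosets (stab y)" "b \<in> left_cosets (stab y)" and eq: "coset_pt y a = coset_pt y b"
    then obtain g h where gh: "a = (+) g ` stab y" "b = (+) h ` stab y"
      by (auto simp: left_cosets_def)
    then have "tau (- g) y = tau (- h) y"
      using eq by (simp add: coset_pt)
    then have e: "tau (- g + h) y = y" "tau (- h + g) y = y"
      by (metis tau_add tau_minus(2))+
    have "a = (+) h ` (+) (- h + g) ` stab y"
      unfolding gh translate_translate by (simp flip: add.assoc)
    also have "(+) (- h + g) ` stab y = stab y"
    proof (intro equalityI subsetI)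
      fix k assume "k \<in> stab y"
      then have "k = (- h + g) + (- g + h + k)" "- g + h + k \<in> stab y"
        using e by (auto simp: stab_def tau_add simp flip: add.assoc)
      then show "k \<in> (+) (- h + g) ` stab y"
        by (rule image_eqI)
    qed (use e in \<open>auto simp: stab_def tau_add\<close>)
    finally show "a = b"
      using gh by simp
  qed
  show "coset_pt y ` left_cosets (stab y) = orb y"
  proof (intro equalityI subsetI)
    fix z assume "z \<in> orb y"
    then obtain g where "z = tau (- (- g)) y"
      by (auto simp: orb_def)
    then have "z = coset_pt y ((+) (- g) ` stab y)"
      unfolding coset_pt .
    then show "z \<in> coset_pt y ` left_cosets (stab y)"
      unfolding left_cosets_def by blast
  qed (auto simp: left_cosets_def coset_pt)
qed

definition on_cosets :: "'y \<Rightarrow> ('y \<Rightarrow> complex) \<Rightarrow> 'g set \<Rightarrow> complex" where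
  "on_cosets y F x = (if x \<in> left_cosets (stab y) then F (coset_pt y x) else 0)"

lemma psum_on_cosets:
  "psum p (on_cosets y F) = (\<Sum>\<^sub>\<infinity>z\<in>orb y. cmod (F z) powr p)"
proof -
  have "psum p (on_cosets y F) = (\<Sum>\<^sub>\<infinity>x\<in>left_cosets (stab y). cmod (F (coset_pt y x)) powr p)"
    unfolding psum_def by (rule infsum_cong_neutral) (auto simp: on_cosets_def)
  also have "\<dots> = (\<Sum>\<^sub>\<infinity>z\<in>orb y. cmod (F z) powr p)"
    by (rule infsum_reindex_bij_betw[OF bij_coset_pt])
  finally show ?thesis .
qed

lemma on_cosets_prime:
  assumes "balanced F"
  shows "on_cosets y F \<in> l2_cosets_prime (stab y)"
proof (rule l2_cosets_primeI)
  have "finite {x \<in> left_cosets (stab y). F (coset_pt y x) \<noteq> 0}"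
  proof (rule inj_on_finite)
    show "inj_on (coset_pt y) {x \<in> left_cosets (stab y). F (coset_pt y x) \<noteq> 0}"
      using bij_coset_pt[of y] by (auto simp: bij_betw_def intro: inj_on_subset)
    show "coset_pt y ` {x \<in> left_cosets (stab y). F (coset_pt y x) \<noteq> 0} \<subseteq> {z. F z \<noteq> 0}"
      by auto
  qed (use assms in \<open>simp add: balanced_def\<close>)
  then have "psummable 2 (on_cosets y F)"
    by (rule psummable_finite) (auto simp: on_cosets_def)
  then show "on_cosets y F \<in> l2_cosets (stab y)"
    by (auto simp: l2_cosets_iff on_cosets_def)
  assume "finite (left_cosets (stab y))"
  then have "finite (orb y)"
    using bij_betw_finite[OF bij_coset_pt] by blast
  have "(\<Sum>x\<in>left_cosets (stab y). on_cosets y F x) = (\<Sum>x\<in>left_cosets (stab y). F (coset_pt y x))"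
    by (simp add: on_cosets_def)
  also have "\<dots> = (\<Sum>z\<in>orb y. F z)"
    by (rule sum.reindex_bij_betw[OF bij_coset_pt])
  also have "\<dots> = 0"
    using assms \<open>finite (orb y)\<close> by (simp add: balanced_def)
  finally show "(\<Sum>x\<in>left_cosets (stab y). on_cosets y F x) = 0" .
qed

text \<open>Split along the finitely many orbits that meet its support, \<open>F\<close> becomes a
  finite family of vectors on coset spaces of stabilizers, with norms and displacements adding up.
  Being balanced puts each piece in the reduced representation.\<close>

lemma quasi_reg_gap_balanced:
  assumes gap: "quasi_reg_gap K \<epsilon>" and F: "balanced F"
    and inv: "\<And>g. g \<in> K \<Longrightarrow> psum 2 (\<lambda>y. F (tau g y) - F y) \<le> \<epsilon> * psum 2 F"
  shows "psum 2 F = 0"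
proof -
  define S where "S = {y. F y \<noteq> 0}"
  have "finite S"
    using F by (simp add: S_def balanced_def)
  \<comment> \<open>One representative for each orbit that meets the support.\<close>
  obtain R where R: "R \<subseteq> S" "inj_on orb R" "orb ` R = orb ` S"
    using subset_image_inj[of "orb ` S" orb S] by auto
  have "finite R"
    using R \<open>finite S\<close> finite_subset by blast
  then obtain r where r: "bij_betw r {..<card R} R"
    using ex_bij_betw_nat_finite[of R] by (auto simp: atLeast0LessThan)
  define n where "n = card R"
  have split: "(\<Sum>i<n. psum 2 (on_cosets (r i) f)) = psum 2 f"
    if f: "finite {y. f y \<noteq> 0}" "\<And>y. f y \<noteq> 0 \<Longrightarrow> orb y \<in> orb ` S" for f
  proof -
    let ?h = "\<lambda>z. cmod (f z) powr 2"
    have s: "?h summable_on B" for B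
      by (rule finite_nonzero_values_imp_summable_on) (use f in \<open>auto intro: rev_finite_subset\<close>)
    have "(\<Sum>i<n. psum 2 (on_cosets (r i) f)) = (\<Sum>y\<in>R. infsum ?h (orb y))"
      unfolding psum_on_cosets n_def by (rule sum.reindex_bij_betw[OF r])
    also have "\<dots> = infsum ?h (\<Union>y\<in>R. orb y)"
      using \<open>finite R\<close> s R(2) by (intro sum_infsum) (auto simp: inj_on_def mem_orb_iff)
    also have "\<dots> = psum 2 f"
      unfolding psum_def
    proof (rule infsum_cong_neutral)
      fix z assume "z \<in> UNIV - (\<Union>y\<in>R. orb y)"
      then have "orb z \<notin> orb ` S"
        unfolding R(3)[symmetric] by (auto simp: mem_orb_iff)
      then show "?h z = 0"
        using f(2) by auto
    qed auto
    finally show ?thesis .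
  qed
  have norm: "(\<Sum>i<n. psum 2 (on_cosets (r i) F)) = psum 2 F"
    using \<open>finite S\<close> by (intro split) (auto simp: S_def)
  have diff: "(\<Sum>i<n. psum 2 (\<lambda>x. quasi_reg g (on_cosets (r i) F) x - on_cosets (r i) F x))
      = psum 2 (\<lambda>y. F (tau g y) - F y)" for g
  proof -
    have "(\<lambda>x. quasi_reg g (on_cosets y F) x - on_cosets y F x) = on_cosets y (\<lambda>z. F (tau g z) - F z)" for y
      by (auto simp: fun_eq_iff quasi_reg_def on_cosets_def left_cosets_translate coset_pt_translate)
    moreover have "finite {y. F (tau g y) - F y \<noteq> 0}"
    proof (rule finite_subset)
      show "{y. F (tau g y) - F y \<noteq> 0} \<subseteq> S \<union> tau g -` S"
        by (auto simp: S_def)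
      show "finite (S \<union> tau g -` S)"
        using \<open>finite S\<close> bij_tau by (auto intro: finite_vimageI bij_is_inj)
    qed
    moreover have "orb y \<in> orb ` S" if "F (tau g y) - F y \<noteq> 0" for y
    proof (cases "F y = 0")
      case True
      then have "tau g y \<in> S"
        using that by (simp add: S_def)
      then show ?thesis
        by (metis imageI orb_tau)
    qed (simp add: S_def)
    ultimately show ?thesis
      using split[of "\<lambda>z. F (tau g z) - F z"] by simp
  qed
  have "(\<Sum>i<n. psum 2 (on_cosets (r i) F)) = 0"
    using gap[unfolded quasi_reg_gap_def, rule_format, of n "\<lambda>i. stab (r i)" "\<lambda>i. on_cosets (r i) F"]
    using open_subgroup_stab on_cosets_prime[OF F] inv by (simp add: norm diff)
  then show ?thesis
    by (simp add: norm)
qed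

end

section \<open>Almost invariant functions on the multiplicative group\<close>

lemma psum_avg_le:
  fixes f :: "nat \<Rightarrow> 'a \<Rightarrow> complex"
  assumes "\<And>j. j < m \<Longrightarrow> finite {x. f j x \<noteq> 0}" "\<And>j. j < m \<Longrightarrow> psum 1 (f j) \<le> e" "m > 0"
  shows "psum 1 (\<lambda>x. (\<Sum>j<m. f j x) / of_nat m) \<le> e"
proof -
  define A where "A = (\<Union>j<m. {x. f j x \<noteq> 0})"
  have A: "finite A"
    using assms by (auto simp: A_def)
  have "psum 1 (\<lambda>x. (\<Sum>j<m. f j x) / of_nat m) = (\<Sum>x\<in>A. cmod ((\<Sum>j<m. f j x) / of_nat m))"
    by (subst psum_finite[OF A]) (auto simp: A_def)
  also have "\<dots> \<le> (\<Sum>x\<in>A. (\<Sum>j<m. cmod (f j x)) / of_nat m)"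
    by (intro sum_mono) (auto simp: norm_divide intro!: divide_right_mono norm_sum)
  also have "\<dots> = (\<Sum>j<m. \<Sum>x\<in>A. cmod (f j x)) / of_nat m"
    by (subst sum.swap) (simp add: sum_divide_distrib)
  also have "\<dots> = (\<Sum>j<m. psum 1 (f j)) / of_nat m"
  proof -
    have "psum 1 (f j) = (\<Sum>x\<in>A. cmod (f j x))" if "j < m" for j
      by (subst psum_finite[OF A]) (use that in \<open>auto simp: A_def\<close>)
    then show ?thesis
      by simp
  qed
  also have "\<dots> \<le> (\<Sum>j<m. e) / of_nat m"
    using assms by (intro divide_right_mono sum_mono) auto
  also have "\<dots> = e"
    using assms by simp
  finally show ?thesis .
qed

lemma finite_support_mult:
  fixes z :: "'a::field"
  assumes "finite {w. m w \<noteq> 0}" "z \<noteq> 0"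
  shows "finite {w. m (z * w) \<noteq> 0}"
proof -
  have "inj (\<lambda>w. z * w)"
    using assms by (auto simp: inj_on_def)
  then show ?thesis
    using finite_vimageI[OF assms(1), of "\<lambda>w. z * w"] by (simp add: vimage_def)
qed

text \<open>Amenability of the multiplicative group: averaging over the powers of the next element
  preserves the approximate invariance already achieved, since the group is commutative.\<close>

lemma almost_invariant_mean_exists:
  fixes Z :: "complex set"
  assumes "finite Z" "0 \<notin> Z" "\<epsilon> > 0"
  shows "\<exists>m :: complex \<Rightarrow> real. finite {w. m w \<noteq> 0} \<and> (\<forall>w. m w \<ge> 0) \<and> m 0 = 0 \<and>
           psum 1 (\<lambda>w. of_real (m w)) = 1 \<and>
           (\<forall>z\<in>Z. psum 1 (\<lambda>w. of_real (m (z * w)) - of_real (m w)) \<le> \<epsilon>)"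
  using assms
proof (induction Z rule: finite_induct)
  case empty
  show ?case
  proof (intro exI[of _ "\<lambda>w. if w = 1 then 1 else 0"] conjI)
    show "psum 1 (\<lambda>w::complex. of_real (if w = 1 then 1 else 0)) = 1"
      by (subst psum_finite[of "{1}"]) auto
  qed auto
next
  case (insert z Z)
  then obtain m where m: "finite {w. m w \<noteq> 0}" "\<And>w. m w \<ge> 0" "m 0 = 0"
    "psum 1 (\<lambda>w. of_real (m w)) = 1"
    and mZ: "\<And>z'. z' \<in> Z \<Longrightarrow> psum 1 (\<lambda>w. of_real (m (z' * w)) - of_real (m w)) \<le> \<epsilon>"
    by auto
  have z: "z \<noteq> 0"
    using insert.prems by auto
  \<comment> \<open>Averaging over the first \<open>N\<close> powers of \<open>z\<close> telescopes,
    leaving two functions of mass 1 divided by \<open>N\<close>; their difference has mass at most 4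
    by the crude bound.\<close>
  obtain N :: nat where N: "4 / \<epsilon> < real N"
    using reals_Archimedean2 by blast
  have "N > 0"
    using N \<open>\<epsilon> > 0\<close> by (cases N) (auto simp: divide_less_0_iff)
  have bij: "bij (\<lambda>w. z ^ j * w)" for j
    by (rule o_bij[of "\<lambda>w. w / z ^ j"]) (use z in \<open>auto simp: fun_eq_iff\<close>)
  have fin: "finite {w. h (z ^ j * w) \<noteq> 0}" if "finite {w. h w \<noteq> 0}" for h :: "complex \<Rightarrow> complex" and j
    using finite_vimageI[OF that bij_is_inj[OF bij]] by (simp add: vimage_def)
  have finm: "finite {w. complex_of_real (m (z ^ j * w)) \<noteq> 0}" for j
    using fin[of "\<lambda>w. of_real (m w)" j] m by simp
  have psm: "psum 1 (\<lambda>w. complex_of_real (m (z ^ j * w))) = 1" for j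
    using psum_reindex[OF bij[of j], of 1 "\<lambda>w. complex_of_real (m w)"] m by simp
  define n where "n w = (\<Sum>j<N. m (z ^ j * w)) / real N" for w
  have n_eq: "complex_of_real (n w) = (\<Sum>j<N. complex_of_real (m (z ^ j * w))) / of_nat N" for w
    by (simp add: n_def)
  have n0: "n w \<ge> 0" for w
    using m by (simp add: n_def sum_nonneg)
  have A: "finite (\<Union>j<N. {w. complex_of_real (m (z ^ j * w)) \<noteq> 0})" (is "finite ?A")
    using finm by blast
  have n_out: "n w = 0" if "w \<notin> ?A" for w
    using that by (auto simp: n_def)
  have "psum 1 (\<lambda>w. complex_of_real (n w)) = (\<Sum>w\<in>?A. n w)"
    by (subst psum_finite[OF A]) (use n_out n0 in auto)
  also have "\<dots> = (\<Sum>j<N. \<Sum>w\<in>?A. m (z ^ j * w)) / real N"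
    unfolding n_def by (subst sum.swap) (simp add: sum_divide_distrib)
  also have "\<dots> = (\<Sum>j<N. 1) / real N"
  proof -
    have "(\<Sum>w\<in>?A. m (z ^ j * w)) = 1" if "j < N" for j
    proof -
      have "psum 1 (\<lambda>w. complex_of_real (m (z ^ j * w))) = (\<Sum>w\<in>?A. m (z ^ j * w))"
        by (subst psum_finite[OF A]) (use that m in auto)
      then show ?thesis
        using psm by simp
    qed
    then show ?thesis
      by simp
  qed
  finally have n1: "psum 1 (\<lambda>w. complex_of_real (n w)) = 1"
    using \<open>N > 0\<close> by simp
  have nZ: "psum 1 (\<lambda>w. of_real (n (z' * w)) - of_real (n w)) \<le> \<epsilon>" if "z' \<in> Z" for z'
  proof -
    define d where "d w = complex_of_real (m (z' * w)) - of_real (m w)" for w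
    have z': "z' \<noteq> 0"
      using that insert.prems by auto
    have "finite ({w. m w \<noteq> 0} \<union> {w. m (z' * w) \<noteq> 0})"
      using finite_support_mult[OF m(1) z'] m(1) by simp
    then have find: "finite {w. d w \<noteq> 0}"
      by (rule rev_finite_subset) (auto simp: d_def)
    have "(\<lambda>w. of_real (n (z' * w)) - of_real (n w)) = (\<lambda>w. (\<Sum>j<N. d (z ^ j * w)) / of_nat N)"
      unfolding n_eq d_def sum_subtractf diff_divide_distrib by (simp only: mult.left_commute[of z'])
    moreover have "psum 1 (\<lambda>w. (\<Sum>j<N. d (z ^ j * w)) / of_nat N) \<le> \<epsilon>"
    proof (rule psum_avg_le)
      show "finite {w. d (z ^ j * w) \<noteq> 0}" for j
        by (rule fin[OF find])
      show "psum 1 (\<lambda>w. d (z ^ j * w)) \<le> \<epsilon>" for j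
        using psum_reindex[OF bij[of j], of 1 d] mZ[OF that] by (simp add: d_def[abs_def])
    qed fact
    ultimately show ?thesis
      by simp
  qed
  have nz: "psum 1 (\<lambda>w. of_real (n (z * w)) - of_real (n w)) \<le> \<epsilon>"
  proof -
    have "(\<Sum>j<N. complex_of_real (m (z ^ j * (z * w)))) - (\<Sum>j<N. of_real (m (z ^ j * w)))
        = of_real (m (z ^ N * w)) - of_real (m w)" for w
    proof -
      have e: "z ^ j * (z * w) = z * z ^ j * w" for j
        by (simp only: mult.assoc mult.left_commute[of z])
      show ?thesis
        using sum_lessThan_telescope[of "\<lambda>j. complex_of_real (m (z ^ j * w))" N]
        unfolding sum_subtractf e by simp
    qed
    note tel = this
    have eq: "(\<lambda>w. complex_of_real (n (z * w)) - of_real (n w))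
        = (\<lambda>w. (1 / of_nat N) * (of_real (m (z ^ N * w)) - of_real (m w)))"
      unfolding n_eq diff_divide_distrib[symmetric] tel by simp
    have "psum 1 (\<lambda>w. complex_of_real (m (z ^ N * w)) - of_real (m w)) \<le> 2 powr 1 * (1 + 1)"
    proof -
      have "psummable 1 (\<lambda>w. complex_of_real (m w))" "psummable 1 (\<lambda>w. complex_of_real (m (z ^ N * w)))"
        by (rule psummable_finite[OF m(1)], simp) (rule psummable_finite[OF finm[of N]], simp)
      then show ?thesis
        using psum_diff_le[of 1 "\<lambda>w. complex_of_real (m (z ^ N * w))" "\<lambda>w. complex_of_real (m w)"] psm m by simp
    qed
    then have "psum 1 (\<lambda>w. complex_of_real (n (z * w)) - of_real (n w)) \<le> 4 / real N"
      unfolding eq psum_cmult using \<open>N > 0\<close> by (simp add: norm_divide divide_right_mono)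
    also have "\<dots> \<le> \<epsilon>"
      using N \<open>N > 0\<close> \<open>\<epsilon> > 0\<close> by (simp add: field_simps)
    finally show ?thesis .
  qed
  have "finite {w. n w \<noteq> 0}"
    by (rule finite_subset[OF _ A]) (use n_out in fast)
  moreover have "n 0 = 0"
    using m by (simp add: n_def)
  ultimately show ?case
    using n0 n1 nZ nz by (intro exI[of _ n]) auto
qed

lemma sqrt_diff_squared_le:
  fixes a b :: real
  assumes "a \<ge> 0" "b \<ge> 0"
  shows "(sqrt a - sqrt b)\<^sup>2 \<le> \<bar>a - b\<bar>"
proof -
  have "\<bar>sqrt a - sqrt b\<bar> * \<bar>sqrt a - sqrt b\<bar> \<le> \<bar>sqrt a - sqrt b\<bar> * (sqrt a + sqrt b)"
    using assms by (intro mult_left_mono) (auto simp: abs_le_iff)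
  also have "\<dots> = \<bar>(sqrt a - sqrt b) * (sqrt a + sqrt b)\<bar>"
    using assms by (simp add: abs_mult)
  also have "(sqrt a - sqrt b) * (sqrt a + sqrt b) = a - b"
    using assms by (simp add: algebra_simps)
  finally show ?thesis
    by (simp add: power2_eq_square)
qed

text \<open>The square root of an almost invariant mean: squared differences of roots are at most
  differences of the values. The point 0 is excluded because it is no element of the multiplicative
  group and would project to untwisted orbits.\<close>

lemma almost_invariant_l2_function_exists:
  fixes Z :: "complex set"
  assumes "finite Z" "0 \<notin> Z" "\<epsilon> > 0"
  obtains k :: "complex \<Rightarrow> complex" where "finite {w. k w \<noteq> 0}" "k 0 = 0" "psum 2 k = 1"
    "\<And>z. z \<in> Z \<Longrightarrow> psum 2 (\<lambda>w. k (z * w) - k w) \<le> \<epsilon>"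
proof -
  obtain m :: "complex \<Rightarrow> real" where m: "finite {w. m w \<noteq> 0}" "\<And>w. m w \<ge> 0" "m 0 = 0"
    "psum 1 (\<lambda>w. of_real (m w)) = 1"
    and mZ: "\<And>z. z \<in> Z \<Longrightarrow> psum 1 (\<lambda>w. of_real (m (z * w)) - of_real (m w)) \<le> \<epsilon>"
    using almost_invariant_mean_exists[OF assms] by auto
  define k where "k w = complex_of_real (sqrt (m w))" for w
  have "psum 2 k = psum 1 (\<lambda>w. of_real (m w))"
    using m by (simp add: psum_def k_def)
  moreover have "psum 2 (\<lambda>w. k (z * w) - k w) \<le> \<epsilon>" if "z \<in> Z" for z
  proof -
    have "z \<noteq> 0"
      using that assms(2) by auto
    then have "finite ({w. m w \<noteq> 0} \<union> {w. m (z * w) \<noteq> 0})"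
      using finite_support_mult[OF m(1)] m(1) by simp
    then have s: "psummable p (\<lambda>w. k (z * w) - k w)"
        "psummable p (\<lambda>w. complex_of_real (m (z * w)) - of_real (m w))" for p
      by (auto intro!: psummable_finite[where A="{w. m w \<noteq> 0} \<union> {w. m (z * w) \<noteq> 0}"] simp: k_def)
    have "psum 2 (\<lambda>w. k (z * w) - k w) \<le> psum 1 (\<lambda>w. complex_of_real (m (z * w)) - of_real (m w))"
      unfolding psum_def
    proof (rule infsum_mono)
      show "cmod (k (z * w) - k w) powr 2 \<le> cmod (complex_of_real (m (z * w)) - of_real (m w)) powr 1" for w
        using sqrt_diff_squared_le[OF m(2) m(2), of "z * w" w]
        by (simp add: k_def norm_of_real flip: of_real_diff)
    qed (use s in \<open>simp_all only: psummable_def\<close>)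
    then show ?thesis
      using mZ[OF that] by simp
  qed
  moreover have "finite {w. k w \<noteq> 0}" "k 0 = 0"
    using m by (auto simp: k_def)
  ultimately show thesis
    using that m by simp
qed

lemma psum_2_prod:
  fixes h :: "'a \<times> 'b \<Rightarrow> complex"
  assumes "finite A" "finite B" "\<And>x z. h (x, z) \<noteq> 0 \<Longrightarrow> x \<in> A \<and> z \<in> B"
  shows "psum 2 h = (\<Sum>x\<in>A. psum 2 (\<lambda>z. h (x, z)))"
proof -
  have "psum 2 h = (\<Sum>y\<in>A \<times> B. cmod (h y) powr 2)"
    by (rule psum_finite) (use assms in auto)
  also have "\<dots> = (\<Sum>x\<in>A. \<Sum>z\<in>B. cmod (h (x, z)) powr 2)"
    by (simp add: sum.cartesian_product)
  also have "\<dots> = (\<Sum>x\<in>A. psum 2 (\<lambda>z. h (x, z)))"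
    by (intro sum.cong refl psum_finite[symmetric]) (use assms in auto)
  finally show ?thesis .
qed

section \<open>Monomial representations\<close>

text \<open>\<open>c\<close> is a unimodular cocycle over the right action \<open>sg\<close>. The
  last assumption is openness of stabilizers for the twisted action on pairs; at
  \<open>z = 0\<close> it concerns \<open>sg\<close> alone.\<close>

locale monomial_system =
  fixes sg :: "'g::topological_group_add \<Rightarrow> nat \<Rightarrow> nat" and c :: "'g \<Rightarrow> nat \<Rightarrow> complex"
  assumes c_unit [simp]: "cmod (c g x) = 1"
    and sg_zero: "sg 0 x = x" and c_zero: "c 0 x = 1"
    and sg_add: "sg (g + h) x = sg h (sg g x)"
    and c_add: "c (g + h) x = c g x * c h (sg g x)"
    and open_stab: "open {g. sg g x = x \<and> c g x * z = z}"
begin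

text \<open>All complex numbers are allowed as second coordinate to avoid a subtype for the circle.
  The nonzero ones merely give rescaled copies of the same orbits.\<close>

definition tau :: "'g \<Rightarrow> nat \<times> complex \<Rightarrow> nat \<times> complex" where
  "tau g y = (sg g (fst y), c g (fst y) * snd y)"

lemma tau_pair [simp]: "tau g (x, z) = (sg g x, c g x * z)"
  by (simp add: tau_def)

sublocale Y: right_action tau
proof unfold_locales
  show "tau 0 y = y" for y
    by (simp add: tau_def sg_zero c_zero)
  show "tau (g + h) y = tau h (tau g y)" for g h y
    by (simp add: tau_def sg_add c_add mult_ac)
  show "open {g. tau g y = y}" for y
    using open_stab[of "fst y" "snd y"] unfolding tau_def prod_eq_iff fst_conv snd_conv .
qed

definition act :: "'g \<Rightarrow> (nat \<Rightarrow> complex) \<Rightarrow> nat \<Rightarrow> complex" where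
  "act g f x = c g x * f (sg g x)"

lemma c_nonzero [simp]: "c g x \<noteq> 0"
  using c_unit[of g x] by force

lemma sg_minus [simp]: "sg (- g) (sg g x) = x" "sg g (sg (- g) x) = x"
  using sg_add[of g "- g" x] sg_add[of "- g" g x] by (simp_all add: sg_zero)

lemma bij_sg: "bij (sg g)"
  by (rule o_bij[of "sg (- g)"]) (auto simp: fun_eq_iff)

lemma psum_act [simp]: "psum p (act g f) = psum p f"
  using psum_reindex[OF bij_sg[of g], of p f] by (subst psum_norm_cong[of _ "\<lambda>x. f (sg g x)"]) (auto simp: act_def norm_mult)

lemma psummable_act [simp]: "psummable p (act g f) = psummable p f"
  using psummable_reindex[OF bij_sg[of g], of p f]
  by (subst psummable_norm_cong[of _ "\<lambda>x. f (sg g x)"]) (auto simp: act_def norm_mult)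

lemma act_mazur: "act g (\<lambda>x. mazur r (f x)) = (\<lambda>x. mazur r (act g f x))"
  by (simp add: fun_eq_iff act_def mazur_unimodular)

text \<open>Scaling the second coordinate commutes with the action. Hence for nonzero
  \<open>z\<close> finiteness of the twisted orbit depends on \<open>x\<close> alone.\<close>

lemma orb_scale: "Y.orb (x, z) = (\<lambda>y. (fst y, z * snd y)) ` Y.orb (x, 1)"
  by (auto simp: Y.orb_def image_image mult.commute)

lemma finite_orb_scale: "z \<noteq> 0 \<Longrightarrow> finite (Y.orb (x, z)) \<longleftrightarrow> finite (Y.orb (x, 1))"
  unfolding orb_scale[of x z] by (rule finite_image_iff) (auto simp: inj_on_def prod_eq_iff)

lemma finite_orb_sg: "finite (Y.orb (sg g x, 1)) \<longleftrightarrow> finite (Y.orb (x, 1))"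
proof -
  have "finite (Y.orb (sg g x, 1)) \<longleftrightarrow> finite (Y.orb (tau g (x, 1)))"
    using finite_orb_scale[of "c g x" "sg g x"] by simp
  then show ?thesis
    by (simp del: tau_pair)
qed

text \<open>The cocycle identity inverts \<open>c g x\<close> into the value of \<open>c\<close> at
  \<open>- g\<close> and \<open>sg g x\<close>. The base point then ranges over the finite set
  \<open>S\<close>, and the compact set of negatives moves each base point to finitely many
  pairs.\<close>

lemma finite_multipliers:
  assumes "compact K" "finite S"
  shows "finite {c g x | g x. g \<in> K \<and> sg g x \<in> S}"
proof (rule finite_subset)
  let ?h = "\<lambda>y. (\<lambda>w. inverse (snd w)) ` (\<lambda>g. tau g (y, 1)) ` uminus ` K"
  show "{c g x | g x. g \<in> K \<and> sg g x \<in> S} \<subseteq> (\<Union>y\<in>S. ?h y)"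
  proof safe
    fix g x assume "g \<in> K" "sg g x \<in> S"
    have "c g x * c (- g) (sg g x) = 1"
      using c_add[of g "- g" x] by (simp add: c_zero)
    then have "c g x = inverse (c (- g) (sg g x))"
      by (simp add: field_simps)
    then have "c g x \<in> ?h (sg g x)"
      using \<open>g \<in> K\<close> by (simp add: image_image)
    then show "c g x \<in> (\<Union>y\<in>S. ?h y)"
      using \<open>sg g x \<in> S\<close> by blast
  qed
  have "compact (uminus ` K)"
    using assms(1) by (intro compact_continuous_image continuous_on_subset[OF continuous_on_translation(3)]) auto
  then show "finite (\<Union>y\<in>S. ?h y)"
    using assms(2) Y.finite_compact_image by blast
qed

text \<open>The gap is applied to \<open>F (x, z) = cmod (f x) * k z\<close> with \<open>k\<close>
  almost invariant under the relevant phases. Passing to moduli does not increase displacements,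
  \<open>k\<close> absorbs the phases, and \<open>F\<close> is balanced because it lives on infinite
  orbits.\<close>

lemma infinite_orbit_bound:
  assumes gap: "quasi_reg_gap K \<epsilon>" "\<epsilon> > 0" "compact K"
    and f: "finite {x. f x \<noteq> 0}" "\<And>x. f x \<noteq> 0 \<Longrightarrow> infinite (Y.orb (x, 1))"
    and inv: "\<And>g. g \<in> K \<Longrightarrow> psum 2 (\<lambda>x. act g f x - f x) \<le> \<delta>" and "\<delta> \<ge> 0"
  shows "\<epsilon> * psum 2 f \<le> 8 * \<delta>"
proof (rule ccontr)
  assume "\<not> \<epsilon> * psum 2 f \<le> 8 * \<delta>"
  then have big: "8 * \<delta> < \<epsilon> * psum 2 f"
    by simp
  define S where "S = {x. f x \<noteq> 0}"
  \<comment> \<open>Only multipliers at points that \<open>K\<close> moves into the support of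
    \<open>f\<close> matter. They are finite in number, so amenability is needed for a finite set
    only.\<close>
  define Z where "Z = {c g x | g x. g \<in> K \<and> sg g x \<in> S}"
  have "finite Z" "0 \<notin> Z"
    using finite_multipliers[OF \<open>compact K\<close>, of S] f by (auto simp: Z_def S_def)
  then obtain k where k: "finite {w. k w \<noteq> 0}" "k 0 = 0" "psum 2 k = 1"
    and kZ: "\<And>z. z \<in> Z \<Longrightarrow> psum 2 (\<lambda>w. k (z * w) - k w) \<le> \<epsilon> / 8"
    using almost_invariant_l2_function_exists[of Z "\<epsilon> / 8"] \<open>\<epsilon> > 0\<close> by auto
  define a where "a x = complex_of_real (cmod (f x))" for x
  define F where "F y = a (fst y) * k (snd y)" for y
  have supp: "F (x, z) \<noteq> 0 \<longleftrightarrow> x \<in> S \<and> k z \<noteq> 0" for x z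
    by (simp add: F_def S_def a_def)
  have a: "finite {x. a x \<noteq> 0}" "psum 2 a = psum 2 f"
    using f by (auto simp: a_def intro: psum_norm_cong)
  have norm: "psum 2 F = psum 2 f"
  proof -
    have "psum 2 F = (\<Sum>x\<in>S. psum 2 (\<lambda>z. F (x, z)))"
      by (rule psum_2_prod[OF _ k(1)]) (use f supp in \<open>auto simp: S_def\<close>)
    also have "\<dots> = (\<Sum>x\<in>S. cmod (f x) powr 2)"
      unfolding F_def fst_conv snd_conv psum_cmult k by (simp add: a_def)
    also have "\<dots> = psum 2 f"
      by (rule psum_finite[symmetric]) (use f in \<open>auto simp: S_def\<close>)
    finally show ?thesis .
  qed
  have "Y.balanced F"
    unfolding Y.balanced_def
  proof (intro conjI allI impI)
    have "{y. F y \<noteq> 0} \<subseteq> S \<times> {w. k w \<noteq> 0}"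
      using supp by auto
    then show "finite {y. F y \<noteq> 0}"
      by (rule finite_subset) (use k f in \<open>auto simp: S_def\<close>)
    fix y assume fin: "finite (Y.orb y)"
    show "(\<Sum>z\<in>Y.orb y. F z) = 0"
    proof (rule sum.neutral, rule ballI, rule ccontr)
      fix z assume z: "z \<in> Y.orb y" "F z \<noteq> 0"
      then have "f (fst z) \<noteq> 0" "snd z \<noteq> 0"
        using k(2) by (auto simp: F_def a_def)
      then have "infinite (Y.orb z)"
        using f(2) finite_orb_scale[of "snd z" "fst z"] by simp
      then show False
        using fin Y.orb_eq[OF z(1)] by simp
    qed
  qed
  moreover have "psum 2 (\<lambda>y. F (tau g y) - F y) \<le> \<epsilon> * psum 2 F" if "g \<in> K" for g
  proof -
    \<comment> \<open>The displacement of \<open>F\<close> is \<open>u + v\<close>: \<open>u\<close>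
      moves the second coordinate and costs \<open>\<epsilon> / 8\<close> of the mass,
      \<open>v\<close> moves the modulus and costs \<open>\<delta>\<close>. Four times their sum
      stays below \<open>\<epsilon>\<close> times the mass since \<open>8 * \<delta>\<close> does.
      The weight in \<open>u\<close> is taken at \<open>sg g x\<close>, so only phases in
      \<open>Z\<close> occur.\<close>
    define u where "u y = a (sg g (fst y)) * (k (c g (fst y) * snd y) - k (snd y))" for y
    define v where "v y = (a (sg g (fst y)) - a (fst y)) * k (snd y)" for y
    define W where "W = {w. k w \<noteq> 0} \<union> (\<Union>z\<in>Z. {w. k (z * w) \<noteq> 0})"
    define T where "T = sg g -` S"
    have "finite W"
      using k(1) \<open>finite Z\<close> \<open>0 \<notin> Z\<close> by (auto simp: W_def intro: finite_support_mult)
    have "finite S"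
      using f by (simp add: S_def)
    have "finite T"
      unfolding T_def by (rule finite_vimageI[OF \<open>finite S\<close> bij_is_inj[OF bij_sg]])
    have suppu: "x \<in> T \<and> z \<in> W" if "u (x, z) \<noteq> 0" for x z
    proof -
      have "x \<in> T" "k (c g x * z) \<noteq> 0 \<or> k z \<noteq> 0"
        using that by (auto simp: u_def T_def S_def a_def)
      moreover have "c g x \<in> Z"
        using \<open>x \<in> T\<close> \<open>g \<in> K\<close> by (auto simp: Z_def T_def)
      ultimately show ?thesis
        by (auto simp: W_def)
    qed
    have suppv: "x \<in> S \<union> T \<and> z \<in> W" if "v (x, z) \<noteq> 0" for x z
      using that by (auto simp: v_def T_def S_def a_def W_def)
    have "psum 2 u = (\<Sum>x\<in>T. psum 2 (\<lambda>z. u (x, z)))"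
      by (rule psum_2_prod[OF \<open>finite T\<close> \<open>finite W\<close> suppu])
    also have "\<dots> \<le> (\<Sum>x\<in>T. cmod (a (sg g x)) powr 2 * (\<epsilon> / 8))"
    proof (rule sum_mono)
      fix x assume "x \<in> T"
      then have "c g x \<in> Z"
        using \<open>g \<in> K\<close> by (auto simp: Z_def T_def)
      then show "psum 2 (\<lambda>z. u (x, z)) \<le> cmod (a (sg g x)) powr 2 * (\<epsilon> / 8)"
        unfolding u_def fst_conv snd_conv psum_cmult by (intro mult_left_mono kZ) auto
    qed
    also have "\<dots> = psum 2 (\<lambda>x. a (sg g x)) * (\<epsilon> / 8)"
      by (subst psum_finite[OF \<open>finite T\<close>])
         (auto simp: T_def S_def a_def sum_distrib_right)
    also have "\<dots> = psum 2 f * (\<epsilon> / 8)"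
      using psum_reindex[OF bij_sg[of g], of 2 a] a by simp
    finally have u: "psum 2 u \<le> psum 2 f * (\<epsilon> / 8)" .
    have "psum 2 v = (\<Sum>x\<in>S \<union> T. psum 2 (\<lambda>z. v (x, z)))"
      by (rule psum_2_prod[OF _ \<open>finite W\<close> suppv]) (use \<open>finite T\<close> \<open>finite S\<close> in auto)
    also have "\<dots> = (\<Sum>x\<in>S \<union> T. cmod (a (sg g x) - a x) powr 2)"
      unfolding v_def fst_conv snd_conv psum_cmult k by simp
    also have "\<dots> = psum 2 (\<lambda>x. a (sg g x) - a x)"
      by (rule psum_finite[symmetric]) (use \<open>finite T\<close> \<open>finite S\<close> in \<open>auto simp: T_def S_def a_def\<close>)
    also have "\<dots> \<le> psum 2 (\<lambda>x. act g f x - f x)"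
    proof (rule psum_mono)
      show "psummable 2 (\<lambda>x. act g f x - f x)"
        by (rule psummable_finite[of "S \<union> T"]) (use \<open>finite T\<close> \<open>finite S\<close> in \<open>auto simp: T_def S_def act_def\<close>)
      show "cmod (a (sg g x) - a x) \<le> cmod (act g f x - f x)" for x
      proof -
        have "cmod (a (sg g x) - a x) = \<bar>cmod (act g f x) - cmod (f x)\<bar>"
          unfolding a_def of_real_diff[symmetric] norm_of_real by (simp add: act_def norm_mult)
        then show ?thesis
          using norm_triangle_ineq3 by metis
      qed
    qed simp
    also have "\<dots> \<le> \<delta>"
      by (rule inv[OF that])
    finally have v: "psum 2 v \<le> \<delta>" .
    have "psummable 2 u"
      by (rule psummable_finite[of "T \<times> W"]) (use \<open>finite T\<close> \<open>finite W\<close> suppu in auto)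
    moreover have "psummable 2 v"
      by (rule psummable_finite[of "(S \<union> T) \<times> W"]) (use \<open>finite T\<close> \<open>finite S\<close> \<open>finite W\<close> suppv in auto)
    moreover have "(\<lambda>y. F (tau g y) - F y) = (\<lambda>y. u y + v y)"
      by (auto simp: fun_eq_iff F_def u_def v_def algebra_simps)
    ultimately have "psum 2 (\<lambda>y. F (tau g y) - F y) \<le> 4 * (psum 2 u + psum 2 v)"
      using psum_add_le[of 2 u v] by simp
    also have "\<dots> \<le> 4 * (psum 2 f * (\<epsilon> / 8) + \<delta>)"
      by (intro mult_left_mono add_mono u v) simp
    also have "\<dots> \<le> \<epsilon> * psum 2 F"
      using big by (simp add: norm field_simps)
    finally show ?thesis .
  qed
  ultimately have "psum 2 F = 0"
    by (rule Y.quasi_reg_gap_balanced[OF gap(1)])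
  then show False
    using big norm \<open>\<delta> \<ge> 0\<close> by simp
qed

text \<open>On finite twisted orbits the lift of \<open>r\<close> to \<open>z * r x\<close>,
  normalized by the size of the fibre, intertwines \<open>act\<close> with the permutation action
  exactly. Taking orbit means there and pushing them down gives the invariant vector
  \<open>w\<close>, and the gap bounds the balanced remainder.\<close>

lemma finite_orbit_bound:
  assumes gap: "quasi_reg_gap K \<epsilon>"
    and f: "finite {x. f x \<noteq> 0}" "\<And>x. f x \<noteq> 0 \<Longrightarrow> finite (Y.orb (x, 1))"
    and inv: "\<And>g. g \<in> K \<Longrightarrow> psum 2 (\<lambda>x. act g f x - f x) \<le> \<delta>" and "\<delta> \<ge> 0"
  obtains w where "finite {x. w x \<noteq> 0}" "\<And>g. act g w = w" "\<epsilon> * psum 2 (\<lambda>x. f x - w x) \<le> \<delta>"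
proof -
  \<comment> \<open>At \<open>tau g (x, z)\<close> this takes the value
    \<open>z * act g f x\<close>. It is homogeneous in the second coordinate, hence so is its orbit
    mean for nonzero \<open>z\<close>, which therefore descends to the function \<open>w\<close> of
    \<open>x\<close>.\<close>
  define F1 where "F1 y = snd y * f (fst y)" for y
  define w where "w x = Y.orb_mean F1 (x, 1)" for x
  have mean: "Y.orb_mean F1 (x, z) = z * w x" if "z \<noteq> 0" for x z
  proof -
    have inj: "inj_on (\<lambda>y. (fst y, z * snd y)) (Y.orb (x, 1))"
      using that by (auto simp: inj_on_def prod_eq_iff)
    have "(\<Sum>y\<in>Y.orb (x, z). F1 y) = (\<Sum>y\<in>Y.orb (x, 1). z * F1 y)"
      unfolding orb_scale[of x z] by (subst sum.reindex[OF inj]) (auto simp: F1_def mult.assoc)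
    moreover have "card (Y.orb (x, z)) = card (Y.orb (x, 1))"
      unfolding orb_scale[of x z] by (rule card_image[OF inj])
    ultimately show ?thesis
      using finite_orb_scale[OF that] by (simp add: Y.orb_mean_def w_def sum_distrib_left[symmetric])
  qed
  have w_inv: "act g w = w" for g
  proof
    fix x
    have "act g w x = Y.orb_mean F1 (tau g (x, 1))"
      by (simp add: act_def mean)
    then show "act g w x = w x"
      by (simp add: w_def del: tau_pair)
  qed
  define E where "E = (\<Union>x\<in>{x. f x \<noteq> 0}. Y.orb (x, 1))"
  have "finite E"
    using f by (auto simp: E_def)
  have E_tau: "tau g y \<in> E \<longleftrightarrow> y \<in> E" for g y
    by (simp add: E_def Y.mem_orb_iff del: tau_pair)
  have E_unit: "cmod (snd y) = 1" if "y \<in> E" for y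
    using that by (auto simp: E_def Y.orb_def)
  have f_E: "x \<in> fst ` E" if "f x \<noteq> 0" for x
  proof -
    have "(x, 1) \<in> E"
      unfolding E_def using that Y.orb_self by blast
    from imageI[OF this, of fst] show ?thesis
      by simp
  qed
  have w_E: "x \<in> fst ` E" if "w x \<noteq> 0" for x
  proof -
    have "(\<Sum>y\<in>Y.orb (x, 1). F1 y) \<noteq> 0"
      using that by (auto simp: w_def Y.orb_mean_def split: if_splits)
    then obtain y where y: "y \<in> Y.orb (x, 1)" "F1 y \<noteq> 0"
      by (meson sum.neutral)
    then obtain g where g: "y = tau g (x, 1)"
      by (auto simp: Y.orb_def)
    have "f (sg g x) \<noteq> 0"
      using y g by (simp add: F1_def)
    then have "(sg g x, 1) \<in> E"
      unfolding E_def using Y.orb_self by blast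
    then have "tau (- g) (sg g x, 1) \<in> E"
      by (simp only: E_tau)
    from imageI[OF this, of fst] show ?thesis
      by simp
  qed
  have fin_w: "finite {x. w x \<noteq> 0}"
    by (rule finite_subset[of _ "fst ` E"]) (use w_E \<open>finite E\<close> in auto)
  \<comment> \<open>Size of the fibre of \<open>E\<close> over \<open>x\<close>. The action maps
    fibres bijectively, so \<open>e\<close> is constant along orbits, and division by its root gives
    the lift the mass of the original.\<close>
  define e where "e x = card {z. (x, z) \<in> E}" for x
  have fin_fibre: "finite {z. (x, z) \<in> E}" for x
    by (rule finite_subset[of _ "snd ` E"]) (use \<open>finite E\<close> in force)+
  have e_sg: "e (sg g x) = e x" for g x
  proof -
    have "bij_betw (\<lambda>z. c g x * z) {z. (x, z) \<in> E} {z. (sg g x, z) \<in> E}"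
    proof (rule bij_betwI[where g="\<lambda>z. z / c g x"])
      show "(\<lambda>z. c g x * z) \<in> {z. (x, z) \<in> E} \<rightarrow> {z. (sg g x, z) \<in> E}"
        using E_tau[of g "(x, _)"] by auto
      show "(\<lambda>z. z / c g x) \<in> {z. (sg g x, z) \<in> E} \<rightarrow> {z. (x, z) \<in> E}"
      proof
        fix z assume "z \<in> {z. (sg g x, z) \<in> E}"
        then have "tau g (x, z / c g x) \<in> E"
          by simp
        then show "z / c g x \<in> {z. (x, z) \<in> E}"
          by (simp only: E_tau mem_Collect_eq)
      qed
    qed auto
    then show ?thesis
      unfolding e_def by (metis bij_betw_same_card)
  qed
  define lift where "lift r y = (if y \<in> E then snd y * r (fst y) / complex_of_real (sqrt (real (e (fst y)))) else 0)"
    for r :: "nat \<Rightarrow> complex" and y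
  have psum_lift: "psum 2 (lift r) = (\<Sum>x\<in>fst ` E. cmod (r x) powr 2)" for r
  proof -
    have "psum 2 (lift r) = (\<Sum>y\<in>E. cmod (lift r y) powr 2)"
      by (rule psum_finite[OF \<open>finite E\<close>]) (auto simp: lift_def)
    also have "\<dots> = (\<Sum>y\<in>E. cmod (r (fst y)) powr 2 / real (e (fst y)))"
      by (rule sum.cong) (auto simp: lift_def norm_mult norm_divide E_unit power_divide)
    also have "\<dots> = (\<Sum>x\<in>fst ` E. \<Sum>y\<in>{y\<in>E. fst y = x}. cmod (r (fst y)) powr 2 / real (e (fst y)))"
      by (rule sum.group[symmetric]) (use \<open>finite E\<close> in auto)
    also have "\<dots> = (\<Sum>x\<in>fst ` E. cmod (r x) powr 2)"
    proof (rule sum.cong[OF refl])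
      fix x assume x: "x \<in> fst ` E"
      have "{y\<in>E. fst y = x} = (\<lambda>z. (x, z)) ` {z. (x, z) \<in> E}"
        by force
      then have "card {y\<in>E. fst y = x} = e x"
        unfolding e_def by (simp add: card_image inj_on_def)
      moreover have "e x \<noteq> 0"
      proof -
        obtain z where "(x, z) \<in> E"
          using x by auto
        then show ?thesis
          using fin_fibre[of x] by (auto simp: e_def card_eq_0_iff)
      qed
      moreover have "(\<Sum>y\<in>{y\<in>E. fst y = x}. cmod (r (fst y)) powr 2 / real (e (fst y)))
          = (\<Sum>y\<in>{y\<in>E. fst y = x}. cmod (r x) powr 2 / real (e x))"
        by (rule sum.cong) auto
      ultimately show "(\<Sum>y\<in>{y\<in>E. fst y = x}. cmod (r (fst y)) powr 2 / real (e (fst y))) = cmod (r x) powr 2"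
        by simp
    qed
    finally show ?thesis .
  qed
  define F where "F = lift (\<lambda>x. f x - w x)"
  have norm: "psum 2 F = psum 2 (\<lambda>x. f x - w x)"
    unfolding F_def psum_lift
    by (rule psum_finite[symmetric]) (use \<open>finite E\<close> f_E w_E in force)+
  have diff: "psum 2 (\<lambda>y. F (tau g y) - F y) \<le> psum 2 (\<lambda>x. act g f x - f x)" for g
  proof -
    have "F (tau g y) - F y = lift (\<lambda>x. act g f x - f x) y" for y
    proof -
      obtain x z where y: "y = (x, z)"
        by (cases y)
      have "c g x * w (sg g x) = w x"
        using fun_cong[OF w_inv[of g], of x] by (simp add: act_def)
      then have "c g x * z * (f (sg g x) - w (sg g x)) = z * (act g f x - w x)"
        by (simp add: act_def algebra_simps)
      then have k: "c g x * z * (f (sg g x) - w (sg g x)) - z * (f x - w x) = z * (act g f x - f x)"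
        by (simp only: right_diff_distrib[of z]) simp
      show ?thesis
        using E_tau[of g y]
        by (simp add: F_def lift_def y e_sg k flip: diff_divide_distrib)
    qed
    then have "psum 2 (\<lambda>y. F (tau g y) - F y) = (\<Sum>x\<in>fst ` E. cmod (act g f x - f x) powr 2)"
      by (simp only: psum_lift)
    also have "\<dots> \<le> psum 2 (\<lambda>x. act g f x - f x)"
    proof -
      have "psummable 2 f"
        using f(1) by (rule psummable_finite) auto
      then have "psummable 2 (\<lambda>x. act g f x - f x)"
        by (intro psummable_diff) auto
      then show ?thesis
        unfolding psum_def psummable_def using \<open>finite E\<close> by (intro finite_sum_le_infsum) auto
    qed
    finally show ?thesis .
  qed
  have "Y.balanced F"
    unfolding Y.balanced_def
  proof (intro conjI allI impI)
    show "finite {y. F y \<noteq> 0}"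
      by (rule finite_subset[OF _ \<open>finite E\<close>]) (auto simp: F_def lift_def)
    fix y assume fin: "finite (Y.orb y)"
    show "(\<Sum>z\<in>Y.orb y. F z) = 0"
    proof (cases "y \<in> E")
      case True
      have inE: "z \<in> E" if "z \<in> Y.orb y" for z
        using that True by (auto simp: Y.orb_def E_tau simp del: tau_pair)
      have efst: "e (fst z) = e (fst y)" if "z \<in> Y.orb y" for z
        using that e_sg by (auto simp: Y.orb_def tau_def)
      have "(\<Sum>z\<in>Y.orb y. F1 z - Y.orb_mean F1 z) = 0"
      proof -
        have "(\<Sum>z\<in>Y.orb y. Y.orb_mean F1 z) = (\<Sum>z\<in>Y.orb y. Y.orb_mean F1 y)"
          by (rule sum.cong) (auto intro: Y.invariant_on_orb simp del: tau_pair)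
        also have "\<dots> = (\<Sum>z\<in>Y.orb y. F1 z)"
          using fin Y.orb_self[of y] by (auto simp: Y.orb_mean_def card_eq_0_iff simp del: Y.orb_self)
        finally show ?thesis
          by (simp add: sum_subtractf)
      qed
      moreover have "F z = (F1 z - Y.orb_mean F1 z) / complex_of_real (sqrt (real (e (fst y))))"
        if "z \<in> Y.orb y" for z
      proof -
        have "snd z \<noteq> 0"
          using E_unit[OF inE[OF that]] by force
        then have "Y.orb_mean F1 z = snd z * w (fst z)"
          using mean[of "snd z" "fst z"] by simp
        then show ?thesis
          using inE[OF that] efst[OF that] by (simp add: F_def lift_def F1_def right_diff_distrib)
      qed
      ultimately show ?thesis
        by (simp flip: sum_divide_distrib)
    next
      case False
      then have "z \<notin> E" if "z \<in> Y.orb y" for z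
        using that by (auto simp: Y.orb_def E_tau simp del: tau_pair)
      then show ?thesis
        by (simp add: F_def lift_def)
    qed
  qed
  have "\<epsilon> * psum 2 F \<le> \<delta>"
  proof (rule ccontr)
    assume big: "\<not> \<epsilon> * psum 2 F \<le> \<delta>"
    have "psum 2 (\<lambda>y. F (tau g y) - F y) \<le> \<epsilon> * psum 2 F" if "g \<in> K" for g
      using diff[of g] inv[OF that] big by linarith
    then have "psum 2 F = 0"
      by (rule Y.quasi_reg_gap_balanced[OF gap \<open>Y.balanced F\<close>])
    then show False
      using big \<open>\<delta> \<ge> 0\<close> by simp
  qed
  then show thesis
    using that[OF fin_w w_inv] norm by simp
qed

end

section \<open>Rigidity of almost invariant vectors in l_4\<close>

lemma young_4:
  fixes a b :: real
  assumes "a \<ge> 0" "b \<ge> 0"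
  shows "a * b ^ 3 \<le> a ^ 4 / 4 + 3 / 4 * b ^ 4"
proof -
  have "0 \<le> (a - b)\<^sup>2 * (a\<^sup>2 + 2 * a * b + 3 * b\<^sup>2)"
    using assms by simp
  also have "\<dots> = a ^ 4 + 3 * b ^ 4 - 4 * (a * b ^ 3)"
    by (simp add: power2_eq_square power3_eq_cube power4_eq_xxxx algebra_simps)
  finally show ?thesis
    by simp
qed

context monomial_system
begin

text \<open>The vector \<open>\<bar>v\<bar>\<^sup>2 v\<^sup>*\<close> is dual invariant and norms \<open>v\<close>; testing against it shows that
  \<open>lp_prime\<close> keeps its distance from the invariant vectors.\<close>

lemma lp_prime_far_from_invariant:
  assumes rep: "\<And>g f. f \<in> lp_space 4 \<Longrightarrow> \<pi> g f = act g f"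
    and F: "F \<in> lp_prime 4 \<pi>" and v: "finite {x. v x \<noteq> 0}" "\<And>g. act g v = v"
  shows "psum 4 v \<le> psum 4 (\<lambda>x. v x - F x)"
proof -
  define S where "S = {x. v x \<noteq> 0}"
  define \<psi> where "\<psi> x = of_real ((cmod (v x))\<^sup>2) * cnj (v x)" for x
  have S: "finite S" "\<And>x. x \<notin> S \<Longrightarrow> v x = 0" "\<And>x. x \<notin> S \<Longrightarrow> \<psi> x = 0"
    using v by (auto simp: S_def \<psi>_def)
  have v_sg: "v (sg g x) = cnj (c g x) * v x" for g x
  proof -
    have "cnj (c g x) * v x = (cnj (c g x) * c g x) * v (sg g x)"
      using fun_cong[OF v(2)[of g], of x] by (simp add: act_def mult.assoc)
    also have "cnj (c g x) * c g x = 1"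
      using complex_norm_square[of "c g x"] by (simp add: mult.commute)
    finally show ?thesis
      by simp
  qed
  have \<psi>_sg: "\<psi> (sg g x) = c g x * \<psi> x" for g x
    by (simp add: \<psi>_def v_sg norm_mult)
  have S_sg: "sg g x \<in> S \<longleftrightarrow> x \<in> S" for g x
    by (simp add: S_def v_sg)
  have "dual_invariant 4 \<pi> \<psi>"
    unfolding dual_invariant_def
  proof (intro conjI allI ballI)
    show "\<psi> \<in> lp_space (conj_exp 4)"
      unfolding lp_space_iff by (rule psummable_finite[OF S(1) S(3)])
    fix g f assume f: "f \<in> lp_space 4"
    have "lp_pair (\<pi> (- g) f) \<psi> = (\<Sum>x\<in>S. act (- g) f x * \<psi> x)"
      unfolding rep[OF f] by (rule lp_pair_finite) (use S in auto)
    also have "\<dots> = (\<Sum>x\<in>S. f (sg (- g) x) * \<psi> (sg (- g) x))"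
      by (simp add: act_def \<psi>_sg mult_ac)
    also have "\<dots> = (\<Sum>x\<in>S. f x * \<psi> x)"
    proof (rule sum.reindex_bij_betw)
      show "bij_betw (sg (- g)) S S"
        by (rule bij_betwI[where g="sg g"]) (auto simp: S_sg)
    qed
    also have "\<dots> = lp_pair f \<psi>"
      by (rule lp_pair_finite[symmetric]) (use S in auto)
    finally show "lp_pair (\<pi> (- g) f) \<psi> = lp_pair f \<psi>" .
  qed
  then have "lp_pair F \<psi> = 0"
    using F by (simp add: lp_prime_def)
  then have zero: "(\<Sum>x\<in>S. F x * \<psi> x) = 0"
    using lp_pair_finite[of S F \<psi>] S by simp
  have "psummable 4 F"
    using F by (simp add: lp_prime_def lp_space_iff)
  then have sF: "psummable 4 (\<lambda>x. v x - F x)"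
    by (intro psummable_diff psummable_finite[OF S(1) S(2)]) auto
  have v4: "psum 4 v = (\<Sum>x\<in>S. cmod (v x) ^ 4)"
    by (subst psum_finite[OF S(1) S(2)]) auto
  have v\<psi>: "v x * \<psi> x = of_real (cmod (v x) ^ 4)" for x
  proof -
    have "v x * \<psi> x = of_real ((cmod (v x))\<^sup>2) * (v x * cnj (v x))"
      by (simp add: \<psi>_def)
    also have "\<dots> = of_real ((cmod (v x))\<^sup>2 * (cmod (v x))\<^sup>2)"
      by (simp only: complex_norm_square of_real_mult)
    finally show ?thesis
      by (simp flip: power_add)
  qed
  have "complex_of_real (psum 4 v) = (\<Sum>x\<in>S. v x * \<psi> x) - (\<Sum>x\<in>S. F x * \<psi> x)"
    unfolding zero v4 v\<psi> by simp
  also have "\<dots> = (\<Sum>x\<in>S. (v x - F x) * \<psi> x)"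
    by (simp add: sum_subtractf left_diff_distrib)
  finally have "psum 4 v = cmod (\<Sum>x\<in>S. (v x - F x) * \<psi> x)"
    by (metis abs_of_nonneg norm_of_real psum_nonneg)
  \<comment> \<open>Young's inequality for the exponents 4 and 4/3; the term with three quarters of
    the mass of \<open>v\<close> is absorbed on the left.\<close>
  also have "\<dots> \<le> (\<Sum>x\<in>S. cmod (v x - F x) ^ 4 / 4 + 3 / 4 * cmod (v x) ^ 4)"
  proof (rule sum_norm_le)
    fix x
    have "cmod ((v x - F x) * \<psi> x) = cmod (v x - F x) * cmod (v x) ^ 3"
      by (simp add: \<psi>_def norm_mult power2_eq_square power3_eq_cube)
    then show "cmod ((v x - F x) * \<psi> x) \<le> cmod (v x - F x) ^ 4 / 4 + 3 / 4 * cmod (v x) ^ 4"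
      using young_4[of "cmod (v x - F x)" "cmod (v x)"] by simp
  qed
  also have "\<dots> = (\<Sum>x\<in>S. cmod (v x - F x) powr 4) / 4 + 3 / 4 * psum 4 v"
    by (simp add: v4 sum.distrib sum_divide_distrib sum_distrib_left)
  also have "(\<Sum>x\<in>S. cmod (v x - F x) powr 4) \<le> psum 4 (\<lambda>x. v x - F x)"
    unfolding psum_def using sF S by (intro finite_sum_le_infsum) (auto simp: psummable_def)
  finally show ?thesis
    by simp
qed

text \<open>The two orbit bounds require finite support, so a small tail is cut off first. The rest
  splits according to whether the twisted orbit is finite; this property is constant along
  \<open>sg\<close>-orbits, so restricting to either part does not increase displacements.\<close>

lemma near_invariant_if_almost_invariant:
  assumes gap: "quasi_reg_gap K \<epsilon>" "\<epsilon> > 0" "compact K"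
    and f: "psummable 2 f" and "\<delta> > 0"
    and inv: "\<And>g. g \<in> K \<Longrightarrow> psum 2 (\<lambda>x. act g f x - f x) \<le> \<delta>"
  obtains w where "finite {x. w x \<noteq> 0}" "\<And>g. act g w = w"
    "psum 2 (\<lambda>x. f x - w x) \<le> (16 + 4752 / \<epsilon>) * \<delta>"
proof -
  obtain A where A: "finite A" "psum 2 (\<lambda>x. if x \<in> A then 0 else f x) < \<delta>"
    using psum_tail[OF f \<open>\<delta> > 0\<close>] .
  define t where "t x = (if x \<in> A then 0 else f x)" for x
  define f' where "f' x = (if x \<in> A then f x else 0)" for x
  have t: "psummable 2 t" "psum 2 t \<le> \<delta>"
    using A f by (auto simp: t_def[abs_def] intro: psummable_mono[OF f])
  \<comment> \<open>The tail, of mass at most \<open>\<delta>\<close>, has displacement at most 8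
    times \<open>\<delta>\<close>; the quasi-triangle inequality then gives 36 = 4 * (1 +
    8).\<close>
  have inv': "psum 2 (\<lambda>x. act g f' x - f' x) \<le> 36 * \<delta>" if "g \<in> K" for g
  proof -
    have e: "(\<lambda>x. act g f' x - f' x) = (\<lambda>x. (act g f x - f x) - (act g t x - t x))"
      by (auto simp: fun_eq_iff act_def f'_def t_def)
    have "psum 2 (\<lambda>x. act g t x - t x) \<le> 4 * (psum 2 t + psum 2 t)"
      using psum_diff_le[of 2 "act g t" t] t by simp
    moreover have "psum 2 (\<lambda>x. (act g f x - f x) - (act g t x - t x))
        \<le> 4 * (psum 2 (\<lambda>x. act g f x - f x) + psum 2 (\<lambda>x. act g t x - t x))"
      using psum_diff_le[of 2 "\<lambda>x. act g f x - f x" "\<lambda>x. act g t x - t x"] t f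
      by (simp add: psummable_diff)
    ultimately show ?thesis
      unfolding e using inv[OF that] t by simp
  qed
  define fA where "fA x = (if finite (Y.orb (x, 1)) then 0 else f' x)" for x
  define fB where "fB x = (if finite (Y.orb (x, 1)) then f' x else 0)" for x
  have fin: "finite {x. f' x \<noteq> 0}" "finite {x. fA x \<noteq> 0}" "finite {x. fB x \<noteq> 0}"
    by (rule finite_subset[OF _ A(1)]; auto simp: f'_def fA_def fB_def)+
  have s: "psummable 2 f'" "psummable 2 fA" "psummable 2 fB"
    using fin by (auto intro: psummable_finite)
  have s': "psummable 2 (\<lambda>x. act g f' x - f' x)" for g
    using s by (intro psummable_diff) auto
  have lA: "psum 2 (\<lambda>x. act g fA x - fA x) \<le> psum 2 (\<lambda>x. act g f' x - f' x)" for g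
    by (rule psum_mono[OF s']) (use s in \<open>auto simp: act_def[of _ fA] act_def[of _ f'] fA_def finite_orb_sg\<close>)
  have A_le: "\<epsilon> * psum 2 fA \<le> 8 * (36 * \<delta>)"
  proof (rule infinite_orbit_bound[OF gap fin(2)])
    show "infinite (Y.orb (x, 1))" if "fA x \<noteq> 0" for x
      using that by (auto simp: fA_def)
    show "psum 2 (\<lambda>x. act g fA x - fA x) \<le> 36 * \<delta>" if "g \<in> K" for g
      using lA inv'[OF that] by (rule order_trans)
  qed (use \<open>\<delta> > 0\<close> in simp)
  have lB: "psum 2 (\<lambda>x. act g fB x - fB x) \<le> psum 2 (\<lambda>x. act g f' x - f' x)" for g
    by (rule psum_mono[OF s']) (use s in \<open>auto simp: act_def[of _ fB] act_def[of _ f'] fB_def finite_orb_sg\<close>)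
  obtain w where w: "finite {x. w x \<noteq> 0}" "\<And>g. act g w = w"
      "\<epsilon> * psum 2 (\<lambda>x. fB x - w x) \<le> 36 * \<delta>"
  proof (rule finite_orbit_bound[OF gap(1) fin(3)])
    show "finite (Y.orb (x, 1))" if "fB x \<noteq> 0" for x
      using that by (auto simp: fB_def split: if_splits)
    show "psum 2 (\<lambda>x. act g fB x - fB x) \<le> 36 * \<delta>" if "g \<in> K" for g
      using lB inv'[OF that] by (rule order_trans)
  qed (use \<open>\<delta> > 0\<close> in auto)
  have sw: "psummable 2 w"
    using w by (auto intro: psummable_finite)
  have "(\<lambda>x. f x - w x) = (\<lambda>x. (t x + fA x) + (fB x - w x))"
    by (auto simp: fun_eq_iff t_def fA_def fB_def f'_def)
  then have "psum 2 (\<lambda>x. f x - w x) \<le> 4 * (psum 2 (\<lambda>x. t x + fA x) + psum 2 (\<lambda>x. fB x - w x))"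
    using psum_add_le[of 2 "\<lambda>x. t x + fA x" "\<lambda>x. fB x - w x"] s t sw
    by (simp add: psummable_add psummable_diff)
  also have "\<dots> \<le> 4 * (4 * (\<delta> + 288 * \<delta> / \<epsilon>) + 36 * \<delta> / \<epsilon>)"
  proof -
    have b: "psum 2 fA \<le> 288 * \<delta> / \<epsilon>" "psum 2 (\<lambda>x. fB x - w x) \<le> 36 * \<delta> / \<epsilon>"
      using A_le w(3) \<open>\<epsilon> > 0\<close> by (simp_all add: pos_le_divide_eq mult.commute)
    have "psum 2 (\<lambda>x. t x + fA x) \<le> 4 * (psum 2 t + psum 2 fA)"
      using psum_add_le[of 2 t fA] s t by simp
    also have "\<dots> \<le> 4 * (\<delta> + 288 * \<delta> / \<epsilon>)"
      by (intro mult_left_mono add_mono t b) simp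
    finally show ?thesis
      by (intro mult_left_mono add_mono b) simp_all
  qed
  \<comment> \<open>4752 = 16 * 288 + 4 * 36, where 288 = 8 * 36 comes from the infinite orbits and
    36 from the finite ones.\<close>
  also have "\<dots> = (16 + 4752 / \<epsilon>) * \<delta>"
    using \<open>\<epsilon> > 0\<close> by (simp add: field_simps)
  finally show thesis
    using that w by blast
qed

text \<open>The Mazur map takes \<open>F\<close> to l_2, where an invariant vector lies nearby, and
  its inverse brings that vector back to an invariant \<open>v\<close> within mass 1/64 of
  \<open>F\<close>. As \<open>F\<close> annihilates dual invariants, \<open>v\<close> is itself no
  larger than 1/64, so the mass of \<open>F\<close> would be at most 16 * (1/64 + 1/64) < 1.\<close>

lemma lp_prime_rigidity:
  assumes gap: "quasi_reg_gap K \<epsilon>" "\<epsilon> > 0" "compact K"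
    and rep: "\<And>g f. f \<in> lp_space 4 \<Longrightarrow> \<pi> g f = act g f"
  obtains \<eta> where "\<eta> > 0" "\<And>F. F \<in> lp_prime 4 \<pi> \<Longrightarrow> psum 4 F = 1 \<Longrightarrow>
    \<exists>g\<in>K. psum 4 (\<lambda>x. act g F x - F x) > \<eta>"
proof -
  \<comment> \<open>The masses of \<open>f\<close> and \<open>w\<close> will be at most 1 and 8, so
    1/1152 contributes 1/128; the choice of \<open>\<theta>\<close> contributes another
    1/128.\<close>
  obtain C' where C': "C' > 0" "\<forall>a b. cmod (mazur (2 / 4) a - mazur (2 / 4) b) powr 4
      \<le> 1 / 1152 * (cmod a powr 2 + cmod b powr 2) + C' * cmod (a - b) powr 2"
    using mazur_diff_bound[of 2 4 "1 / 1152"] by auto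
  define \<theta> where "\<theta> = min 1 (1 / (128 * C'))"
  define C0 where "C0 = 16 + 4752 / \<epsilon>"
  define \<delta> where "\<delta> = \<theta> / C0"
  have "C0 > 0" "\<theta> > 0"
    using \<open>\<epsilon> > 0\<close> \<open>C' > 0\<close> by (auto simp: C0_def \<theta>_def intro: add_pos_pos)
  then have "\<delta> > 0"
    by (simp add: \<delta>_def)
  obtain C where C: "C > 0" "\<forall>a b. cmod (mazur (4 / 2) a - mazur (4 / 2) b) powr 2
      \<le> \<delta> / 4 * (cmod a powr 4 + cmod b powr 4) + C * cmod (a - b) powr 4"
    using mazur_diff_bound[of 4 2 "\<delta> / 4"] \<open>\<delta> > 0\<close> by auto
  define \<eta> where "\<eta> = \<delta> / (2 * C)"
  have "\<eta> > 0"
    using \<open>\<delta> > 0\<close> \<open>C > 0\<close> by (simp add: \<eta>_def)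
  moreover have "\<exists>g\<in>K. psum 4 (\<lambda>x. act g F x - F x) > \<eta>"
    if F: "F \<in> lp_prime 4 \<pi>" "psum 4 F = 1" for F
  proof (rule ccontr)
    assume "\<not> ?thesis"
    then have inv: "psum 4 (\<lambda>x. act g F x - F x) \<le> \<eta>" if "g \<in> K" for g
      using that by force
    have sF: "psummable 4 F"
      using F by (simp add: lp_prime_def lp_space_iff)
    define f where "f x = mazur (4 / 2) (F x)" for x
    have f: "psummable 2 f" "psum 2 f = 1"
      using sF F psummable_mazur[of 2 4 F] psum_mazur[of 2 4 F] by (simp_all add: f_def[abs_def])
    have "psum 2 (\<lambda>x. act g f x - f x) \<le> \<delta>" if "g \<in> K" for g
    proof -
      have "psum 2 (\<lambda>x. act g f x - f x) \<le> \<delta> / 4 * (psum 4 (act g F) + psum 4 F) + C * psum 4 (\<lambda>x. act g F x - F x)"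
        unfolding f_def act_mazur by (rule psum_mazur_diff_le[OF C(2)]) (use sF in auto)
      also have "\<dots> \<le> \<delta> / 4 * 2 + C * \<eta>"
        using inv[OF that] F \<open>C > 0\<close> by simp
      also have "\<dots> = \<delta>"
        using \<open>C > 0\<close> by (simp add: \<eta>_def)
      finally show ?thesis .
    qed
    then obtain w where w: "finite {x. w x \<noteq> 0}" "\<And>g. act g w = w"
      "psum 2 (\<lambda>x. f x - w x) \<le> C0 * \<delta>"
      using near_invariant_if_almost_invariant[OF gap f(1) \<open>\<delta> > 0\<close>] unfolding C0_def by blast
    have sw: "psummable 2 w"
      using w by (auto intro: psummable_finite)
    have fw: "psum 2 (\<lambda>x. f x - w x) \<le> \<theta>"
      using w(3) \<open>C0 > 0\<close> by (simp add: \<delta>_def)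
    have "psum 2 w \<le> 4 * (psum 2 f + psum 2 (\<lambda>x. f x - w x))"
      using psum_diff_le[of 2 f "\<lambda>x. f x - w x"] f sw by (simp add: psummable_diff)
    then have w8: "psum 2 w \<le> 8"
      using fw f by (simp add: \<theta>_def)
    define v where "v x = mazur (2 / 4) (w x)" for x
    have v: "finite {x. v x \<noteq> 0}" "\<And>g. act g v = v"
    proof -
      show "finite {x. v x \<noteq> 0}"
        by (rule finite_subset[OF _ w(1)]) (auto simp: v_def)
      show "act g v = v" for g
        unfolding v_def act_mazur w(2) ..
    qed
    have F_eq: "F x = mazur (2 / 4) (f x)" for x
      using mazur_inverse[of 2 "F x"] by (simp add: f_def)
    have "psum 4 (\<lambda>x. F x - v x) \<le> 1 / 1152 * (psum 2 f + psum 2 w) + C' * psum 2 (\<lambda>x. f x - w x)"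
      unfolding F_eq v_def by (rule psum_mazur_diff_le[OF C'(2)]) (use f sw in auto)
    also have "\<dots> \<le> 1 / 1152 * (1 + 8) + C' * (1 / (128 * C'))"
      using f w8 fw \<open>C' > 0\<close> by (intro add_mono mult_left_mono) (auto simp: \<theta>_def)
    also have "\<dots> = 1 / 64"
      using \<open>C' > 0\<close> by simp
    finally have Fv: "psum 4 (\<lambda>x. F x - v x) \<le> 1 / 64" .
    have sv: "psummable 4 v"
      using v by (auto intro: psummable_finite)
    have "psum 4 v \<le> psum 4 (\<lambda>x. F x - v x)"
      using lp_prime_far_from_invariant[OF rep F(1) v] by (simp add: psum_diff_commute[of 4 v F])
    moreover have "psum 4 F \<le> 16 * (psum 4 (\<lambda>x. F x - v x) + psum 4 v)"
      using psum_add_le[of 4 "\<lambda>x. F x - v x" v] sF sv by (simp add: psummable_diff)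
    ultimately show False
      using Fv F by simp
  qed
  ultimately show thesis
    using that by blast
qed

end

section \<open>Isometries of \<open>l_4\<close>\<close>

lemma parallelogram_4:
  fixes a b :: complex
  shows "cmod (a + b) ^ 4 + cmod (a - b) ^ 4
       = 2 * (cmod a ^ 4 + cmod b ^ 4) + (4 * ((cmod a)\<^sup>2 * (cmod b)\<^sup>2) + 8 * (Re (a * cnj b))\<^sup>2)"
proof -
  have p: "(cmod (a + b))\<^sup>2 = (cmod a)\<^sup>2 + (cmod b)\<^sup>2 + 2 * Re (a * cnj b)"
    "(cmod (a - b))\<^sup>2 = (cmod a)\<^sup>2 + (cmod b)\<^sup>2 - 2 * Re (a * cnj b)"
    unfolding cmod_power2 by (simp_all add: power2_eq_square algebra_simps)
  have "cmod x ^ 4 = ((cmod x)\<^sup>2)\<^sup>2" for x :: complex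
    by simp
  then show ?thesis
    unfolding p by (simp only: p) (simp add: power2_eq_square algebra_simps)
qed

text \<open>Lamperti's argument: for \<open>p = 4\<close> the deviation from the parallelogram identity detects
  disjointness of supports, so isometries preserve it.\<close>

lemma disjoint_iff_psum_4:
  assumes "psummable 4 f" "psummable 4 h"
  shows "(\<forall>x. f x * h x = 0) \<longleftrightarrow>
    psum 4 (\<lambda>x. f x + h x) + psum 4 (\<lambda>x. f x - h x) = 2 * (psum 4 f + psum 4 h)"
proof -
  define D where "D x = 4 * ((cmod (f x))\<^sup>2 * (cmod (h x))\<^sup>2) + 8 * (Re (f x * cnj (h x)))\<^sup>2" for x
  have hs: "((\<lambda>x. cmod (k x) ^ 4) has_sum psum 4 k) UNIV" if "psummable 4 k" for k :: "'a \<Rightarrow> complex"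
    using that has_sum_infsum[of "\<lambda>x. cmod (k x) ^ 4" UNIV] by (simp add: psummable_def psum_def)
  have "((\<lambda>x. (cmod (f x + h x) ^ 4 + cmod (f x - h x) ^ 4) - 2 * (cmod (f x) ^ 4 + cmod (h x) ^ 4)) has_sum
      (psum 4 (\<lambda>x. f x + h x) + psum 4 (\<lambda>x. f x - h x) - 2 * (psum 4 f + psum 4 h))) UNIV"
    by (intro has_sum_minus has_sum_add has_sum_cmult_right hs psummable_add psummable_diff assms) simp_all
  then have D: "(D has_sum (psum 4 (\<lambda>x. f x + h x) + psum 4 (\<lambda>x. f x - h x) - 2 * (psum 4 f + psum 4 h))) UNIV"
    unfolding parallelogram_4 D_def[abs_def] by simp
  have D0: "D x \<ge> 0" for x
    by (simp add: D_def)
  show ?thesis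
  proof
    assume "\<forall>x. f x * h x = 0"
    then have "D x = 0" for x
      by (cases "f x = 0") (auto simp: D_def)
    then have "(D has_sum 0) UNIV"
      by (simp add: has_sum_0)
    with D have "psum 4 (\<lambda>x. f x + h x) + psum 4 (\<lambda>x. f x - h x) - 2 * (psum 4 f + psum 4 h) = 0"
      by (rule has_sum_unique)
    then show "psum 4 (\<lambda>x. f x + h x) + psum 4 (\<lambda>x. f x - h x) = 2 * (psum 4 f + psum 4 h)"
      by simp
  next
    assume "psum 4 (\<lambda>x. f x + h x) + psum 4 (\<lambda>x. f x - h x) = 2 * (psum 4 f + psum 4 h)"
    then have "(D has_sum 0) UNIV"
      using D by simp
    then have "D x = 0" for x
      using nonneg_has_sum_le_0D[of D UNIV 0 x] D0 by simp
    moreover have "D x \<ge> 4 * ((cmod (f x))\<^sup>2 * (cmod (h x))\<^sup>2)" for x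
      by (simp add: D_def)
    ultimately have "(cmod (f x))\<^sup>2 * (cmod (h x))\<^sup>2 \<le> 0" for x
      by (metis mult_le_cancel_left_pos mult_zero_right zero_less_numeral)
    then have "(cmod (f x * h x))\<^sup>2 \<le> 0" for x
      by (simp add: norm_mult power_mult_distrib)
    then show "\<forall>x. f x * h x = 0"
      by simp
  qed
qed

definition basis_vec :: "nat \<Rightarrow> nat \<Rightarrow> complex" where
  "basis_vec k n = (if n = k then 1 else 0)"

lemma psummable_basis_vec: "psummable p (basis_vec k)"
  by (rule psummable_finite[of "{k}"]) (auto simp: basis_vec_def)

lemma psum_basis_vec: "psum p (basis_vec k) = 1"
  by (subst psum_finite[of "{k}"]) (auto simp: basis_vec_def)

text \<open>By surjectivity some \<open>f\<close> is sent to the n-th basis vector; let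
  \<open>f k\<close> be nonzero. The images of the k-th basis vector and of the rest of
  \<open>f\<close> are disjoint and combine to something supported at \<open>n\<close>, so the first
  is a multiple of the n-th basis vector. For any other input, the part away from \<open>k\<close>
  must then have an image vanishing at \<open>n\<close>.\<close>

lemma lp_isometry_4_monomial:
  assumes "lp_isometry 4 T"
  shows "\<exists>s a. (\<forall>n. cmod (a n) = 1) \<and> (\<forall>f n. psummable 4 f \<longrightarrow> T f n = a n * f (s n))"
proof -
  have bij: "bij_betw T (lp_space 4) (lp_space 4)"
    and lin: "\<And>f h a b. psummable 4 f \<Longrightarrow> psummable 4 h \<Longrightarrow>
        T (\<lambda>n. a * f n + b * h n) = (\<lambda>n. a * T f n + b * T h n)"
    and iso: "\<And>f. psummable 4 f \<Longrightarrow> lp_norm 4 (T f) = lp_norm 4 f"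
    using assms unfolding lp_isometry_def lp_space_iff[symmetric] by auto
  have T_in: "psummable 4 (T f)" if "psummable 4 f" for f
    using bij_betw_apply[OF bij, of f] that by (simp add: lp_space_iff)
  have T_psum: "psum 4 (T f) = psum 4 f" if "psummable 4 f" for f
    using lp_norm_powr[OF that] lp_norm_powr[OF T_in[OF that]] iso[OF that] by simp
  have disj: "(\<forall>x. T f x * T h x = 0) \<longleftrightarrow> (\<forall>x. f x * h x = 0)" if fh: "psummable 4 f" "psummable 4 h" for f h
  proof -
    have "T (\<lambda>n. f n + h n) = (\<lambda>n. T f n + T h n)" "T (\<lambda>n. f n - h n) = (\<lambda>n. T f n - T h n)"
      using lin[OF fh, of 1 1] lin[OF fh, of 1 "- 1"] by simp_all
    then show ?thesis
      unfolding disjoint_iff_psum_4[OF fh] disjoint_iff_psum_4[OF T_in[OF fh(1)] T_in[OF fh(2)]]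
      using T_psum[OF psummable_add[OF fh]] T_psum[OF psummable_diff[OF fh]] T_psum[OF fh(1)] T_psum[OF fh(2)]
      by simp
  qed
  have split: "T f n = f k * T (basis_vec k) n + T (\<lambda>n. if n = k then 0 else f n) n"
    "\<forall>x. T (basis_vec k) x * T (\<lambda>n. if n = k then 0 else f n) x = 0" if f: "psummable 4 f" for f k n
  proof -
    have r: "psummable 4 (\<lambda>n. if n = k then 0 else f n)"
      by (rule psummable_mono[OF f]) auto
    have "f = (\<lambda>n. f k * basis_vec k n + 1 * (if n = k then 0 else f n))"
      by (auto simp: fun_eq_iff basis_vec_def)
    then show "T f n = f k * T (basis_vec k) n + T (\<lambda>n. if n = k then 0 else f n) n"
      using lin[OF psummable_basis_vec[of 4 k] r, of "f k" 1] by simp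
    show "\<forall>x. T (basis_vec k) x * T (\<lambda>n. if n = k then 0 else f n) x = 0"
      using disj[OF psummable_basis_vec[of 4 k] r] by (auto simp: basis_vec_def)
  qed
  have "\<exists>k b. cmod b = 1 \<and> (\<forall>f. psummable 4 f \<longrightarrow> T f n = b * f k)" for n
  proof -
    have "basis_vec n \<in> T ` lp_space 4"
      using bij psummable_basis_vec[of 4 n] by (simp add: bij_betw_def lp_space_iff)
    then obtain f where f: "psummable 4 f" "T f = basis_vec n"
      by (auto simp: lp_space_iff)
    have "f \<noteq> (\<lambda>_. 0)"
    proof
      assume "f = (\<lambda>_. 0)"
      then have "psum 4 f = 0"
        by (simp add: psum_def)
      then show False
        using T_psum[OF f(1)] f(2) psum_basis_vec[of 4 n] by simp
    qed
    then obtain k where k: "f k \<noteq> 0"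
      by auto
    have Tk: "T (basis_vec k) m = 0" if "m \<noteq> n" for m
    proof -
      have "f k * T (basis_vec k) m + T (\<lambda>n. if n = k then 0 else f n) m = 0"
        using split(1)[OF f(1), of m k] f(2) that by (simp add: basis_vec_def)
      moreover have "T (basis_vec k) m * T (\<lambda>n. if n = k then 0 else f n) m = 0"
        using split(2)[OF f(1)] by blast
      ultimately show ?thesis
        using k by auto
    qed
    define b where "b = T (basis_vec k) n"
    have "psum 4 (T (basis_vec k)) = cmod b ^ 4"
      by (subst psum_finite[of "{n}"]) (use Tk in \<open>auto simp: b_def\<close>)
    then have "cmod b ^ 4 = 1"
      using T_psum[OF psummable_basis_vec[of 4 k]] psum_basis_vec[of 4 k] by simp
    then have b: "cmod b = 1"
      using power_eq_iff_eq_base[of 4 "cmod b" 1] by simp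
    have "T h n = b * h k" if "psummable 4 h" for h
    proof -
      have "b * T (\<lambda>n. if n = k then 0 else h n) n = 0"
        using split(2)[OF that, of k] by (simp add: b_def)
      moreover have "b \<noteq> 0"
        using b by auto
      ultimately show ?thesis
        using split(1)[OF that, of n k] by (simp add: b_def)
    qed
    then show ?thesis
      using b by blast
  qed
  then have "\<forall>n. \<exists>k b. cmod b = 1 \<and> (\<forall>f. psummable 4 f \<longrightarrow> T f n = b * f k)"
    by blast
  from choice[OF this] obtain s where
    "\<forall>n. \<exists>b. cmod b = 1 \<and> (\<forall>f. psummable 4 f \<longrightarrow> T f n = b * f (s n))"
    by blast
  from choice[OF this] obtain a where
    "\<forall>n. cmod (a n) = 1 \<and> (\<forall>f. psummable 4 f \<longrightarrow> T f n = a n * f (s n))"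
    by blast
  then show ?thesis
    by blast
qed

lemma orth_rep_lp_psummable:
  assumes "orth_rep_lp p \<pi>" "psummable p f"
  shows "psummable p (\<pi> g f)"
proof -
  have "bij_betw (\<pi> g) (lp_space p) (lp_space p)"
    using assms(1) by (simp add: orth_rep_lp_def lp_isometry_def)
  then show ?thesis
    using assms(2) bij_betw_apply[of "\<pi> g" "lp_space p" "lp_space p" f] by (simp add: lp_space_iff)
qed

text \<open>Evaluation on basis vectors turns the homomorphism property into the cocycle identities.
  Strong continuity only yields phases close to 1 near the identity; on an open subgroup the phases
  are closed under powers, and smallness forces them to be 1.\<close>

lemma orth_rep_lp_4_monomial:
  fixes \<pi> :: "'g::topological_group_add \<Rightarrow> (nat \<Rightarrow> complex) \<Rightarrow> (nat \<Rightarrow> complex)"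
  assumes lc: "locally_compact_space (euclidean :: 'g topology)"
    and td: "totally_disconnected_group TYPE('g)"
    and rep: "orth_rep_lp 4 \<pi>"
  obtains sg c where "monomial_system sg c"
    "\<And>g f. f \<in> lp_space 4 \<Longrightarrow> \<pi> g f = monomial_system.act sg c g f"
proof -
  have "\<forall>g. \<exists>s a. (\<forall>n. cmod (a n) = 1) \<and> (\<forall>f n. psummable 4 f \<longrightarrow> \<pi> g f n = a n * f (s n))"
    using rep lp_isometry_4_monomial unfolding orth_rep_lp_def by blast
  from choice[OF this] obtain sg where
    "\<forall>g. \<exists>a. (\<forall>n. cmod (a n) = 1) \<and> (\<forall>f n. psummable 4 f \<longrightarrow> \<pi> g f n = a n * f (sg g n))"
    by blast
  from choice[OF this] obtain c where
    "\<forall>g. (\<forall>n. cmod (c g n) = 1) \<and> (\<forall>f n. psummable 4 f \<longrightarrow> \<pi> g f n = c g n * f (sg g n))"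
    by blast
  then have c1: "\<And>g n. cmod (c g n) = 1"
    and \<pi>: "\<And>g f n. psummable 4 f \<Longrightarrow> \<pi> g f n = c g n * f (sg g n)"
    by auto
  have c0: "c g n \<noteq> 0" for g n
    using c1[of g n] by force
  have zero: "sg 0 x = x \<and> c 0 x = 1" for x
  proof -
    have "\<pi> 0 (basis_vec x) = basis_vec x"
      using rep psummable_basis_vec by (simp add: orth_rep_lp_def lp_space_iff)
    then have "c 0 x * basis_vec x (sg 0 x) = 1"
      using \<pi>[OF psummable_basis_vec, of 0 x x] by (simp add: basis_vec_def)
    then show ?thesis
      by (auto simp: basis_vec_def split: if_splits)
  qed
  have add: "sg (g + h) x = sg h (sg g x) \<and> c (g + h) x = c g x * c h (sg g x)" for g h x
  proof -
    define k where "k = sg (g + h) x"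
    have s: "psummable 4 (\<pi> h (basis_vec k))"
      by (rule orth_rep_lp_psummable[OF rep psummable_basis_vec])
    have "\<pi> (g + h) (basis_vec k) x = \<pi> g (\<pi> h (basis_vec k)) x"
      using rep psummable_basis_vec by (simp add: orth_rep_lp_def lp_space_iff)
    then have "c (g + h) x = c g x * (c h (sg g x) * basis_vec k (sg h (sg g x)))"
      unfolding \<pi>[OF s] \<pi>[OF psummable_basis_vec] by (simp add: k_def basis_vec_def)
    then show ?thesis
      using c0[of "g + h" x] by (auto simp: basis_vec_def k_def split: if_splits)
  qed
  have minus: "sg (- g) x = x \<and> c (- g) x = inverse (c g x)" if "sg g x = x" for g x
    using add[of g "- g" x] zero[of x] that c0[of g x] by (auto simp: field_simps)
  have "open {g. sg g x = x \<and> c g x * z = z}" for x z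
  proof -
    have "((\<lambda>g. lp_norm 4 (\<pi> g (basis_vec x) - \<pi> 0 (basis_vec x))) \<longlongrightarrow> 0) (at 0)"
      using rep psummable_basis_vec[of 4 x] unfolding orth_rep_lp_def lp_space_iff[symmetric] by blast
    then have "eventually (\<lambda>g. lp_norm 4 (\<pi> g (basis_vec x) - \<pi> 0 (basis_vec x)) < 1) (at 0)"
      by (rule order_tendstoD) simp
    then obtain N where N: "open N" "0 \<in> N"
      "\<And>g. g \<in> N \<Longrightarrow> g \<noteq> 0 \<Longrightarrow> lp_norm 4 (\<pi> g (basis_vec x) - \<pi> 0 (basis_vec x)) < 1"
      unfolding eventually_at_topological by blast
    \<comment> \<open>If \<open>sg g x\<close> differed from \<open>x\<close>, the coordinate at
      \<open>x\<close> of the difference would be -1.\<close>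
    have near: "sg g x = x \<and> cmod (c g x - 1) < 1" if "g \<in> N" for g
    proof (cases "g = 0")
      case False
      let ?d = "\<lambda>n. \<pi> g (basis_vec x) n - \<pi> 0 (basis_vec x) n"
      have s: "psummable 4 (\<pi> h (basis_vec x))" for h
        by (rule orth_rep_lp_psummable[OF rep psummable_basis_vec])
      have d: "psummable 4 ?d"
        by (intro psummable_diff s) simp
      have "lp_norm 4 ?d < 1"
        using N(3)[OF that False] by (simp add: fun_diff_def)
      then have "psum 4 ?d < 1"
        using lp_norm_less_iff[OF d, of 1] by simp
      then have "cmod (?d x) ^ 4 < 1"
        using norm_powr_le_psum[OF d, of x] by simp
      then have "cmod (?d x) < 1"
        using power_less_one_iff[of "cmod (?d x)" 4] by simp
      moreover have "?d x = c g x * basis_vec x (sg g x) - 1"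
        using zero[of x] by (simp add: \<pi>[OF psummable_basis_vec] basis_vec_def)
      ultimately show ?thesis
        by (auto simp: basis_vec_def split: if_splits)
    qed (simp add: zero)
    obtain U where U: "open_subgroup U" "U \<subseteq> N"
      using van_Dantzig[OF lc td N(1,2)] .
    have cU: "c g x = 1" if "g \<in> U" for g
    proof (rule unit_circle_no_small_subgroups[OF c1])
      fix n
      \<comment> \<open>Since \<open>U\<close> fixes \<open>x\<close>, the cocycle is multiplicative
        on it, so every power is again a value on \<open>U\<close>.\<close>
      have "\<exists>h\<in>U. c h x = c g x ^ n"
      proof (induction n)
        case 0
        then show ?case
          using U zero unfolding open_subgroup_def by (intro bexI[of _ 0]) auto
      next
        case (Suc n)
        then obtain h where h: "h \<in> U" "c h x = c g x ^ n"
          by blast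
        have "sg g x = x"
          using near U that by blast
        then have "c (g + h) x = c g x ^ Suc n"
          using add[of g h x] h by simp
        moreover have "g + h \<in> U"
          using U that h unfolding open_subgroup_def by blast
        ultimately show ?case
          by blast
      qed
      then show "cmod (c g x ^ n - 1) < 1"
        using near U by (metis subsetD)
    qed
    have "open_subgroup {g. sg g x = x \<and> c g x * z = z}"
    proof (rule open_subgroupI[of U])
      show "open U" "0 \<in> U"
        using U by (auto simp: open_subgroup_def)
      show "U \<subseteq> {g. sg g x = x \<and> c g x * z = z}"
        using cU near U by auto
      show "g + h \<in> {g. sg g x = x \<and> c g x * z = z}"
        if "g \<in> {g. sg g x = x \<and> c g x * z = z}" "h \<in> {g. sg g x = x \<and> c g x * z = z}" for g h
        using that add[of g h x] by auto
      show "- g \<in> {g. sg g x = x \<and> c g x * z = z}" if "g \<in> {g. sg g x = x \<and> c g x * z = z}" for g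
        using that minus[of g x] c0[of g x] by (auto simp: field_simps)
    qed
    then show ?thesis
      by (simp add: open_subgroup_def)
  qed
  then have ms: "monomial_system sg c"
    using c1 zero add by unfold_locales blast+
  moreover have "\<pi> g f = monomial_system.act sg c g f" if "f \<in> lp_space 4" for g f
    using that \<pi> by (simp add: fun_eq_iff monomial_system.act_def[OF ms] lp_space_iff)
  ultimately show thesis
    using that by blast
qed

lemma property_T_quasi_reg_imp_lp_4:
  fixes G :: "'g::topological_group_add itself"
  assumes lc: "locally_compact_space (euclidean :: 'g topology)"
    and td: "totally_disconnected_group TYPE('g)"
    and T: "property_T_quasi_reg TYPE('g)"
  shows "property_T_lp 4 TYPE('g)"
  unfolding property_T_lp_def
proof (rule notI, elim exE conjE)
  fix \<pi> :: "'g \<Rightarrow> (nat \<Rightarrow> complex) \<Rightarrow> (nat \<Rightarrow> complex)" and F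
  assume rep: "orth_rep_lp 4 \<pi>" and F: "\<forall>n. F n \<in> lp_prime 4 \<pi>" and ai: "almost_invariant_seq 4 \<pi> F"
  obtain sg c where ms: "monomial_system sg c"
    and act: "\<And>g f. f \<in> lp_space 4 \<Longrightarrow> \<pi> g f = monomial_system.act sg c g f"
    by (rule orth_rep_lp_4_monomial[OF lc td rep]) blast
  interpret monomial_system sg c
    by (rule ms)
  obtain K \<epsilon> where K: "compact (K :: 'g set)" "\<epsilon> > 0" "quasi_reg_gap K \<epsilon>"
    using property_T_quasi_reg_gap[OF T] .
  obtain \<eta> where \<eta>: "\<eta> > 0" "\<And>f. f \<in> lp_prime 4 \<pi> \<Longrightarrow> psum 4 f = 1 \<Longrightarrow>
      \<exists>g\<in>K. psum 4 (\<lambda>x. act g f x - f x) > \<eta>"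
    by (rule lp_prime_rigidity[OF K(3,2,1) act]) blast+
  have "eventually (\<lambda>n. \<forall>g\<in>K. lp_norm 4 (\<pi> g (F n) - F n) < \<eta> powr (1 / 4)) sequentially"
    using ai K(1) \<eta>(1) unfolding almost_invariant_seq_def by simp
  then obtain n where n: "\<And>g. g \<in> K \<Longrightarrow> lp_norm 4 (\<pi> g (F n) - F n) < \<eta> powr (1 / 4)"
    using eventually_happens[of _ sequentially] by force
  have Fn: "psummable 4 (F n)" "lp_norm 4 (F n) = 1"
    using ai by (auto simp: almost_invariant_seq_def lp_space_iff)
  then have "psum 4 (F n) = 1"
    using lp_norm_powr[OF Fn(1)] by simp
  then obtain g where g: "g \<in> K" "psum 4 (\<lambda>x. act g (F n) x - F n x) > \<eta>"
    using \<eta>(2) F by blast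
  have s: "psummable 4 (\<lambda>x. act g (F n) x - F n x)"
    using Fn by (intro psummable_diff) auto
  have "\<pi> g (F n) - F n = (\<lambda>x. act g (F n) x - F n x)"
    using act[of "F n" g] Fn by (simp add: fun_eq_iff lp_space_iff)
  then have "psum 4 (\<lambda>x. act g (F n) x - F n x) < (\<eta> powr (1 / 4)) powr 4"
    using n[OF g(1)] lp_norm_less_iff[OF s, of "\<eta> powr (1 / 4)"] \<eta>(1) by simp
  also have "\<dots> = \<eta>"
    using \<eta>(1) by (simp add: powr_powr del: powr_numeral)
  finally show False
    using g(2) by simp
qed

section \<open>Permutation representations on \<open>l_p\<close>\<close>

lemma psummable_constant_norm_infinite:
  assumes "psummable q f" "infinite A" "\<And>x. x \<in> A \<Longrightarrow> f x = a"
  shows "a = 0"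
proof (rule ccontr)
  assume "a \<noteq> 0"
  then have pos: "cmod a powr q > 0"
    by simp
  obtain N :: nat where N: "psum q f / cmod a powr q < real N"
    using reals_Archimedean2 by blast
  obtain B where B: "finite B" "card B = N" "B \<subseteq> A"
    using infinite_arbitrarily_large[OF assms(2)] by blast
  have "real N * cmod a powr q = (\<Sum>x\<in>B. cmod a powr q)"
    using B by simp
  also have "\<dots> = (\<Sum>x\<in>B. cmod (f x) powr q)"
    using B assms(3) by (intro sum.cong) auto
  also have "\<dots> \<le> psum q f"
    unfolding psum_def using assms(1) B by (intro finite_sum_le_infsum) (auto simp: psummable_def)
  finally show False
    using N pos by (simp add: pos_divide_less_eq)
qed

text \<open>For strong continuity, \<open>f\<close> is split into a finitely supported part and a
  small tail. For \<open>g\<close> in a suitable open neighbourhood of \<open>g0\<close> the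
  translates of the finite part coincide, and only the tail contributes.\<close>

lemma perm_orth_rep_lp:
  fixes tau :: "'g::topological_group_add \<Rightarrow> nat \<Rightarrow> nat"
  assumes ra: "right_action tau" and "p > 0"
  shows "orth_rep_lp p (\<lambda>g f n. f (tau g n))"
proof -
  interpret right_action tau
    by (rule ra)
  have iso: "lp_isometry p (\<lambda>f n. f (tau g n))" for g
    unfolding lp_isometry_def
  proof (intro conjI ballI allI)
    show "bij_betw (\<lambda>f n. f (tau g n)) (lp_space p) (lp_space p)"
      by (rule bij_betwI[where g="\<lambda>f n. f (tau (- g) n)"]) (auto simp: lp_space_iff)
    show "lp_norm p (\<lambda>n. f (tau g n)) = lp_norm p f" if "f \<in> lp_space p" for f
      using that by (simp add: lp_space_iff lp_norm_eq)
  qed simp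
  have cont: "((\<lambda>g. lp_norm p ((\<lambda>n. f (tau g n)) - (\<lambda>n. f (tau g0 n)))) \<longlongrightarrow> 0) (at g0)"
    if f: "psummable p f" for f g0
  proof (rule tendstoI)
    fix e :: real
    assume "e > 0"
    define e' where "e' = e powr p / (2 powr p * 2)"
    have "e' > 0"
      using \<open>e > 0\<close> by (simp add: e'_def)
    obtain A where A: "finite A" "psum p (\<lambda>x. if x \<in> A then 0 else f x) < e'"
      using psum_tail[OF f \<open>e' > 0\<close>] .
    define t where "t x = (if x \<in> A then 0 else f x)" for x
    have t: "psummable p t" "psum p t < e'"
      using A by (auto simp: t_def[abs_def] intro: psummable_mono[OF f \<open>p > 0\<close>])
    \<comment> \<open>Inverses occur because the translate of a function supported on
      \<open>A\<close> is supported on the preimage of \<open>A\<close>, that is, its image under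
      \<open>tau (- g)\<close>.\<close>
    define N where "N = (\<Inter>m\<in>A. {g. tau (- g) m = tau (- g0) m})"
    have "open N"
      unfolding N_def using A(1) open_uminus_vimage[OF open_fibre] by (intro open_INT) auto
    moreover have "g0 \<in> N"
      by (simp add: N_def)
    moreover have "lp_norm p ((\<lambda>n. f (tau g n)) - (\<lambda>n. f (tau g0 n))) < e" if "g \<in> N" for g
    proof -
      have eq: "f (tau g n) - f (tau g0 n) = t (tau g n) - t (tau g0 n)" for n
      proof (cases "tau g n \<in> A \<or> tau g0 n \<in> A")
        case True
        then have "tau g n = tau g0 n"
        proof
          assume "tau g n \<in> A"
          then have "tau (- g) (tau g n) = tau (- g0) (tau g n)"
            using that by (auto simp: N_def)
          then have "tau g0 n = tau g0 (tau (- g0) (tau g n))"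
            by simp
          then show ?thesis
            by simp
        next
          assume "tau g0 n \<in> A"
          then have "tau (- g) (tau g0 n) = tau (- g0) (tau g0 n)"
            using that by (auto simp: N_def)
          then have "tau g n = tau g (tau (- g) (tau g0 n))"
            by simp
          then show ?thesis
            by simp
        qed
        then show ?thesis
          by simp
      qed (simp add: t_def)
      have "psum p (\<lambda>n. t (tau g n) - t (tau g0 n)) \<le> 2 powr p * (psum p t + psum p t)"
        using psum_diff_le[of p "\<lambda>n. t (tau g n)" "\<lambda>n. t (tau g0 n)"] t \<open>p > 0\<close> by simp
      also have "\<dots> < 2 powr p * (e' + e')"
        using t by (intro mult_strict_left_mono) auto
      also have "\<dots> = e powr p"
        by (simp add: e'_def)
      finally have "psum p (\<lambda>n. f (tau g n) - f (tau g0 n)) < e powr p"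
        unfolding eq .
      moreover have "psummable p (\<lambda>n. f (tau g n) - f (tau g0 n))"
        using f \<open>p > 0\<close> by (intro psummable_diff) auto
      ultimately show ?thesis
        using lp_norm_less_iff \<open>p > 0\<close> \<open>e > 0\<close> unfolding fun_diff_def by blast
    qed
    ultimately have "\<forall>\<^sub>F g in at g0. lp_norm p ((\<lambda>n. f (tau g n)) - (\<lambda>n. f (tau g0 n))) < e"
      unfolding eventually_at_topological by blast
    then show "\<forall>\<^sub>F g in at g0. dist (lp_norm p ((\<lambda>n. f (tau g n)) - (\<lambda>n. f (tau g0 n)))) 0 < e"
      by (rule eventually_mono) (simp add: lp_norm_def)
  qed
  show ?thesis
    unfolding orth_rep_lp_def using iso cont by (simp add: lp_space_iff tau_zero tau_add Ball_def)
qed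

text \<open>Testing on basis vectors shows that a dual invariant functional is constant on orbits,
  and summability makes it vanish on infinite ones. A balanced vector annihilates exactly such
  functions.\<close>

lemma balanced_in_lp_prime:
  fixes tau :: "'g::topological_group_add \<Rightarrow> nat \<Rightarrow> nat"
  assumes ra: "right_action tau" and F: "right_action.balanced tau F"
  shows "F \<in> lp_prime p (\<lambda>g f n. f (tau g n))"
proof -
  interpret right_action tau
    by (rule ra)
  have fin: "finite {x. F x \<noteq> 0}"
    using F by (simp add: balanced_def)
  have "lp_pair F \<psi> = 0" if \<psi>: "dual_invariant p (\<lambda>g f n. f (tau g n)) \<psi>" for \<psi>
  proof -
    have inv: "\<psi> (tau g m) = \<psi> m" for g m
    proof -
      have "lp_pair (\<lambda>n. basis_vec m (tau (- g) n)) \<psi> = lp_pair (basis_vec m) \<psi>"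
        using \<psi> psummable_basis_vec[of p m] unfolding dual_invariant_def lp_space_iff[symmetric] by blast
      moreover have "lp_pair (\<lambda>n. basis_vec m (tau (- g) n)) \<psi> = \<psi> (tau g m)"
      proof -
        have "n = tau g m" if "basis_vec m (tau (- g) n) \<noteq> 0" for n
        proof -
          have "tau (- g) n = m"
            using that by (auto simp: basis_vec_def split: if_splits)
          then show ?thesis
            using tau_minus(2)[of g n] by simp
        qed
        then show ?thesis
          by (subst lp_pair_finite[of "{tau g m}"]) (auto simp: basis_vec_def)
      qed
      moreover have "lp_pair (basis_vec m) \<psi> = \<psi> m"
        by (subst lp_pair_finite[of "{m}"]) (auto simp: basis_vec_def)
      ultimately show ?thesis
        by simp
    qed
    have "\<psi> y = 0" if "infinite (orb y)" for y
    proof (rule psummable_constant_norm_infinite[OF _ that])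
      show "psummable (conj_exp p) \<psi>"
        using \<psi> by (simp add: dual_invariant_def lp_space_iff)
      show "\<psi> x = \<psi> y" if "x \<in> orb y" for x
        using invariant_on_orb[of \<psi>, OF inv that] .
    qed
    then have "(\<Sum>x\<in>{x. F x \<noteq> 0}. F x * \<psi> x) = 0"
      by (intro balanced_orthogonal[OF F inv _ fin]) auto
    then show ?thesis
      using lp_pair_finite[OF fin, of F \<psi>] by simp
  qed
  moreover have "psummable p F"
    using fin by (rule psummable_finite) auto
  ultimately show ?thesis
    by (auto simp: lp_prime_def lp_space_iff)
qed

text \<open>The Mazur image \<open>u n\<close> of \<open>f n\<close> is corrected to
  \<open>h n\<close> by its orbit mean. Were \<open>h n\<close> small, \<open>f n\<close> would be
  close to \<open>w\<close>, the image in l_2 of the mean; but \<open>w\<close> is invariant, hence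
  orthogonal to \<open>f n\<close>, and Pythagoras forbids this. So normalizing \<open>h n\<close>
  is harmless.\<close>

lemma not_property_T_lp_of_action:
  fixes tau :: "'g::topological_group_add \<Rightarrow> nat \<Rightarrow> nat"
  assumes ra: "right_action tau" and "p > 0" and bal: "\<And>n. right_action.balanced tau (f n)"
    and b: "b > 0" "\<And>n. b \<le> psum 2 (f n)" "\<And>n. psum 2 (f n) \<le> 2"
    and inv: "\<And>K e. compact K \<Longrightarrow> e > 0 \<Longrightarrow>
      eventually (\<lambda>n. \<forall>g\<in>K. psum 2 (\<lambda>x. f n (tau g x) - f n x) < e) sequentially"
  shows "\<not> property_T_lp p TYPE('g)"
proof -
  interpret right_action tau
    by (rule ra)
  define \<pi> where "\<pi> g h n = h (tau g n)" for g and h :: "nat \<Rightarrow> complex" and n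
  \<comment> \<open>The factor 1/2 lets the masses of \<open>f n\<close> and \<open>w\<close> be
    absorbed on the left, where Pythagoras supplies both in full.\<close>
  obtain C where C: "C > 0" "\<forall>a b. cmod (mazur (p / 2) a - mazur (p / 2) b) powr 2
      \<le> 1 / 2 * (cmod a powr p + cmod b powr p) + C * cmod (a - b) powr p"
    using mazur_diff_bound[of p 2 "1 / 2"] \<open>p > 0\<close> by auto
  define u where "u n x = mazur (2 / p) (f n x)" for n x
  define h where "h n x = u n x - orb_mean (u n) x" for n x
  have fin_f: "finite {x. f n x \<noteq> 0}" for n
    using bal[of n] by (simp add: balanced_def)
  have fin_u: "finite {x. u n x \<noteq> 0}" for n
    by (rule finite_subset[OF _ fin_f[of n]]) (auto simp: u_def)
  have bal_h: "balanced (h n)" for n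
    unfolding h_def by (rule balanced_diff_orb_mean[OF fin_u])
  have fin_h: "finite {x. h n x \<noteq> 0}" for n
    using bal_h[of n] by (simp add: balanced_def)
  have summ: "psummable q (f n)" "psummable q (u n)" "psummable q (h n)" "psummable q (orb_mean (u n))" for q n
    using fin_f[of n] fin_u[of n] fin_h[of n] finite_orb_mean[OF fin_u[of n]]
    by (auto intro: psummable_finite)
  define \<kappa> where "\<kappa> = b / (2 * C)"
  have "\<kappa> > 0"
    using b C by (simp add: \<kappa>_def)
  have lower: "psum p (h n) \<ge> \<kappa>" for n
  proof -
    define w where "w x = mazur (p / 2) (orb_mean (u n) x)" for x
    have f_eq: "f n x = mazur (p / 2) (u n x)" for x
      using mazur_inverse[of "2 / p" "f n x"] \<open>p > 0\<close> by (simp add: u_def)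
    have "psum 2 (\<lambda>x. f n x - w x) \<le> 1 / 2 * (psum p (u n) + psum p (orb_mean (u n))) + C * psum p (h n)"
      unfolding f_eq w_def h_def by (rule psum_mazur_diff_le[OF C(2)]) (use \<open>p > 0\<close> summ in auto)
    moreover have "psum p (u n) = psum 2 (f n)" "psum 2 w = psum p (orb_mean (u n))"
      using psum_mazur[of 2 p "u n"] psum_mazur[of 2 p "orb_mean (u n)"]
      by (simp_all add: f_eq[abs_def] w_def[abs_def])
    moreover have "psum 2 (\<lambda>x. f n x - w x) = psum 2 (f n) + psum 2 w - 2 * Re (l2_ip (f n) w)"
      by (rule psum_2_diff) (use summ psummable_mazur[of 2 p "orb_mean (u n)"] in \<open>auto simp: w_def[abs_def]\<close>)
    moreover have "l2_ip (f n) w = 0"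
    proof -
      have "(\<Sum>x\<in>{x. f n x \<noteq> 0}. f n x * cnj (w x)) = 0"
        by (rule balanced_orthogonal[OF bal[of n] _ _ fin_f]) (auto simp: w_def orb_mean_def)
      moreover have "l2_ip (f n) w = (\<Sum>\<^sub>\<infinity>x\<in>{x. f n x \<noteq> 0}. f n x * cnj (w x))"
        unfolding l2_ip_def by (rule infsum_cong_neutral) auto
      ultimately show ?thesis
        using fin_f[of n] by simp
    qed
    ultimately have "psum 2 (f n) + psum p (orb_mean (u n))
        \<le> 1 / 2 * (psum 2 (f n) + psum p (orb_mean (u n))) + C * psum p (h n)"
      by simp
    moreover have "x \<le> 2 * z" if "x + y \<le> 1 / 2 * (x + y) + z" "0 \<le> y" for x y z :: real
      using that by (simp add: field_simps)
    ultimately have "psum 2 (f n) \<le> 2 * (C * psum p (h n))"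
      using psum_nonneg by blast
    then have "b \<le> 2 * (C * psum p (h n))"
      using b(2)[of n] by simp
    then show ?thesis
      using C by (simp add: \<kappa>_def field_simps)
  qed
  define s where "s n = complex_of_real (psum p (h n) powr (- 1 / p))" for n
  have s_pow: "cmod (s n) powr p = 1 / psum p (h n)" for n
  proof -
    have "psum p (h n) > 0"
      using lower[of n] \<open>\<kappa> > 0\<close> by linarith
    have "cmod (s n) powr p = (psum p (h n) powr (- 1 / p)) powr p"
      unfolding s_def norm_of_real by simp
    also have "\<dots> = psum p (h n) powr (- 1)"
      unfolding powr_powr using \<open>p > 0\<close> by simp
    also have "\<dots> = 1 / psum p (h n)"
      using \<open>psum p (h n) > 0\<close> by (simp add: powr_minus_divide)
    finally show ?thesis .
  qed
  define F where "F n x = s n * h n x" for n x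
  have F: "psummable p (F n)" "psum p (F n) = 1" for n
    using summ lower[of n] \<open>\<kappa> > 0\<close> by (auto simp: F_def[abs_def] psummable_cmult psum_cmult s_pow)
  have "balanced (F n)" for n
  proof -
    have "finite {x. F n x \<noteq> 0}"
      by (rule finite_subset[OF _ fin_h[of n]]) (auto simp: F_def)
    then show ?thesis
      using bal_h[of n] by (simp add: balanced_def F_def flip: sum_distrib_left)
  qed
  then have prime: "F n \<in> lp_prime p \<pi>" for n
    using balanced_in_lp_prime[OF ra] unfolding \<pi>_def[abs_def] by blast
  have ai: "almost_invariant_seq p \<pi> F"
    unfolding almost_invariant_seq_def
  proof (intro conjI allI impI)
    show "F n \<in> lp_space p" "lp_norm p (F n) = 1" for n
      using F[of n] by (auto simp: lp_space_iff lp_norm_eq)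
    fix K :: "'g set" and e :: real
    assume K: "compact K" and "e > 0"
    define e' where "e' = \<kappa> * e powr p"
    have "e' > 0"
      using \<open>e > 0\<close> \<open>\<kappa> > 0\<close> by (simp add: e'_def)
    obtain C' where C': "C' > 0" "\<forall>a b. cmod (mazur (2 / p) a - mazur (2 / p) b) powr p
        \<le> e' / 8 * (cmod a powr 2 + cmod b powr 2) + C' * cmod (a - b) powr 2"
      using mazur_diff_bound[of 2 p "e' / 8"] \<open>p > 0\<close> \<open>e' > 0\<close> by auto
    have "eventually (\<lambda>n. \<forall>g\<in>K. psum 2 (\<lambda>x. f n (tau g x) - f n x) < e' / (2 * C')) sequentially"
      using K \<open>e' > 0\<close> C' by (intro inv) auto
    then show "eventually (\<lambda>n. \<forall>g\<in>K. lp_norm p (\<pi> g (F n) - F n) < e) sequentially"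
    proof (rule eventually_mono, intro ballI)
      fix n g
      assume "\<forall>g\<in>K. psum 2 (\<lambda>x. f n (tau g x) - f n x) < e' / (2 * C')" "g \<in> K"
      then have d: "psum 2 (\<lambda>x. f n (tau g x) - f n x) < e' / (2 * C')"
        by blast
      \<comment> \<open>The subtracted mean is invariant and cancels, so almost invariance passes
        unchanged from \<open>u n\<close> to \<open>h n\<close>.\<close>
      have h_diff: "h n (tau g x) - h n x = u n (tau g x) - u n x" for x
        by (simp add: h_def)
      have "psum p (\<lambda>x. u n (tau g x) - u n x)
          \<le> e' / 8 * (psum 2 (\<lambda>x. f n (tau g x)) + psum 2 (f n)) + C' * psum 2 (\<lambda>x. f n (tau g x) - f n x)"
        unfolding u_def by (rule psum_mazur_diff_le[OF C'(2)]) (use \<open>p > 0\<close> summ in auto)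
      also have "\<dots> < e' / 8 * 4 + C' * (e' / (2 * C'))"
        using d C' b(3)[of n] \<open>e' > 0\<close> by (intro add_le_less_mono mult_left_mono mult_strict_left_mono) auto
      also have "\<dots> = e'"
        using C' by simp
      finally have "psum p (\<lambda>x. h n (tau g x) - h n x) < e'"
        unfolding h_diff .
      then have "1 / psum p (h n) * psum p (\<lambda>x. h n (tau g x) - h n x) < 1 / psum p (h n) * e'"
        using lower[of n] \<open>\<kappa> > 0\<close> by (intro mult_strict_left_mono) auto
      also have "\<dots> \<le> e powr p"
        using lower[of n] \<open>\<kappa> > 0\<close> mult_right_mono[OF lower[of n], of "e powr p"]
        by (simp add: e'_def divide_simps mult.commute)
      also have "1 / psum p (h n) * psum p (\<lambda>x. h n (tau g x) - h n x) = psum p (\<pi> g (F n) - F n)"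
        by (simp add: \<pi>_def F_def fun_diff_def psum_cmult s_pow flip: right_diff_distrib)
      finally have "psum p (\<pi> g (F n) - F n) < e powr p" .
      moreover have "psummable p (\<pi> g (F n) - F n)"
        unfolding fun_diff_def \<pi>_def using F \<open>p > 0\<close> by (intro psummable_diff) auto
      ultimately show "lp_norm p (\<pi> g (F n) - F n) < e"
        using lp_norm_less_iff \<open>p > 0\<close> \<open>e > 0\<close> by blast
    qed
  qed
  have "orth_rep_lp p \<pi>"
    unfolding \<pi>_def[abs_def] by (rule perm_orth_rep_lp[OF ra \<open>p > 0\<close>])
  then show ?thesis
    unfolding property_T_lp_def using prime ai by blast
qed

section \<open>From weak containment to an action\<close>

text \<open>By Lindelof, countably many open sets with compact hulls cover the group. Every compact
  set is eventually inside the finite unions of hulls, so one diagonal sequence handles all compact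
  sets.\<close>

lemma sigma_compact_exhaustion:
  fixes G :: "'g::second_countable_topology itself"
  assumes lc: "locally_compact_space (euclidean :: 'g topology)"
  obtains C :: "nat \<Rightarrow> 'g set" where "\<And>n. compact (C n)" "\<And>K. compact K \<Longrightarrow> eventually (\<lambda>n. K \<subseteq> C n) sequentially"
proof -
  define B where "B = {U :: 'g set. open U \<and> (\<exists>D. compact D \<and> U \<subseteq> D)}"
  have cover: "\<Union>B = UNIV"
    using lc unfolding locally_compact_space_def B_def by simp blast
  obtain B' where B': "B' \<subseteq> B" "countable B'" "\<Union>B' = \<Union>B"
    using Lindelof[of B] by (auto simp: B_def)
  have "B' \<noteq> {}"
    using B' cover by auto
  define U where "U = from_nat_into B'"
  have U: "U n \<in> B'" "range U = B'" for n
    using B' \<open>B' \<noteq> {}\<close> by (auto simp: U_def from_nat_into range_from_nat_into)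
  have UB: "U n \<in> B" for n
    using U(1) B'(1) by blast
  then have "\<forall>n. \<exists>D. compact D \<and> U n \<subseteq> D"
    unfolding B_def by blast
  from choice[OF this] obtain D where D: "\<And>n. compact (D n)" "\<And>n. U n \<subseteq> D n"
    by blast
  have "eventually (\<lambda>n. K \<subseteq> (\<Union>i\<le>n. D i)) sequentially" if K: "compact K" for K
  proof -
    obtain I where I: "finite I" "K \<subseteq> (\<Union>i\<in>I. U i)"
    proof (rule compactE_image[OF K, of UNIV U])
      show "open (U i)" for i
        using UB[of i] by (simp add: B_def)
      show "K \<subseteq> (\<Union>i. U i)"
        using U B' cover by auto
    qed auto
    obtain N where N: "\<And>i. i \<in> I \<Longrightarrow> i \<le> N"
      using finite_nat_set_iff_bounded_le[of I] I by auto
    have "K \<subseteq> (\<Union>i\<le>n. D i)" if "n \<ge> N" for n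
    proof
      fix x assume "x \<in> K"
      then obtain i where "i \<in> I" "x \<in> U i"
        using I by auto
      then show "x \<in> (\<Union>i\<le>n. D i)"
        using N[of i] that D(2)[of i] by force
    qed
    then show ?thesis
      by (auto simp: eventually_sequentially)
  qed
  then show thesis
    using that[of "\<lambda>n. \<Union>i\<le>n. D i"] D by (simp add: compact_UN)
qed

section \<open>Cosets of open subgroups and finite approximation of vectors\<close>

lemma translate_subgroup:
  assumes "open_subgroup H" "h \<in> H"
  shows "(+) h ` H = H"
proof (intro equalityI subsetI)
  fix x assume "x \<in> H"
  then have "x = h + (- h + x)" "- h + x \<in> H"
    using assms unfolding open_subgroup_def by (auto simp flip: add.assoc)
  then show "x \<in> (+) h ` H"
    by (rule image_eqI)
qed (use assms in \<open>auto simp: open_subgroup_def\<close>)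

lemma translate_coset_eq_iff:
  assumes "open_subgroup H"
  shows "(+) g ` H = (+) k ` H \<longleftrightarrow> - k + g \<in> H"
proof
  assume "(+) g ` H = (+) k ` H"
  then have "g + 0 \<in> (+) k ` H"
    using assms unfolding open_subgroup_def by blast
  then show "- k + g \<in> H"
    by (auto simp flip: add.assoc)
next
  assume "- k + g \<in> H"
  then have "(+) k ` (+) (- k + g) ` H = (+) k ` H"
    by (simp add: translate_subgroup[OF assms])
  then show "(+) g ` H = (+) k ` H"
    by (simp add: translate_translate flip: add.assoc)
qed

lemma countable_left_cosets:
  fixes H :: "'g::{topological_group_add, second_countable_topology} set"
  assumes H: "open_subgroup H"
  shows "countable (left_cosets H)"
proof (rule countable_disjoint_open_subsets)
  fix S assume "S \<in> left_cosets H"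
  then obtain g where g: "S = (+) g ` H"
    by (auto simp: left_cosets_def)
  have "S = {x. - g + x \<in> H}"
    unfolding g by (auto simp flip: add.assoc intro!: image_eqI[of _ _ "- g + _"])
  then show "open S"
    using open_left_translate[of H "- g"] H by (simp add: open_subgroup_def)
next
  show "pairwise disjnt (left_cosets H)"
  proof (rule pairwiseI)
    fix S T assume "S \<in> left_cosets H" "T \<in> left_cosets H" "S \<noteq> T"
    then obtain g k where gk: "S = (+) g ` H" "T = (+) k ` H"
      by (auto simp: left_cosets_def)
    show "disjnt S T"
      unfolding disjnt_iff
    proof (intro allI notI)
      fix x assume "x \<in> S \<and> x \<in> T"
      then obtain a b where ab: "a \<in> H" "b \<in> H" "x = g + a" "x = k + b"
        using gk by auto
      then have "- k + g = b + - a"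
        by (metis add.assoc add.left_inverse add.right_inverse add_0 add_0_right)
      then have "- k + g \<in> H"
        using ab H unfolding open_subgroup_def by metis
      then show False
        using translate_coset_eq_iff[OF H] gk \<open>S \<noteq> T\<close> by blast
    qed
  qed
qed

lemma open_coset_stabilizer:
  fixes H :: "'g::topological_group_add set"
  assumes H: "open_subgroup H" and x: "x \<in> left_cosets H"
  shows "open {g. (+) (- g) ` x = x}"
proof -
  obtain k where k: "x = (+) k ` H"
    using x by (auto simp: left_cosets_def)
  have "(+) (- g) ` x = x \<longleftrightarrow> - k + (- g + k) \<in> H" for g
    unfolding k translate_translate using translate_coset_eq_iff[OF H] by blast
  moreover have "open {g. - k + (- g + k) \<in> H}"
    using open_uminus_vimage[OF open_right_translate[OF open_left_translate[of H "- k"], of k]] H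
    by (simp add: open_subgroup_def)
  ultimately show ?thesis
    by simp
qed

text \<open>Plain truncation would destroy a vanishing sum, but only a finite coset space imposes
  one, and there the support is already finite.\<close>

lemma l2_cosets_prime_truncate:
  assumes \<xi>: "\<xi> \<in> l2_cosets_prime H" and "e > 0"
  obtains \<zeta> where "\<zeta> \<in> l2_cosets_prime H" "finite {x. \<zeta> x \<noteq> 0}" "psum 2 (\<lambda>x. \<xi> x - \<zeta> x) < e"
    "psum 2 \<zeta> \<le> psum 2 \<xi>"
proof (cases "finite (left_cosets H)")
  case True
  have "{x. \<xi> x \<noteq> 0} \<subseteq> left_cosets H"
    using \<xi> by (auto simp: l2_cosets_prime_def l2_cosets_iff)
  then have "finite {x. \<xi> x \<noteq> 0}"
    using True by (rule finite_subset)
  then show ?thesis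
    using that[OF \<xi>] \<open>e > 0\<close> by (simp add: psum_def)
next
  case False
  have \<xi>2: "psummable 2 \<xi>" "\<And>x. x \<notin> left_cosets H \<Longrightarrow> \<xi> x = 0"
    using \<xi> by (auto simp: l2_cosets_prime_def l2_cosets_iff)
  obtain A where A: "finite A" "psum 2 (\<lambda>x. if x \<in> A then 0 else \<xi> x) < e"
    using psum_tail[OF \<xi>2(1) \<open>e > 0\<close>] .
  define \<zeta> where "\<zeta> x = (if x \<in> A then \<xi> x else 0)" for x
  have "psummable 2 \<zeta>" "psum 2 \<zeta> \<le> psum 2 \<xi>"
    by (rule psummable_mono[OF \<xi>2(1)] psum_mono[OF \<xi>2(1)]; simp add: \<zeta>_def)+
  then have "\<zeta> \<in> l2_cosets_prime H"
    using \<xi>2 False by (intro l2_cosets_primeI) (auto simp: l2_cosets_iff \<zeta>_def)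
  moreover have "(\<lambda>x. \<xi> x - \<zeta> x) = (\<lambda>x. if x \<in> A then 0 else \<xi> x)"
    by (auto simp: \<zeta>_def)
  moreover have "finite {x. \<zeta> x \<noteq> 0}"
    by (rule finite_subset[OF _ A(1)]) (auto simp: \<zeta>_def)
  ultimately show ?thesis
    using that A \<open>psum 2 \<zeta> \<le> psum 2 \<xi>\<close> by simp
qed

text \<open>Weak containment controls coefficients only. At 0 a coefficient is the squared norm, and
  twice the drop of its real part at \<open>g\<close> is the squared displacement.\<close>

lemma dirsum_coeff_has_sum:
  fixes \<Xi> :: "'g::topological_group_add set \<Rightarrow> 'g set \<Rightarrow> complex"
  assumes \<Xi>: "\<Xi> \<in> dirsum_space"
  shows "((\<lambda>H. psum 2 (\<Xi> H)) has_sum Re (dirsum_coeff \<Xi> 0)) {H. open_subgroup H}"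
    and "((\<lambda>H. psum 2 (\<lambda>x. quasi_reg g (\<Xi> H) x - \<Xi> H x)) has_sum
          (2 * Re (dirsum_coeff \<Xi> 0) - 2 * Re (dirsum_coeff \<Xi> g))) {H. open_subgroup H}"
proof -
  let ?S = "{H :: 'g set. open_subgroup H}"
  have pr: "\<Xi> H \<in> l2_cosets H" "psummable 2 (\<Xi> H)" if "H \<in> ?S" for H
    using \<Xi> that by (auto simp: dirsum_space_def l2_cosets_prime_def l2_cosets_iff)
  have "(\<lambda>H. \<Sum>\<^sub>\<infinity>x\<in>left_cosets H. (cmod (\<Xi> H x))\<^sup>2) summable_on ?S"
    using \<Xi> by (simp add: dirsum_space_def)
  moreover have e: "(\<Sum>\<^sub>\<infinity>x\<in>left_cosets H. (cmod (\<Xi> H x))\<^sup>2) = psum 2 (\<Xi> H)" if "H \<in> ?S" for H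
    by (rule infsum_cosets_eq_psum[OF pr(1)[OF that]])
  ultimately have sN: "(\<lambda>H. psum 2 (\<Xi> H)) summable_on ?S"
    by (simp only: summable_on_cong[of ?S, OF e])
  have coeff: "((\<lambda>H. l2_ip (quasi_reg g (\<Xi> H)) (\<Xi> H)) has_sum dirsum_coeff \<Xi> g) ?S" for g
  proof -
    have "(\<lambda>H. norm (l2_ip (quasi_reg g (\<Xi> H)) (\<Xi> H))) summable_on ?S"
    proof (rule Infinite_Sum.abs_summable_on_comparison_test'[OF sN])
      fix H assume "H \<in> ?S"
      then show "norm (l2_ip (quasi_reg g (\<Xi> H)) (\<Xi> H)) \<le> psum 2 (\<Xi> H)"
        using l2_ip_bound[of "quasi_reg g (\<Xi> H)" "\<Xi> H" 1] pr(2)[of H] by simp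
    qed
    then have "(\<lambda>H. l2_ip (quasi_reg g (\<Xi> H)) (\<Xi> H)) summable_on ?S"
      by (rule Infinite_Sum.abs_summable_summable)
    moreover have "dirsum_coeff \<Xi> g = (\<Sum>\<^sub>\<infinity>H\<in>?S. l2_ip (quasi_reg g (\<Xi> H)) (\<Xi> H))"
      unfolding dirsum_coeff_def by (intro infsum_cong l2_inner_eq_ip pr)
    ultimately show ?thesis
      using has_sum_infsum by metis
  qed
  have q0: "quasi_reg 0 \<xi> = \<xi>" for \<xi> :: "'g set \<Rightarrow> complex"
    by (simp add: quasi_reg_def)
  have "((\<lambda>H. Re (l2_ip (quasi_reg 0 (\<Xi> H)) (\<Xi> H))) has_sum Re (dirsum_coeff \<Xi> 0)) ?S"
    by (rule has_sum_Re[OF coeff])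
  moreover have e0: "Re (l2_ip (quasi_reg 0 (\<Xi> H)) (\<Xi> H)) = psum 2 (\<Xi> H)" if "H \<in> ?S" for H
    unfolding q0 l2_ip_self[OF pr(2)[OF that]] by simp
  ultimately show N: "((\<lambda>H. psum 2 (\<Xi> H)) has_sum Re (dirsum_coeff \<Xi> 0)) ?S"
    by (simp only: has_sum_cong[of ?S, OF e0])
  have "((\<lambda>H. 2 * psum 2 (\<Xi> H) - 2 * Re (l2_ip (quasi_reg g (\<Xi> H)) (\<Xi> H))) has_sum
      (2 * Re (dirsum_coeff \<Xi> 0) - 2 * Re (dirsum_coeff \<Xi> g))) ?S"
    by (intro has_sum_minus has_sum_cmult_right N has_sum_Re coeff)
  moreover have e1: "psum 2 (\<lambda>x. quasi_reg g (\<Xi> H) x - \<Xi> H x)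
      = 2 * psum 2 (\<Xi> H) - 2 * Re (l2_ip (quasi_reg g (\<Xi> H)) (\<Xi> H))" if "H \<in> ?S" for H
    using psum_2_diff[of "quasi_reg g (\<Xi> H)" "\<Xi> H"] pr(2)[OF that] by simp
  ultimately show "((\<lambda>H. psum 2 (\<lambda>x. quasi_reg g (\<Xi> H) x - \<Xi> H x)) has_sum
          (2 * Re (dirsum_coeff \<Xi> 0) - 2 * Re (dirsum_coeff \<Xi> g))) ?S"
    by (simp only: has_sum_cong[of ?S, OF e1])
qed

text \<open>A finite sum of coefficients close to 1 gives vectors of mass about 1 and small
  displacement. They are reduced to finitely many subgroups and then to finite supports, with errors
  spread evenly over the pieces.\<close>

lemma almost_invariant_families:
  fixes K :: "'g::topological_group_add set"
  assumes wc: "trivial_weakly_contained_quasi_reg TYPE('g)" and K: "compact K" and "e > 0"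
  shows "\<exists>(n::nat) L \<xi>. (\<forall>i<n. open_subgroup (L i) \<and> \<xi> i \<in> l2_cosets_prime (L i) \<and> finite {x. \<xi> i x \<noteq> 0}) \<and>
    1 / 8 \<le> (\<Sum>i<n. psum 2 (\<xi> i)) \<and> (\<Sum>i<n. psum 2 (\<xi> i)) \<le> 2 \<and>
    (\<forall>g\<in>K. (\<Sum>i<n. psum 2 (\<lambda>x. quasi_reg g (\<xi> i) x - \<xi> i x)) \<le> e)"
proof -
  \<comment> \<open>The displacement will be at most 4 * 4 + 32 = 48 times
    \<open>\<epsilon>\<close>. The mass will be at least (1 - 6 * \<open>\<epsilon>\<close>) / 4,
    which exceeds 1/8 once \<open>\<epsilon>\<close> is at most 1/16.\<close>
  define \<epsilon> where "\<epsilon> = min (1 / 16) (e / 48)"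
  have \<epsilon>: "\<epsilon> > 0" "\<epsilon> \<le> 1 / 16" "48 * \<epsilon> \<le> e"
    using \<open>e > 0\<close> by (auto simp: \<epsilon>_def)
  \<comment> \<open>Including 0 makes the approximation control the total mass as well.\<close>
  have "compact (insert 0 K)"
    using K by simp
  then have "\<exists>(n::nat) \<Xi>. (\<forall>i<n. \<Xi> i \<in> dirsum_space) \<and>
      (\<forall>g\<in>insert 0 K. cmod (complex_of_real 1 - (\<Sum>i<n. dirsum_coeff (\<Xi> i) g)) < \<epsilon>)"
    using wc \<epsilon>(1) unfolding trivial_weakly_contained_quasi_reg_def by (metis zero_le_one)
  then obtain n0 :: nat and \<Xi> :: "nat \<Rightarrow> 'g set \<Rightarrow> 'g set \<Rightarrow> complex" where
    \<Xi>: "\<And>i. i < n0 \<Longrightarrow> \<Xi> i \<in> dirsum_space"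
    and close: "\<And>g. g \<in> insert 0 K \<Longrightarrow> cmod (complex_of_real 1 - (\<Sum>i<n0. dirsum_coeff (\<Xi> i) g)) < \<epsilon>"
    by blast
  define r where "r g = (\<Sum>i<n0. Re (dirsum_coeff (\<Xi> i) g))" for g
  have r: "\<bar>1 - r g\<bar> < \<epsilon>" if "g \<in> insert 0 K" for g
    using abs_Re_le_cmod[of "complex_of_real 1 - (\<Sum>i<n0. dirsum_coeff (\<Xi> i) g)"] close[OF that]
    by (simp add: r_def)
  let ?S = "{H :: 'g set. open_subgroup H}"
  have "\<exists>F. finite F \<and> F \<subseteq> ?S \<and> Re (dirsum_coeff (\<Xi> i) 0) - \<epsilon> / real (Suc n0) \<le> (\<Sum>H\<in>F. psum 2 (\<Xi> i H))"
    if "i < n0" for i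
  proof -
    have N: "((\<lambda>H. psum 2 (\<Xi> i H)) has_sum Re (dirsum_coeff (\<Xi> i) 0)) ?S"
      by (rule dirsum_coeff_has_sum(1)[OF \<Xi>[OF that]])
    obtain F where "finite F" "F \<subseteq> ?S"
      "dist (sum (\<lambda>H. psum 2 (\<Xi> i H)) F) (Re (dirsum_coeff (\<Xi> i) 0)) \<le> \<epsilon> / real (Suc n0)"
      using has_sum_finite_approximation[OF N, of "\<epsilon> / real (Suc n0)"] \<epsilon>(1) by auto
    then show ?thesis
      unfolding dist_real_def by (intro exI[of _ F]) linarith
  qed
  then have "\<forall>i. \<exists>F. i < n0 \<longrightarrow> finite F \<and> F \<subseteq> ?S \<and>
      Re (dirsum_coeff (\<Xi> i) 0) - \<epsilon> / real (Suc n0) \<le> (\<Sum>H\<in>F. psum 2 (\<Xi> i H))"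
    by blast
  from choice[OF this] obtain F where F: "\<And>i. i < n0 \<Longrightarrow> finite (F i)" "\<And>i. i < n0 \<Longrightarrow> F i \<subseteq> ?S"
    "\<And>i. i < n0 \<Longrightarrow> Re (dirsum_coeff (\<Xi> i) 0) - \<epsilon> / real (Suc n0) \<le> (\<Sum>H\<in>F i. psum 2 (\<Xi> i H))"
    by blast
  define P where "P = Sigma {..<n0} F"
  have P: "finite P" "\<And>i H. (i, H) \<in> P \<Longrightarrow> i < n0 \<and> H \<in> ?S"
    using F(1,2) by (auto simp: P_def)
  have sum_P: "(\<Sum>y\<in>P. f (fst y) (snd y)) = (\<Sum>i<n0. \<Sum>H\<in>F i. f i H)" for f :: "nat \<Rightarrow> 'g set \<Rightarrow> real"
    unfolding P_def by (subst sum.Sigma) (use F in \<open>auto simp: case_prod_beta\<close>)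
  define \<Phi> where "\<Phi> y = \<Xi> (fst y) (snd y)" for y
  have \<Phi>: "\<Phi> y \<in> l2_cosets_prime (snd y)" "psummable 2 (\<Phi> y)" if "y \<in> P" for y
  proof -
    show "\<Phi> y \<in> l2_cosets_prime (snd y)"
      using \<Xi>[of "fst y"] P(2)[of "fst y" "snd y"] that unfolding \<Phi>_def dirsum_space_def by auto
    then show "psummable 2 (\<Phi> y)"
      by (simp add: l2_cosets_prime_def l2_cosets_iff)
  qed
  have N_upper: "(\<Sum>y\<in>P. psum 2 (\<Phi> y)) \<le> 1 + \<epsilon>"
  proof -
    have "(\<Sum>y\<in>P. psum 2 (\<Phi> y)) \<le> r 0"
      unfolding \<Phi>_def sum_P[of "\<lambda>i H. psum 2 (\<Xi> i H)"] r_def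
      by (intro sum_mono finite_sum_le_has_sum[OF dirsum_coeff_has_sum(1)[OF \<Xi>]]) (use F in auto)
    then show ?thesis
      using r[of 0] by simp
  qed
  have N_lower: "1 - 2 * \<epsilon> \<le> (\<Sum>y\<in>P. psum 2 (\<Phi> y))"
  proof -
    have "r 0 - (\<Sum>i<n0. \<epsilon> / real (Suc n0)) \<le> (\<Sum>y\<in>P. psum 2 (\<Phi> y))"
      unfolding \<Phi>_def sum_P[of "\<lambda>i H. psum 2 (\<Xi> i H)"] r_def sum_subtractf[symmetric] using F(3) by (intro sum_mono) auto
    moreover have "(\<Sum>i<n0. \<epsilon> / real (Suc n0)) \<le> \<epsilon>"
      using \<epsilon>(1) by (simp add: divide_simps)
    ultimately show ?thesis
      using r[of 0] by simp
  qed
  \<comment> \<open>Dropping summands only lowers the displacement, all its terms being nonnegative;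
    only the mass needed a lower approximation.\<close>
  have D_upper: "(\<Sum>y\<in>P. psum 2 (\<lambda>x. quasi_reg g (\<Phi> y) x - \<Phi> y x)) \<le> 4 * \<epsilon>" if "g \<in> K" for g
  proof -
    have "(\<Sum>y\<in>P. psum 2 (\<lambda>x. quasi_reg g (\<Phi> y) x - \<Phi> y x))
        \<le> (\<Sum>i<n0. 2 * Re (dirsum_coeff (\<Xi> i) 0) - 2 * Re (dirsum_coeff (\<Xi> i) g))"
      unfolding \<Phi>_def sum_P[of "\<lambda>i H. psum 2 (\<lambda>x. quasi_reg g (\<Xi> i H) x - \<Xi> i H x)"]
      by (intro sum_mono finite_sum_le_has_sum[OF dirsum_coeff_has_sum(2)[OF \<Xi>]]) (use F in auto)
    also have "\<dots> = 2 * r 0 - 2 * r g"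
      by (simp add: r_def sum_subtractf sum_distrib_left)
    also have "\<dots> \<le> 4 * \<epsilon>"
      using r[of 0] r[of g] that by (simp add: abs_less_iff)
    finally show ?thesis .
  qed
  define t where "t = \<epsilon> / real (Suc (card P))"
  have "t > 0"
    using \<epsilon> by (simp add: t_def)
  have tP: "real (card P) * t \<le> \<epsilon>"
    using \<epsilon>(1) by (simp add: t_def divide_simps)
  have "\<exists>\<zeta>. \<zeta> \<in> l2_cosets_prime (snd y) \<and> finite {x. \<zeta> x \<noteq> 0} \<and>
      psum 2 (\<lambda>x. \<Phi> y x - \<zeta> x) < t \<and> psum 2 \<zeta> \<le> psum 2 (\<Phi> y)" if "y \<in> P" for y
    using l2_cosets_prime_truncate[OF \<Phi>(1)[OF that] \<open>t > 0\<close>] by metis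
  then have "\<forall>y. \<exists>\<zeta>. y \<in> P \<longrightarrow> \<zeta> \<in> l2_cosets_prime (snd y) \<and> finite {x. \<zeta> x \<noteq> 0} \<and>
      psum 2 (\<lambda>x. \<Phi> y x - \<zeta> x) < t \<and> psum 2 \<zeta> \<le> psum 2 (\<Phi> y)"
    by blast
  from choice[OF this] obtain \<zeta> where \<zeta>: "\<And>y. y \<in> P \<Longrightarrow> \<zeta> y \<in> l2_cosets_prime (snd y)"
    "\<And>y. y \<in> P \<Longrightarrow> finite {x. \<zeta> y x \<noteq> 0}" "\<And>y. y \<in> P \<Longrightarrow> psum 2 (\<lambda>x. \<Phi> y x - \<zeta> y x) < t"
    "\<And>y. y \<in> P \<Longrightarrow> psum 2 (\<zeta> y) \<le> psum 2 (\<Phi> y)"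
    by blast
  have s\<zeta>: "psummable 2 (\<zeta> y)" if "y \<in> P" for y
    using \<zeta>(2)[OF that] by (rule psummable_finite) auto
  have \<zeta>_upper: "(\<Sum>y\<in>P. psum 2 (\<zeta> y)) \<le> 2"
  proof -
    have "(\<Sum>y\<in>P. psum 2 (\<zeta> y)) \<le> (\<Sum>y\<in>P. psum 2 (\<Phi> y))"
      by (rule sum_mono) (rule \<zeta>(4))
    then show ?thesis
      using N_upper \<epsilon>(2) by linarith
  qed
  have \<zeta>_lower: "1 / 8 \<le> (\<Sum>y\<in>P. psum 2 (\<zeta> y))"
  proof -
    have "psum 2 (\<Phi> y) \<le> 4 * psum 2 (\<zeta> y) + 4 * t" if "y \<in> P" for y
      using psum_add_le[of 2 "\<lambda>x. \<Phi> y x - \<zeta> y x" "\<zeta> y"] s\<zeta>[OF that] \<Phi>(2)[OF that] \<zeta>(3)[OF that]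
      by (simp add: psummable_diff)
    then have "(\<Sum>y\<in>P. psum 2 (\<Phi> y)) \<le> (\<Sum>y\<in>P. 4 * psum 2 (\<zeta> y) + 4 * t)"
      by (rule sum_mono)
    also have "\<dots> = 4 * (\<Sum>y\<in>P. psum 2 (\<zeta> y)) + 4 * (real (card P) * t)"
      by (simp add: sum.distrib sum_distrib_left)
    finally show ?thesis
      using N_lower tP \<epsilon>(2) by linarith
  qed
  have \<zeta>_diff: "(\<Sum>y\<in>P. psum 2 (\<lambda>x. quasi_reg g (\<zeta> y) x - \<zeta> y x)) \<le> e" if g: "g \<in> K" for g
  proof -
    have "psum 2 (\<lambda>x. quasi_reg g (\<zeta> y) x - \<zeta> y x)
        \<le> 4 * psum 2 (\<lambda>x. quasi_reg g (\<Phi> y) x - \<Phi> y x) + 32 * t" if y: "y \<in> P" for y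
    proof -
      define d where "d x = \<Phi> y x - \<zeta> y x" for x
      have d: "psummable 2 d" "psum 2 d < t"
        using s\<zeta>[OF y] \<Phi>(2)[OF y] \<zeta>(3)[OF y] by (simp_all add: d_def[abs_def] psummable_diff)
      have eq: "(\<lambda>x. quasi_reg g (\<zeta> y) x - \<zeta> y x)
          = (\<lambda>x. (quasi_reg g (\<Phi> y) x - \<Phi> y x) - (quasi_reg g d x - d x))"
        by (auto simp: fun_eq_iff quasi_reg_def d_def)
      have s1: "psummable 2 (\<lambda>x. quasi_reg g (\<Phi> y) x - \<Phi> y x)" "psummable 2 (\<lambda>x. quasi_reg g d x - d x)"
        using \<Phi>(2)[OF y] d by (simp_all add: psummable_diff)
      have "psum 2 (\<lambda>x. quasi_reg g d x - d x) \<le> 4 * (psum 2 d + psum 2 d)"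
        using psum_diff_le[of 2 "quasi_reg g d" d] d by simp
      moreover have "psum 2 (\<lambda>x. (quasi_reg g (\<Phi> y) x - \<Phi> y x) - (quasi_reg g d x - d x))
          \<le> 4 * (psum 2 (\<lambda>x. quasi_reg g (\<Phi> y) x - \<Phi> y x) + psum 2 (\<lambda>x. quasi_reg g d x - d x))"
        using psum_diff_le[OF s1] by simp
      ultimately show ?thesis
        unfolding eq using d(2) by simp
    qed
    then have "(\<Sum>y\<in>P. psum 2 (\<lambda>x. quasi_reg g (\<zeta> y) x - \<zeta> y x))
        \<le> (\<Sum>y\<in>P. 4 * psum 2 (\<lambda>x. quasi_reg g (\<Phi> y) x - \<Phi> y x) + 32 * t)"
      by (rule sum_mono)
    also have "\<dots> = 4 * (\<Sum>y\<in>P. psum 2 (\<lambda>x. quasi_reg g (\<Phi> y) x - \<Phi> y x)) + 32 * (real (card P) * t)"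
      by (simp add: sum.distrib sum_distrib_left)
    finally show ?thesis
      using D_upper[OF g] tP \<epsilon>(3) by linarith
  qed
  obtain h where h: "bij_betw h {..<card P} P"
    using ex_bij_betw_nat_finite[OF P(1)] by (auto simp: atLeast0LessThan)
  have hP: "h i \<in> P" if "i < card P" for i
    using bij_betw_apply[OF h] that by simp
  have re: "(\<Sum>i<card P. f (h i)) = (\<Sum>y\<in>P. f y)" for f :: "nat \<times> 'g set \<Rightarrow> real"
    by (rule sum.reindex_bij_betw[OF h])
  show ?thesis
  proof (intro exI conjI)
    show "\<forall>i<card P. open_subgroup (snd (h i)) \<and> \<zeta> (h i) \<in> l2_cosets_prime (snd (h i)) \<and> finite {x. \<zeta> (h i) x \<noteq> 0}"
    proof (intro allI impI)
      fix i assume "i < card P"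
      then show "open_subgroup (snd (h i)) \<and> \<zeta> (h i) \<in> l2_cosets_prime (snd (h i)) \<and> finite {x. \<zeta> (h i) x \<noteq> 0}"
        using \<zeta>(1,2)[OF hP] P(2)[of "fst (h i)" "snd (h i)"] hP[of i] by simp
    qed
    show "1 / 8 \<le> (\<Sum>i<card P. psum 2 (\<zeta> (h i)))" "(\<Sum>i<card P. psum 2 (\<zeta> (h i))) \<le> 2"
      unfolding re[of "\<lambda>y. psum 2 (\<zeta> y)"] by (fact \<zeta>_lower, fact \<zeta>_upper)
    show "\<forall>g\<in>K. (\<Sum>i<card P. psum 2 (\<lambda>x. quasi_reg g (\<zeta> (h i)) x - \<zeta> (h i) x)) \<le> e"
      using \<zeta>_diff re[of "\<lambda>y. psum 2 (\<lambda>x. quasi_reg _ (\<zeta> y) x - \<zeta> y x)"] by simp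
  qed
qed

section \<open>One action on the naturals carrying countably many coset spaces\<close>

locale coset_families =
  fixes m :: "nat \<Rightarrow> nat" and L :: "nat \<Rightarrow> nat \<Rightarrow> 'g::{topological_group_add, second_countable_topology} set"
  assumes open_subgroup_L: "i < m n \<Longrightarrow> open_subgroup (L n i)"
begin

text \<open>The tags keep coset spaces apart even when the same subgroup occurs repeatedly.\<close>

definition X :: "(nat \<times> nat \<times> 'g set) set" where
  "X = {(n, i, x). i < m n \<and> x \<in> left_cosets (L n i)}"

lemma countable_X: "countable X"
proof -
  have "X = (\<Union>n. \<Union>i\<in>{..<m n}. (\<lambda>x. (n, i, x)) ` left_cosets (L n i))"
    by (auto simp: X_def)
  then show ?thesis
    by (simp only:) (intro countable_UN countable_image countable_left_cosets open_subgroup_L; simp)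
qed

definition code :: "nat \<Rightarrow> nat \<Rightarrow> 'g set \<Rightarrow> nat" where
  "code n i x = to_nat_on X (n, i, x)"

definition decode :: "nat \<Rightarrow> nat \<times> nat \<times> 'g set" where
  "decode = inv_into X (to_nat_on X)"

lemma decode_code [simp]: "(n, i, x) \<in> X \<Longrightarrow> decode (code n i x) = (n, i, x)"
  unfolding decode_def code_def by (intro inv_into_f_f inj_on_to_nat_on countable_X)

text \<open>Off the coded cosets the action is trivial, so nothing need be assumed about the size of \<open>X\<close>.\<close>

definition tau :: "'g \<Rightarrow> nat \<Rightarrow> nat" where
  "tau g k = (if k \<in> to_nat_on X ` X then (case decode k of (n, i, x) \<Rightarrow> code n i ((+) (- g) ` x)) else k)"

definition lift :: "nat \<Rightarrow> (nat \<Rightarrow> 'g set \<Rightarrow> complex) \<Rightarrow> nat \<Rightarrow> complex" where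
  "lift n \<zeta> k = (if k \<in> to_nat_on X ` X then (case decode k of (n', i, x) \<Rightarrow> if n' = n then \<zeta> i x else 0) else 0)"

lemma code_in: "(n, i, x) \<in> X \<Longrightarrow> code n i x \<in> to_nat_on X ` X"
  by (simp add: code_def)

lemma X_translate [simp]: "(n, i, (+) g ` x) \<in> X \<longleftrightarrow> (n, i, x) \<in> X"
  by (simp add: X_def left_cosets_translate)

lemma tau_code: "(n, i, x) \<in> X \<Longrightarrow> tau g (code n i x) = code n i ((+) (- g) ` x)"
  by (simp add: tau_def code_in)

lemma tau_out: "k \<notin> to_nat_on X ` X \<Longrightarrow> tau g k = k"
  by (simp add: tau_def)

lemma lift_code: "(n', i, x) \<in> X \<Longrightarrow> lift n \<zeta> (code n' i x) = (if n' = n then \<zeta> i x else 0)"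
  by (simp add: lift_def code_in)

lemma lift_out: "k \<notin> to_nat_on X ` X \<Longrightarrow> lift n \<zeta> k = 0"
  by (simp add: lift_def)

lemma code_cases:
  obtains (code) n i x where "(n, i, x) \<in> X" "k = code n i x" | (out) "k \<notin> to_nat_on X ` X"
  unfolding code_def by fastforce

lemma code_inj: "(n, i, x) \<in> X \<Longrightarrow> (n', i', x') \<in> X \<Longrightarrow> code n i x = code n' i' x' \<longleftrightarrow> n = n' \<and> i = i' \<and> x = x'"
  by (metis decode_code prod.inject)

sublocale right_action tau
proof unfold_locales
  fix g h :: 'g and k
  show "tau 0 k = k"
    by (cases k rule: code_cases) (auto simp: tau_code tau_out)
  show "tau (g + h) k = tau h (tau g k)"
    by (cases k rule: code_cases)
       (auto simp: tau_code tau_out translate_translate minus_add simp del: add_uminus_conv_diff)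
  show "open {g. tau g k = k}"
  proof (cases k rule: code_cases)
    case (code n i x)
    then have "{g. tau g k = k} = {g. (+) (- g) ` x = x}"
      by (auto simp: tau_code code_inj)
    then show ?thesis
      using code open_coset_stabilizer[OF open_subgroup_L, of i n x] by (simp add: X_def)
  qed (simp add: tau_out)
qed

lemma orb_code:
  assumes "(n, i, x) \<in> X"
  shows "orb (code n i x) = code n i ` left_cosets (L n i)"
proof (intro equalityI subsetI)
  fix k assume "k \<in> code n i ` left_cosets (L n i)"
  then obtain a b where ab: "k = code n i ((+) a ` L n i)" "x = (+) b ` L n i"
    using assms by (auto simp: X_def left_cosets_def)
  have "- (b + - a) + b = a"
    by (simp add: minus_add add.assoc del: add_uminus_conv_diff)
  then have "k = tau (b + - a) (code n i x)"
    unfolding tau_code[OF assms] unfolding ab translate_translate by simp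
  then show "k \<in> orb (code n i x)"
    by simp
next
  fix k assume "k \<in> orb (code n i x)"
  then obtain g where "k = code n i ((+) (- g) ` x)"
    using tau_code[OF assms] by (auto simp: orb_def)
  moreover have "(+) (- g) ` x \<in> left_cosets (L n i)"
    using assms by (simp add: X_def left_cosets_translate)
  ultimately show "k \<in> code n i ` left_cosets (L n i)"
    by blast
qed

lemma inj_code: "i < m n \<Longrightarrow> inj_on (code n i) (left_cosets (L n i))"
  by (rule inj_onI) (use code_inj in \<open>auto simp: X_def\<close>)

lemma finite_lift:
  assumes "\<And>i. i < m n \<Longrightarrow> finite {x. \<zeta> i x \<noteq> 0}"
  shows "finite {k. lift n \<zeta> k \<noteq> 0}"
proof (rule finite_subset)
  show "{k. lift n \<zeta> k \<noteq> 0} \<subseteq> (\<Union>i<m n. code n i ` {x. \<zeta> i x \<noteq> 0})"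
  proof
    fix k assume k: "k \<in> {k. lift n \<zeta> k \<noteq> 0}"
    then obtain n' i x where "(n', i, x) \<in> X" "k = code n' i x"
      using lift_out[of k n \<zeta>] by (cases k rule: code_cases) auto
    then show "k \<in> (\<Union>i<m n. code n i ` {x. \<zeta> i x \<noteq> 0})"
      using k by (auto simp: lift_code X_def split: if_splits)
  qed
qed (use assms in auto)

lemma psum_lift:
  assumes fin: "\<And>i. i < m n \<Longrightarrow> finite {x. \<zeta> i x \<noteq> 0}"
    and supp: "\<And>i x. i < m n \<Longrightarrow> x \<notin> left_cosets (L n i) \<Longrightarrow> \<zeta> i x = 0"
  shows "psum 2 (lift n \<zeta>) = (\<Sum>i<m n. psum 2 (\<zeta> i))"
proof -
  let ?h = "\<lambda>k. cmod (lift n \<zeta> k) powr 2"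
  have s: "?h summable_on B" for B
    by (rule finite_nonzero_values_imp_summable_on) (use finite_lift[OF fin] in \<open>auto intro: rev_finite_subset\<close>)
  have "psum 2 (lift n \<zeta>) = infsum ?h (\<Union>i\<in>{..<m n}. code n i ` left_cosets (L n i))"
    unfolding psum_def
  proof (rule infsum_cong_neutral)
    fix k assume k: "k \<in> UNIV - (\<Union>i\<in>{..<m n}. code n i ` left_cosets (L n i))"
    show "?h k = 0"
    proof (cases k rule: code_cases)
      case (code n' i x)
      then show ?thesis
        using k by (auto simp: lift_code X_def)
    qed (simp add: lift_out)
  qed auto
  also have "\<dots> = (\<Sum>i<m n. infsum ?h (code n i ` left_cosets (L n i)))"
    using s by (intro sum_infsum[symmetric]) (auto simp: code_inj X_def)
  also have "\<dots> = (\<Sum>i<m n. psum 2 (\<zeta> i))"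
  proof (rule sum.cong[OF refl])
    fix i assume i: "i \<in> {..<m n}"
    then have "infsum ?h (code n i ` left_cosets (L n i)) = (\<Sum>\<^sub>\<infinity>x\<in>left_cosets (L n i). ?h (code n i x))"
      by (subst infsum_reindex) (auto simp: inj_code o_def)
    also have "\<dots> = psum 2 (\<zeta> i)"
      unfolding psum_def by (rule infsum_cong_neutral) (use i supp in \<open>auto simp: lift_code X_def\<close>)
    finally show "infsum ?h (code n i ` left_cosets (L n i)) = psum 2 (\<zeta> i)" .
  qed
  finally show ?thesis .
qed

lemma lift_tau: "lift n \<zeta> (tau g k) = lift n (\<lambda>i. quasi_reg g (\<zeta> i)) k"
  by (cases k rule: code_cases) (auto simp: tau_code tau_out lift_code lift_out quasi_reg_def)

lemma lift_diff: "lift n \<zeta> k - lift n \<zeta>' k = lift n (\<lambda>i x. \<zeta> i x - \<zeta>' i x) k"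
  by (cases k rule: code_cases) (auto simp: lift_code lift_out)

text \<open>Orbits of coded points are whole coset spaces, so the condition is the vanishing sum of
  a vector orthogonal to the constants; all other orbits are single points where the lift is
  0.\<close>

lemma balanced_lift:
  assumes \<zeta>: "\<And>i. i < m n \<Longrightarrow> \<zeta> i \<in> l2_cosets_prime (L n i)"
    and fin: "\<And>i. i < m n \<Longrightarrow> finite {x. \<zeta> i x \<noteq> 0}"
  shows "balanced (lift n \<zeta>)"
  unfolding balanced_def
proof (intro conjI allI impI)
  show "finite {k. lift n \<zeta> k \<noteq> 0}"
    by (rule finite_lift[OF fin])
  fix k assume f: "finite (orb k)"
  show "(\<Sum>z\<in>orb k. lift n \<zeta> z) = 0"
  proof (cases k rule: code_cases)
    case (code n' i x)
    then have i: "i < m n'"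
      by (simp add: X_def)
    have o: "orb k = code n' i ` left_cosets (L n' i)"
      unfolding code(2) by (rule orb_code[OF code(1)])
    then have "finite (left_cosets (L n' i))"
      using f finite_image_iff[OF inj_code[OF i]] by simp
    moreover have "(\<Sum>z\<in>orb k. lift n \<zeta> z) = (\<Sum>x\<in>left_cosets (L n' i). if n' = n then \<zeta> i x else 0)"
      unfolding o by (subst sum.reindex[OF inj_code[OF i]]) (auto simp: lift_code X_def i)
    ultimately show ?thesis
      using l2_cosets_prime_sum[OF \<zeta>[of i]] i by (cases "n' = n") auto
  next
    case out
    then have "orb k = {k}"
      by (auto simp: orb_def tau_out)
    then show ?thesis
      using out by (simp add: lift_out)
  qed
qed

end

text \<open>Failure of the property requires a single representation carrying a whole sequence. The
  n-th family is almost invariant on \<open>C n\<close> up to \<open>1 / real (Suc n)\<close>, and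
  all families are placed in the one action on the naturals.\<close>

lemma weakly_contained_imp_not_property_T_lp:
  fixes G :: "'g::{topological_group_add, second_countable_topology} itself"
  assumes lc: "locally_compact_space (euclidean :: 'g topology)"
    and wc: "trivial_weakly_contained_quasi_reg TYPE('g)" and "p > 0"
  shows "\<not> property_T_lp p TYPE('g)"
proof -
  obtain C :: "nat \<Rightarrow> 'g set" where C: "\<And>n. compact (C n)"
    "\<And>K. compact K \<Longrightarrow> eventually (\<lambda>n. K \<subseteq> C n) sequentially"
    using sigma_compact_exhaustion[OF lc] by blast
  define good where "good n (m::nat) L \<xi> \<longleftrightarrow>
    (\<forall>i<m. open_subgroup (L i :: 'g set) \<and> \<xi> i \<in> l2_cosets_prime (L i) \<and> finite {x. \<xi> i x \<noteq> 0}) \<and>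
    1 / 8 \<le> (\<Sum>i<m. psum 2 (\<xi> i)) \<and> (\<Sum>i<m. psum 2 (\<xi> i)) \<le> 2 \<and>
    (\<forall>g\<in>C n. (\<Sum>i<m. psum 2 (\<lambda>x. quasi_reg g (\<xi> i) x - \<xi> i x)) \<le> 1 / real (Suc n))" for n m L \<xi>
  have "\<exists>m L \<xi>. good n m L \<xi>" for n
    unfolding good_def by (rule almost_invariant_families[OF wc C(1)]) simp
  then obtain m L \<xi> where "\<And>n. good n (m n) (L n) (\<xi> n)"
    by metis
  note fam = this[unfolded good_def]
  interpret coset_families m L
    by unfold_locales (use fam in blast)
  have \<xi>: "\<xi> n i \<in> l2_cosets_prime (L n i)" "finite {x. \<xi> n i x \<noteq> 0}"
      "\<And>x. x \<notin> left_cosets (L n i) \<Longrightarrow> \<xi> n i x = 0" if "i < m n" for n i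
    using fam[of n] that by (auto simp: l2_cosets_prime_def l2_cosets_iff)
  have norm: "psum 2 (lift n (\<xi> n)) = (\<Sum>i<m n. psum 2 (\<xi> n i))" for n
    by (rule psum_lift) (use \<xi> in auto)
  have diff: "psum 2 (\<lambda>k. lift n (\<xi> n) (tau g k) - lift n (\<xi> n) k)
      = (\<Sum>i<m n. psum 2 (\<lambda>x. quasi_reg g (\<xi> n i) x - \<xi> n i x))" for n g
    unfolding lift_tau lift_diff
  proof (rule psum_lift)
    fix i assume i: "i < m n"
    have "finite ({x. \<xi> n i x \<noteq> 0} \<union> (`) ((+) (- g)) -` {x. \<xi> n i x \<noteq> 0})"
      using \<xi>(2)[OF i] finite_vimageI[OF \<xi>(2)[OF i] bij_is_inj[OF bij_translate]] by simp
    then show "finite {x. quasi_reg g (\<xi> n i) x - \<xi> n i x \<noteq> 0}"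
      by (rule rev_finite_subset) (auto simp: quasi_reg_def)
    show "quasi_reg g (\<xi> n i) x - \<xi> n i x = 0" if "x \<notin> left_cosets (L n i)" for x
      using that \<xi>(3)[OF i] by (simp add: quasi_reg_def left_cosets_translate)
  qed
  show ?thesis
  proof (rule not_property_T_lp_of_action[OF right_action_axioms \<open>p > 0\<close>, of "\<lambda>n. lift n (\<xi> n)" "1 / 8"])
    show "balanced (lift n (\<xi> n))" for n
      by (rule balanced_lift) (use \<xi> in auto)
    show "1 / 8 \<le> psum 2 (lift n (\<xi> n))" "psum 2 (lift n (\<xi> n)) \<le> 2" for n
      using fam[of n] unfolding norm by blast+
    fix K :: "'g set" and e :: real
    assume "compact K" "e > 0"
    obtain N :: nat where N: "1 / real (Suc N) < e"
      using nat_approx_posE[OF \<open>e > 0\<close>] by blast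
    have "eventually (\<lambda>n. n \<ge> N \<and> K \<subseteq> C n) sequentially"
      by (intro eventually_conj eventually_ge_at_top C \<open>compact K\<close>)
    then show "eventually (\<lambda>n. \<forall>g\<in>K. psum 2 (\<lambda>x. lift n (\<xi> n) (tau g x) - lift n (\<xi> n) x) < e) sequentially"
    proof (rule eventually_mono, intro ballI)
      fix n g assume n: "n \<ge> N \<and> K \<subseteq> C n" and "g \<in> K"
      then have "psum 2 (\<lambda>x. lift n (\<xi> n) (tau g x) - lift n (\<xi> n) x) \<le> 1 / real (Suc n)"
        using fam[of n] unfolding diff by blast
      also have "\<dots> \<le> 1 / real (Suc N)"
        using n by (simp add: divide_simps)
      finally show "psum 2 (\<lambda>x. lift n (\<xi> n) (tau g x) - lift n (\<xi> n) x) < e"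
        using N by simp
    qed
  qed simp
qed

theorem theorem1p4:
  fixes G :: "'g::{topological_group_add, second_countable_topology} itself"
  assumes "locally_compact_space (euclidean :: 'g topology)"
    and "totally_disconnected_group G"
  shows "(\<exists>p::real. 1 < p \<and> p \<noteq> 2 \<and> property_T_lp p G) \<longleftrightarrow> property_T_quasi_reg G"
proof
  assume "\<exists>p::real. 1 < p \<and> p \<noteq> 2 \<and> property_T_lp p G"
  then obtain p :: real where "1 < p" "property_T_lp p TYPE('g)"
    by (auto simp: property_T_lp_def)
  then have "property_T_quasi_reg TYPE('g)"
    using weakly_contained_imp_not_property_T_lp[OF assms(1), of p]
    unfolding property_T_quasi_reg_def by auto
  then show "property_T_quasi_reg G"
    unfolding property_T_quasi_reg_def trivial_weakly_contained_quasi_reg_def .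
next
  assume "property_T_quasi_reg G"
  then have "property_T_quasi_reg TYPE('g)"
    unfolding property_T_quasi_reg_def trivial_weakly_contained_quasi_reg_def .
  moreover have "totally_disconnected_group TYPE('g)"
    using assms(2) unfolding totally_disconnected_group_def .
  ultimately have "property_T_lp 4 TYPE('g)"
    by (intro property_T_quasi_reg_imp_lp_4[OF assms(1)])
  then have "property_T_lp 4 G"
    unfolding property_T_lp_def .
  then show "\<exists>p::real. 1 < p \<and> p \<noteq> 2 \<and> property_T_lp p G"
    by (intro exI[of _ 4]) simp
qed

end
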